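(* Assume the Markov semigroup $(P_t)$ on the Polish space $(E,\rho)$ is Feller, and that: (1) there exist a measurable $V:E\to[0,\infty)$, a concave differentiable function $\phi:\mathbb R_+\to\mathbb R_+$ increasing to infinity with $\phi(0)=0$, and a constant $K>0$ such that $P_tV(x)\le V(x)-\int_0^tP_s(\phi\circ V)(x)\,ds+Kt$ for all $t\ge0$, $x\in E$; (2) $\rho\wedge1\le\theta$ for a premetric $\theta$; (3) Assumption A holds (with this $\theta$) for some functions $r,L$; (4) there exists $t_0>0$ such that for any $M>0$, Assumption B1 holds for $B=\{V\le M\}$ and $t_0$. Then $(P_t)$ has a unique invariant probability measure $\pi$, and for any $\delta\in(0,1)$ there exist constants $C_1,C_2>0$ such that for all $x\in E$ and $t\ge0$, $$W_{\rho\wedge1}(P_t(x,\cdot),\pi)\le\frac{C_1(1+\phi(V(x))^\delta)}{\phi(H_\phi^{-1}(C_2t))^\delta},$$ where $H_\phi(x):=\int_1^x\frac{du}{\phi(u)}$, $x\ge1$.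
   Context: $(E,\rho)$ is a Polish space with Borel $\sigma$-field $\mathcal E$; $\{P_t\}_{t\ge0}$ is a Markov transition function with semigroup $P_t\phi(x)=\int\phi(y)P_t(x,dy)$ and $\mathbb P_x$ the law of the corresponding Markov process started at $x$. Feller means $P_t$ maps bounded continuous functions to bounded continuous functions. A premetric is a lower semicontinuous $\theta:E\times E\to\mathbb R_+$ with $\theta(x,y)=0\iff x=y$. For a distance-like (symmetric, lower semicontinuous, vanishing exactly on the diagonal) or metric $d$, $W_d(\mu,\nu):=\inf\int d\,d\lambda$ over couplings $\lambda$ of $\mu,\nu$; $d_{TV}(\mu,\nu)=\sup_A|\mu(A)-\nu(A)|$. Assumption A: there exist a non-increasing $r:\mathbb R_+\to\mathbb R_+$ with $r(t)\to0$ and a locally bounded $L:\mathbb R_+\to\mathbb R_+$ such that for any $x,y\in E$ there exist random processes $X^{x,y},Y^{x,y}$ on a common probability space with (1) $\mathrm{Law}(X^{x,y})=\mathbb P_x$ and $d_{TV}(\mathrm{Law}(Y^{x,y}_t),P_t(y,\cdot))\le L(t)\theta(x,y)$, $t\ge0$; (2) $\mathbb E\theta(X^{x,y}_t,Y^{x,y}_t)\le r(t)\theta(x,y)$, $t\ge0$. Assumption B1 (for a set $B$ and $t_0>0$): for any $\varepsilon>0$ there is a measurable $D$ with $\inf_{x\in B}P_{t_0}(x,D)>0$ and $\sup_{x,y\in D}\theta(x,y)\le\varepsilon$. *)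

theory Defs
  imports "HOL-Probability.Probability"
begin

text \<open>The Polish space (E, rho) is a type of class polish_space with rho = dist,
  and its Borel sigma-field is borel.  Time parameter ranges over t >= 0.\<close>

definition markov_tf :: "(real \<Rightarrow> 'a::topological_space \<Rightarrow> 'a measure) \<Rightarrow> bool" where
  "markov_tf P \<longleftrightarrow>
     (\<forall>t\<ge>0. \<forall>x. prob_space (P t x) \<and> sets (P t x) = sets borel) \<and>
     (\<forall>t\<ge>0. \<forall>A\<in>sets borel. (\<lambda>x. emeasure (P t x) A) \<in> borel_measurable borel) \<and>
     (\<forall>x. P 0 x = return borel x) \<and>
     (\<forall>s\<ge>0. \<forall>t\<ge>0. \<forall>x. \<forall>A\<in>sets borel.
        emeasure (P (s + t) x) A = (\<integral>\<^sup>+ y. emeasure (P t y) A \<partial>P s x))"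

definition feller :: "(real \<Rightarrow> 'a::topological_space \<Rightarrow> 'a measure) \<Rightarrow> bool" where
  "feller P \<longleftrightarrow>
     (\<forall>t\<ge>0. \<forall>f::'a \<Rightarrow> real. continuous_on UNIV f \<and> bounded (range f) \<longrightarrow>
        continuous_on UNIV (\<lambda>x. \<integral>y. f y \<partial>P t x) \<and> bounded (range (\<lambda>x. \<integral>y. f y \<partial>P t x)))"

text \<open>Finite-dimensional distributions of the Markov process started at x:
  the list [(h0,A0),(h1,A1),...] stands for the event
  X_{t0} in A0, X_{t1} in A1, ... with t_i = h0 + ... + h_i.\<close>
fun mkv_fdd :: "(real \<Rightarrow> 'a \<Rightarrow> 'a measure) \<Rightarrow> 'a \<Rightarrow> (real \<times> 'a set) list \<Rightarrow> ennreal" where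
  "mkv_fdd P x [] = 1"
| "mkv_fdd P x ((h, A) # rest) = (\<integral>\<^sup>+ y. indicator A y * mkv_fdd P y rest \<partial>P h x)"

text \<open>Law(X) = P_x: the process X on the probability space M is a Markov process
  with transition function P started at x (equality of the laws on the product
  sigma-field over times t >= 0, i.e. equality of all finite-dimensional distributions).\<close>
definition has_markov_law ::
  "(real \<Rightarrow> 'a::topological_space \<Rightarrow> 'a measure) \<Rightarrow> 'a \<Rightarrow> 'w measure \<Rightarrow> (real \<Rightarrow> 'w \<Rightarrow> 'a) \<Rightarrow> bool" where
  "has_markov_law P x M X \<longleftrightarrow>
     prob_space M \<and> (\<forall>t\<ge>0. X t \<in> measurable M borel) \<and>
     (\<forall>l. (\<forall>i<length l. fst (l ! i) \<ge> 0 \<and> snd (l ! i) \<in> sets borel) \<longrightarrow>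
        emeasure M {\<omega>\<in>space M. \<forall>i<length l. X (\<Sum>j\<le>i. fst (l ! j)) \<omega> \<in> snd (l ! i)}
          = mkv_fdd P x l)"

definition premetric :: "('a::topological_space \<Rightarrow> 'a \<Rightarrow> real) \<Rightarrow> bool" where
  "premetric \<theta> \<longleftrightarrow>
     (\<forall>c. open {p::'a \<times> 'a. c < \<theta> (fst p) (snd p)}) \<and>
     (\<forall>x y. \<theta> x y \<ge> 0) \<and> (\<forall>x y. \<theta> x y = 0 \<longleftrightarrow> x = y)"

definition dTV :: "'a measure \<Rightarrow> 'a measure \<Rightarrow> real" where
  "dTV \<mu> \<nu> = (SUP A\<in>sets \<mu>. \<bar>measure \<mu> A - measure \<nu> A\<bar>)"

definition couplings :: "'a::topological_space measure \<Rightarrow> 'a measure \<Rightarrow> ('a \<times> 'a) measure set" where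
  "couplings \<mu> \<nu> = {c. sets c = sets (borel \<Otimes>\<^sub>M borel) \<and> prob_space c \<and>
      distr c borel fst = \<mu> \<and> distr c borel snd = \<nu>}"

definition wasserstein :: "('a::topological_space \<Rightarrow> 'a \<Rightarrow> real) \<Rightarrow> 'a measure \<Rightarrow> 'a measure \<Rightarrow> ennreal" where
  "wasserstein d \<mu> \<nu> = (INF c\<in>couplings \<mu> \<nu>. \<integral>\<^sup>+ z. ennreal (d (fst z) (snd z)) \<partial>c)"

definition invariant_prob :: "(real \<Rightarrow> 'a::topological_space \<Rightarrow> 'a measure) \<Rightarrow> 'a measure \<Rightarrow> bool" where
  "invariant_prob P \<pi> \<longleftrightarrow> prob_space \<pi> \<and> sets \<pi> = sets borel \<and>
     (\<forall>t\<ge>0. \<forall>A\<in>sets borel. (\<integral>\<^sup>+ x. emeasure (P t x) A \<partial>\<pi>) = emeasure \<pi> A)"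

definition assumption_A ::
  "'w itself \<Rightarrow> (real \<Rightarrow> 'a::topological_space \<Rightarrow> 'a measure) \<Rightarrow> ('a \<Rightarrow> 'a \<Rightarrow> real)
     \<Rightarrow> (real \<Rightarrow> real) \<Rightarrow> (real \<Rightarrow> real) \<Rightarrow> bool" where
  "assumption_A (_::'w itself) P \<theta> r L \<longleftrightarrow>
     (\<forall>s\<ge>0. r s \<ge> 0) \<and> antimono_on {0..} r \<and> (r \<longlongrightarrow> 0) at_top \<and>
     (\<forall>s\<ge>0. L s \<ge> 0) \<and> (\<forall>T\<ge>0. bounded (L ` {0..T})) \<and>
     (\<forall>x y. \<exists>(M::'w measure) X Y.
        has_markov_law P x M X \<and> (\<forall>t\<ge>0. Y t \<in> measurable M borel) \<and>
        (\<forall>t\<ge>0. dTV (distr M borel (Y t)) (P t y) \<le> L t * \<theta> x y) \<and>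
        (\<forall>t\<ge>0. (\<integral>\<^sup>+ \<omega>. ennreal (\<theta> (X t \<omega>) (Y t \<omega>)) \<partial>M) \<le> ennreal (r t * \<theta> x y)))"

definition assumption_B1 ::
  "(real \<Rightarrow> 'a::topological_space \<Rightarrow> 'a measure) \<Rightarrow> ('a \<Rightarrow> 'a \<Rightarrow> real) \<Rightarrow> 'a set \<Rightarrow> real \<Rightarrow> bool" where
  "assumption_B1 P \<theta> B t0 \<longleftrightarrow>
     (\<forall>\<epsilon>>0. \<exists>D\<in>sets borel. (\<exists>c>0. \<forall>x\<in>B. measure (P t0 x) D \<ge> c) \<and>
        (\<forall>x\<in>D. \<forall>y\<in>D. \<theta> x y \<le> \<epsilon>))"

definition H_phi :: "(real \<Rightarrow> real) \<Rightarrow> real \<Rightarrow> real" where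
  "H_phi \<phi> x = integral {1..x} (\<lambda>u. 1 / \<phi> u)"

definition H_phi_inv :: "(real \<Rightarrow> real) \<Rightarrow> real \<Rightarrow> real" where
  "H_phi_inv \<phi> s = (THE y. y \<ge> 1 \<and> H_phi \<phi> y = s)"

end

theory Submission
  imports Defs
begin

text \<open>
  Everything is done on the dual side: for a function f that is 1-Lipschitz for min(dist, 1) we
  bound the oscillation of P_t f, which needs couplings of P_t(x, .) and P_t(y, .) only for fixed
  x, y and hence no measurable selection. Kantorovich duality then returns to the Wasserstein
  distance.

  With h = t0 + T for a large T and d = min(1, N theta) for a large N, Assumption A contracts d
  on pairs with d < 1, and B1 contracts it on pairs in a sublevel set of the Lyapunov function v.
  By Hoelder's inequality the oscillation bounds |f x - f y| <= d(x, y)^(1-q) (J x + J y)^q are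
  propagated by P_h, for weights J = b^n w(v) + (gamma + v)/s truncated at a level s: the first
  summand decays geometrically at a rate proportional to phi'(s) as long as v stays below s,
  because w(u) = exp(l H(u)) is concave on [1, s] when l is at most phi'(s); the second summand
  exceeds 1 as soon as v exceeds s.
  Choosing phi(s) = phi(v)^(1-q) phi(R)^q with H(R) proportional to the time and using
  phi'(s) (H(R) - H(s)) >= ln (phi(R) / phi(s)) makes both summands at most a constant times
  (phi(v) / phi(R))^q, which is the claimed rate with delta = q^2.

  Summing the drift inequality along the skeleton chain bounds the time averages of the moments of
  phi(v). Hence for every d there is a k such that these moments are bounded both at step k and at
  step k + d, and comparing steps n and n + d through step n + d + k shows that the laws
  of the chain form a Cauchy sequence for the dual distance. Transport kernels between the terms of
  a fast subsequence glue, by the Ionescu-Tulcea theorem, to an almost surely convergent sequence of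
  random points, and the law of the limit is the invariant measure.
\<close>

section \<open>Borel distributions, kernels and couplings\<close>

locale borel_distribution = prob_space M for M :: "'a::topological_space measure" +
  assumes sets_eq_borel [simp, measurable_cong]: "sets M = sets borel"
begin

lemma space_eq_UNIV [simp]: "space M = UNIV"
  using sets_eq_imp_space_eq[OF sets_eq_borel] by simp

lemma emeasure_UNIV [simp]: "emeasure M UNIV = 1" and prob_UNIV [simp]: "prob UNIV = 1"
  using emeasure_space_1 prob_space by simp_all

end

lemma in_prob_algebra_borel_iff: "\<mu> \<in> space (prob_algebra borel) \<longleftrightarrow> borel_distribution \<mu>"
  by (auto simp: space_prob_algebra borel_distribution_def borel_distribution_axioms_def)

lemma borel_distribution_kernel:
  "\<kappa> \<in> N \<rightarrow>\<^sub>M prob_algebra borel \<Longrightarrow> x \<in> space N \<Longrightarrow> borel_distribution (\<kappa> x)"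
  using measurable_space[of \<kappa> N "prob_algebra borel"] by (simp add: in_prob_algebra_borel_iff)

lemma borel_distribution_distr:
  assumes "prob_space M" "X \<in> M \<rightarrow>\<^sub>M borel"
  shows "borel_distribution (distr M borel X)"
  using prob_space.prob_space_distr[OF assms] by (simp add: borel_distribution_def borel_distribution_axioms_def)

context
  fixes M :: "'w measure" and \<kappa> :: "'w \<Rightarrow> 'a::topological_space measure"
  assumes M: "prob_space M" and \<kappa>: "\<kappa> \<in> M \<rightarrow>\<^sub>M prob_algebra borel"
begin

lemma borel_distribution_bind: "borel_distribution (M \<bind> \<kappa>)"
proof -
  have "M \<in> space (prob_algebra M)" using M by (simp add: space_prob_algebra)
  then show ?thesis
    using prob_space_bind'[OF _ \<kappa>] sets_bind'[OF _ \<kappa>] in_prob_algebra_borel_iff[of "M \<bind> \<kappa>"]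
    by (simp add: space_prob_algebra)
qed

lemma nn_integral_bind_kernel:
  "f \<in> borel_measurable borel \<Longrightarrow> (\<integral>\<^sup>+y. f y \<partial>(M \<bind> \<kappa>)) = (\<integral>\<^sup>+\<omega>. \<integral>\<^sup>+y. f y \<partial>\<kappa> \<omega> \<partial>M)"
  by (rule nn_integral_bind) (use measurable_prob_algebraD[OF \<kappa>] in auto)

lemma integral_bind_kernel:
  fixes f :: "'a \<Rightarrow> real"
  assumes "f \<in> borel_measurable borel" "\<And>y. \<bar>f y\<bar> \<le> B"
  shows "(\<integral>y. f y \<partial>(M \<bind> \<kappa>)) = (\<integral>\<omega>. (\<integral>y. f y \<partial>\<kappa> \<omega>) \<partial>M)"
proof (rule integral_bind[where K=borel and B'=1])
  show "finite_measure M" by (rule prob_space.finite_measure[OF M])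
  have "emeasure (\<kappa> \<omega>) (space (\<kappa> \<omega>)) \<le> ennreal 1" if "\<omega> \<in> space M" for \<omega>
  proof -
    interpret borel_distribution "\<kappa> \<omega>" by (rule borel_distribution_kernel[OF \<kappa> that])
    show ?thesis by simp
  qed
  then show "AE \<omega> in M. emeasure (\<kappa> \<omega>) (space (\<kappa> \<omega>)) \<le> ennreal 1" by simp
qed (use assms measurable_prob_algebraD[OF \<kappa>] in auto)

end

definition kernel_joint ::
    "'w measure \<Rightarrow> ('w \<Rightarrow> 'a::topological_space) \<Rightarrow> ('w \<Rightarrow> 'a measure) \<Rightarrow> ('a \<times> 'a) measure"
  where "kernel_joint M X \<kappa> = M \<bind> (\<lambda>\<omega>. distr (\<kappa> \<omega>) (borel \<Otimes>\<^sub>M borel) (Pair (X \<omega>)))"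

context
  fixes M :: "'w measure" and X :: "'w \<Rightarrow> 'a::topological_space" and \<kappa> :: "'w \<Rightarrow> 'a measure"
  assumes M: "prob_space M" and X [measurable]: "X \<in> M \<rightarrow>\<^sub>M borel"
    and \<kappa> [measurable]: "\<kappa> \<in> M \<rightarrow>\<^sub>M prob_algebra borel"
begin

lemma kernel_joint_section_kernel:
  "(\<lambda>\<omega>. distr (\<kappa> \<omega>) (borel \<Otimes>\<^sub>M borel) (Pair (X \<omega>))) \<in> M \<rightarrow>\<^sub>M prob_algebra (borel \<Otimes>\<^sub>M borel)"
  by measurable

lemma prob_space_kernel_joint: "prob_space (kernel_joint M X \<kappa>)"
  and sets_kernel_joint: "sets (kernel_joint M X \<kappa>) = sets (borel \<Otimes>\<^sub>M borel)"
proof -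
  have M_space: "M \<in> space (prob_algebra M)" using M by (simp add: space_prob_algebra)
  show "prob_space (kernel_joint M X \<kappa>)" "sets (kernel_joint M X \<kappa>) = sets (borel \<Otimes>\<^sub>M borel)"
    unfolding kernel_joint_def
    by (rule prob_space_bind'[OF M_space kernel_joint_section_kernel]
        sets_bind'[OF M_space kernel_joint_section_kernel])+
qed

lemma nn_integral_kernel_joint:
  assumes F: "F \<in> borel_measurable (borel \<Otimes>\<^sub>M borel)"
  shows "(\<integral>\<^sup>+z. F z \<partial>kernel_joint M X \<kappa>) = (\<integral>\<^sup>+\<omega>. \<integral>\<^sup>+y. F (X \<omega>, y) \<partial>\<kappa> \<omega> \<partial>M)"
proof -
  have "(\<integral>\<^sup>+z. F z \<partial>distr (\<kappa> \<omega>) (borel \<Otimes>\<^sub>M borel) (Pair (X \<omega>))) = (\<integral>\<^sup>+y. F (X \<omega>, y) \<partial>\<kappa> \<omega>)"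
    if "\<omega> \<in> space M" for \<omega>
  proof -
    interpret borel_distribution "\<kappa> \<omega>" by (rule borel_distribution_kernel[OF \<kappa> that])
    show ?thesis by (subst nn_integral_distr) (use F in auto)
  qed
  then show ?thesis
    unfolding kernel_joint_def nn_integral_bind[OF F measurable_prob_algebraD[OF kernel_joint_section_kernel]]
    by (rule nn_integral_cong)
qed

lemma distr_kernel_joint_fst: "distr (kernel_joint M X \<kappa>) borel fst = distr M borel X"
proof (rule measure_eqI)
  note [measurable_cong] = sets_kernel_joint
  fix A assume "A \<in> sets (distr (kernel_joint M X \<kappa>) borel fst)"
  then have [measurable]: "A \<in> sets borel" by simp
  have mass: "(\<integral>\<^sup>+y. indicator A (X \<omega>) \<partial>\<kappa> \<omega>) = indicator A (X \<omega>)" if "\<omega> \<in> space M" for \<omega>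
    using prob_space.emeasure_space_1 borel_distribution_kernel[OF \<kappa> that]
    by (force simp: borel_distribution_def)
  have "emeasure (distr (kernel_joint M X \<kappa>) borel fst) A
      = (\<integral>\<^sup>+x. indicator A x \<partial>distr (kernel_joint M X \<kappa>) borel fst)"
    by simp
  also have "\<dots> = (\<integral>\<^sup>+z. indicator A (fst z) \<partial>kernel_joint M X \<kappa>)"
    by (rule nn_integral_distr) measurable
  also have "\<dots> = (\<integral>\<^sup>+\<omega>. \<integral>\<^sup>+y. indicator A (X \<omega>) \<partial>\<kappa> \<omega> \<partial>M)"
    by (subst nn_integral_kernel_joint) auto
  also have "\<dots> = (\<integral>\<^sup>+\<omega>. indicator A (X \<omega>) \<partial>M)"
    by (rule nn_integral_cong) (rule mass)
  also have "\<dots> = (\<integral>\<^sup>+x. indicator A x \<partial>distr M borel X)"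
    by (rule nn_integral_distr[symmetric]) measurable
  finally show "emeasure (distr (kernel_joint M X \<kappa>) borel fst) A = emeasure (distr M borel X) A" by simp
qed simp

lemma distr_kernel_joint_snd: "distr (kernel_joint M X \<kappa>) borel snd = M \<bind> \<kappa>"
proof (rule measure_eqI)
  note [measurable_cong] = sets_kernel_joint
  interpret bind: borel_distribution "M \<bind> \<kappa>" by (rule borel_distribution_bind[OF M \<kappa>])
  show "sets (distr (kernel_joint M X \<kappa>) borel snd) = sets (M \<bind> \<kappa>)" by simp
  fix A assume "A \<in> sets (distr (kernel_joint M X \<kappa>) borel snd)"
  then have [measurable]: "A \<in> sets borel" by simp
  have "emeasure (distr (kernel_joint M X \<kappa>) borel snd) A
      = (\<integral>\<^sup>+x. indicator A x \<partial>distr (kernel_joint M X \<kappa>) borel snd)"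
    by simp
  also have "\<dots> = (\<integral>\<^sup>+z. indicator A (snd z) \<partial>kernel_joint M X \<kappa>)"
    by (rule nn_integral_distr) measurable
  also have "\<dots> = (\<integral>\<^sup>+\<omega>. \<integral>\<^sup>+y. indicator A y \<partial>\<kappa> \<omega> \<partial>M)"
    by (subst nn_integral_kernel_joint) auto
  also have "\<dots> = (\<integral>\<^sup>+y. indicator A y \<partial>(M \<bind> \<kappa>))"
    by (rule nn_integral_bind_kernel[OF M \<kappa>, symmetric]) simp
  finally show "emeasure (distr (kernel_joint M X \<kappa>) borel snd) A = emeasure (M \<bind> \<kappa>) A" by simp
qed

lemma kernel_joint_coupling: "kernel_joint M X \<kappa> \<in> couplings (distr M borel X) (M \<bind> \<kappa>)"
  by (simp add: couplings_def prob_space_kernel_joint sets_kernel_joint distr_kernel_joint_fst distr_kernel_joint_snd)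

end

lemma product_coupling:
  assumes "borel_distribution \<mu>" "borel_distribution \<nu>"
  shows "\<mu> \<Otimes>\<^sub>M \<nu> \<in> couplings \<mu> \<nu>"
proof -
  interpret \<mu>: borel_distribution \<mu> by fact
  interpret \<nu>: borel_distribution \<nu> by fact
  interpret pair_prob_space \<mu> \<nu> ..
  have "distr (\<mu> \<Otimes>\<^sub>M \<nu>) borel fst = distr (\<mu> \<Otimes>\<^sub>M \<nu>) \<mu> fst"
    by (rule distr_cong) auto
  then have fst: "distr (\<mu> \<Otimes>\<^sub>M \<nu>) borel fst = \<mu>" by (simp only: \<nu>.distr_pair_fst)
  have "distr (\<mu> \<Otimes>\<^sub>M \<nu>) borel snd = distr (distr (\<nu> \<Otimes>\<^sub>M \<mu>) (\<mu> \<Otimes>\<^sub>M \<nu>) (\<lambda>(x, y). (y, x))) borel snd"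
    by (rule arg_cong[where f="\<lambda>M. distr M borel snd"]) (rule distr_pair_swap)
  also have "\<dots> = distr (\<nu> \<Otimes>\<^sub>M \<mu>) \<nu> fst"
    by (subst distr_distr) (auto intro!: distr_cong)
  finally have "distr (\<mu> \<Otimes>\<^sub>M \<nu>) borel snd = \<nu>" by (simp only: \<mu>.distr_pair_fst)
  with fst show ?thesis
    by (simp add: couplings_def prob_space_axioms sets_pair_measure_cong[OF \<mu>.sets_eq_borel \<nu>.sets_eq_borel])
qed

lemma couplingsD:
  assumes "c \<in> couplings \<mu> \<nu>"
  shows "prob_space c" "sets c = sets (borel \<Otimes>\<^sub>M borel)" "distr c borel fst = \<mu>" "distr c borel snd = \<nu>"
  using assms by (auto simp: couplings_def)

context
  fixes c :: "('a::topological_space \<times> 'a) measure" and \<mu> \<nu>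
  assumes c: "c \<in> couplings \<mu> \<nu>"
begin

private lemma projections_measurable: "fst \<in> c \<rightarrow>\<^sub>M borel" "snd \<in> c \<rightarrow>\<^sub>M borel"
  by (simp_all add: measurable_cong_sets[OF couplingsD(2)[OF c] refl])

lemma coupling_integrable:
  fixes f :: "'a \<Rightarrow> real"
  shows "integrable \<mu> f \<Longrightarrow> integrable c (\<lambda>z. f (fst z))" "integrable \<nu> f \<Longrightarrow> integrable c (\<lambda>z. f (snd z))"
  unfolding couplingsD(3,4)[OF c, symmetric] by (erule integrable_distr[rotated], rule projections_measurable)+

lemma coupling_integral:
  fixes f :: "'a \<Rightarrow> real"
  assumes "f \<in> borel_measurable borel"
  shows "(\<integral>z. f (fst z) \<partial>c) = (\<integral>x. f x \<partial>\<mu>)" "(\<integral>z. f (snd z) \<partial>c) = (\<integral>x. f x \<partial>\<nu>)"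
  using projections_measurable assms unfolding couplingsD(3,4)[OF c, symmetric]
  by (simp_all add: integral_distr)

lemma coupling_integral_diff_le:
  fixes g :: "'a \<Rightarrow> real"
  assumes g: "integrable \<mu> g" "integrable \<nu> g" "g \<in> borel_measurable borel"
    and \<Psi>: "integrable c \<Psi>" "\<And>x y. \<bar>g x - g y\<bar> \<le> \<Psi> (x, y)"
  shows "\<bar>(\<integral>x. g x \<partial>\<mu>) - (\<integral>x. g x \<partial>\<nu>)\<bar> \<le> (\<integral>z. \<Psi> z \<partial>c)"
proof -
  note int = coupling_integrable(1)[OF g(1)] coupling_integrable(2)[OF g(2)]
  have "\<bar>(\<integral>x. g x \<partial>\<mu>) - (\<integral>x. g x \<partial>\<nu>)\<bar> = \<bar>\<integral>z. g (fst z) - g (snd z) \<partial>c\<bar>"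
    using int by (simp add: coupling_integral[OF g(3)])
  also have "\<dots> \<le> (\<integral>z. \<bar>g (fst z) - g (snd z)\<bar> \<partial>c)" by (rule integral_abs_bound)
  also have "\<dots> \<le> (\<integral>z. \<Psi> z \<partial>c)"
    using int \<Psi>(1) \<Psi>(2)[of "fst z" "snd z" for z] by (intro integral_mono) auto
  finally show ?thesis .
qed

end

lemma wasserstein_coupling:
  assumes "wasserstein d \<mu> \<nu> \<le> ennreal A" "0 < \<epsilon>" "0 \<le> A"
  obtains c where "c \<in> couplings \<mu> \<nu>" "(\<integral>\<^sup>+z. ennreal (d (fst z) (snd z)) \<partial>c) \<le> ennreal (A + \<epsilon>)"
proof -
  have "wasserstein d \<mu> \<nu> < ennreal (A + \<epsilon>)"
    using assms by (auto intro: le_less_trans simp: ennreal_less_iff)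
  then show ?thesis
    unfolding wasserstein_def INF_less_iff by (auto intro: that less_imp_le)
qed

lemma wasserstein_le_1:
  assumes "borel_distribution \<mu>" "borel_distribution \<nu>" "\<And>x y. d x y \<le> 1"
  shows "wasserstein d \<mu> \<nu> \<le> 1"
proof -
  have c: "\<mu> \<Otimes>\<^sub>M \<nu> \<in> couplings \<mu> \<nu>" by (rule product_coupling[OF assms(1,2)])
  interpret prob_space "\<mu> \<Otimes>\<^sub>M \<nu>" by (rule couplingsD(1)[OF c])
  have "wasserstein d \<mu> \<nu> \<le> (\<integral>\<^sup>+z. ennreal (d (fst z) (snd z)) \<partial>(\<mu> \<Otimes>\<^sub>M \<nu>))"
    unfolding wasserstein_def by (rule INF_lower[OF c])
  also have "\<dots> \<le> (\<integral>\<^sup>+z. 1 \<partial>(\<mu> \<Otimes>\<^sub>M \<nu>))"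
    using assms(3) by (intro nn_integral_mono) simp
  finally show ?thesis by (simp add: emeasure_space_1)
qed

section \<open>Couplings realising the total variation distance\<close>

lemma nn_integral_uniform_threshold:
  fixes r :: real and a b :: ennreal
  assumes "0 \<le> r" "r \<le> 1"
  shows "(\<integral>\<^sup>+u. (if u \<le> r then a else b) \<partial>uniform_measure lborel {0..1}) = ennreal r * a + ennreal (1 - r) * b"
proof -
  have "(\<integral>\<^sup>+u. (if u \<le> r then a else b) \<partial>uniform_measure lborel {0..1::real})
      = (\<integral>\<^sup>+u. (if u \<le> r then a else b) * indicator {0..1} u \<partial>lborel) / emeasure lborel {0..1::real}"
    by (rule nn_integral_uniform_measure) auto
  also have "\<dots> = (\<integral>\<^sup>+u. a * indicator {0..r} u + b * indicator {r<..1} u \<partial>lborel)"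
    using assms by (auto intro!: nn_integral_cong simp: divide_ennreal_def split: split_indicator)
  also have "\<dots> = a * emeasure lborel {0..r} + b * emeasure lborel {r<..1}"
    by (simp add: nn_integral_add nn_integral_cmult_indicator)
  also have "\<dots> = ennreal r * a + ennreal (1 - r) * b"
    using assms by (simp add: mult.commute)
  finally show ?thesis .
qed

lemma (in finite_measure) absolutely_continuous_real_density:
  assumes "finite_measure \<mu>" "sets \<mu> = sets M" "absolutely_continuous M \<mu>"
  obtains a where "a \<in> borel_measurable M" "\<And>x. 0 \<le> (a x :: real)" "\<mu> = density M (\<lambda>x. ennreal (a x))"
proof -
  obtain a where a: "a \<in> borel_measurable M" "AE x in M. RN_deriv M \<mu> x = ennreal (a x)" "\<And>x. 0 \<le> a x"
    using real_RN_deriv[OF assms(1,3,2)] by metis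
  have "\<mu> = density M (RN_deriv M \<mu>)" by (rule density_RN_deriv[OF assms(3,2), symmetric])
  also have "\<dots> = density M (\<lambda>x. ennreal (a x))" using a by (intro density_cong) auto
  finally show ?thesis using that a by blast
qed

lemma borel_distributions_common_density:
  assumes "borel_distribution \<mu>" "borel_distribution \<nu>"
  obtains \<sigma> a b where "sets \<sigma> = sets borel"
    "a \<in> borel_measurable borel" "\<And>x. 0 \<le> (a x :: real)" "\<mu> = density \<sigma> (\<lambda>x. ennreal (a x))"
    "b \<in> borel_measurable borel" "\<And>x. 0 \<le> (b x :: real)" "\<nu> = density \<sigma> (\<lambda>x. ennreal (b x))"
proof -
  interpret \<mu>: borel_distribution \<mu> by fact
  interpret \<nu>: borel_distribution \<nu> by fact
  define \<sigma> where "\<sigma> = measure_pmf (bernoulli_pmf (1/2)) \<bind> (\<lambda>c. if c then \<mu> else \<nu>)"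
  have kernel: "(\<lambda>c. if c then \<mu> else \<nu>) \<in> measure_pmf (bernoulli_pmf (1/2)) \<rightarrow>\<^sub>M prob_algebra borel"
    using assms by (auto simp: in_prob_algebra_borel_iff)
  interpret \<sigma>: borel_distribution \<sigma>
    unfolding \<sigma>_def by (rule borel_distribution_bind[OF prob_space_measure_pmf kernel])
  have "emeasure \<sigma> A = ennreal (1/2) * emeasure \<mu> A + ennreal (1/2) * emeasure \<nu> A" if "A \<in> sets borel" for A
    unfolding \<sigma>_def using that measurable_prob_algebraD[OF kernel]
    by (subst emeasure_bind) (auto simp: nn_integral_bernoulli_pmf mult.commute)
  then have ac: "absolutely_continuous \<sigma> \<mu>" "absolutely_continuous \<sigma> \<nu>"
    by (auto simp: absolutely_continuous_def null_sets_def)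
  have meas: "borel_measurable \<sigma> = borel_measurable borel" by (rule measurable_cong_sets) simp_all
  obtain a where a: "a \<in> borel_measurable \<sigma>" "\<And>x. 0 \<le> (a x :: real)" "\<mu> = density \<sigma> (\<lambda>x. ennreal (a x))"
    by (rule \<sigma>.absolutely_continuous_real_density[OF \<mu>.finite_measure_axioms _ ac(1)]) auto
  obtain b where b: "b \<in> borel_measurable \<sigma>" "\<And>x. 0 \<le> (b x :: real)" "\<nu> = density \<sigma> (\<lambda>x. ennreal (b x))"
    by (rule \<sigma>.absolutely_continuous_real_density[OF \<nu>.finite_measure_axioms _ ac(2)]) auto
  show ?thesis using that[OF \<sigma>.sets_eq_borel _ a(2,3) _ b(2,3)] a(1) b(1) by (simp add: meas)
qed

lemma measure_diff_le_dTV: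
  assumes "borel_distribution \<mu>" "borel_distribution \<nu>" "A \<in> sets borel"
  shows "measure \<mu> A - measure \<nu> A \<le> dTV \<mu> \<nu>"
proof -
  interpret \<mu>: borel_distribution \<mu> by fact
  interpret \<nu>: borel_distribution \<nu> by fact
  have "\<bar>measure \<mu> B - measure \<nu> B\<bar> \<le> 1" for B
    using \<mu>.prob_le_1[of B] \<nu>.prob_le_1[of B] measure_nonneg[of \<mu> B] measure_nonneg[of \<nu> B] by linarith
  then have "\<bar>measure \<mu> A - measure \<nu> A\<bar> \<le> dTV \<mu> \<nu>"
    unfolding dTV_def using assms(3) by (intro cSUP_upper bdd_aboveI2) auto
  then show ?thesis by linarith
qed

lemma borel_distribution_densityD:
  assumes "borel_distribution (density \<sigma> (\<lambda>x. ennreal (a x)))" and \<sigma> [measurable_cong]: "sets \<sigma> = sets borel"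
    and a [measurable]: "a \<in> borel_measurable borel" and a0: "\<And>x. 0 \<le> a x"
  shows "integrable \<sigma> a" "(\<integral>x. a x \<partial>\<sigma>) = 1"
    and "A \<in> sets borel \<Longrightarrow> measure (density \<sigma> (\<lambda>x. ennreal (a x))) A = (\<integral>x. a x * indicator A x \<partial>\<sigma>)"
proof -
  interpret borel_distribution "density \<sigma> (\<lambda>x. ennreal (a x))" by fact
  have "(\<integral>\<^sup>+x. ennreal (a x) \<partial>\<sigma>) = 1"
    using emeasure_UNIV sets_eq_imp_space_eq[OF \<sigma>] by (simp add: emeasure_density del: emeasure_UNIV)
  then show "integrable \<sigma> a" "(\<integral>x. a x \<partial>\<sigma>) = 1"
    using a0 by (auto intro!: integrableI_nonneg simp: integral_eq_nn_integral)
  show "measure (density \<sigma> (\<lambda>x. ennreal (a x))) A = (\<integral>x. a x * indicator A x \<partial>\<sigma>)" if [measurable]: "A \<in> sets borel"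
    using a0 by (simp add: measure_def emeasure_density integral_eq_nn_integral ennreal_mult ennreal_indicator)
qed

lemma normalised_density:
  fixes f :: "'a::topological_space \<Rightarrow> real"
  assumes \<sigma> [measurable_cong]: "sets \<sigma> = sets borel" and f: "integrable \<sigma> f" "\<And>x. 0 \<le> f x"
  obtains R where "borel_distribution R"
    "\<And>A. A \<in> sets borel \<Longrightarrow> ennreal (\<integral>x. f x \<partial>\<sigma>) * emeasure R A = (\<integral>\<^sup>+x. ennreal (f x) * indicator A x \<partial>\<sigma>)"
proof -
  define t where "t = (\<integral>x. f x \<partial>\<sigma>)"
  have t: "0 \<le> t" unfolding t_def using f(2) by (intro integral_nonneg_AE) auto
  have [measurable]: "f \<in> borel_measurable \<sigma>" using f(1) by simp
  have mass: "(\<integral>\<^sup>+x. ennreal (f x) \<partial>\<sigma>) = ennreal t"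
    unfolding t_def using f by (intro nn_integral_eq_integral) auto
  show ?thesis
  proof (cases "t = 0")
    case True
    have "(\<integral>\<^sup>+x. ennreal (f x) * indicator A x \<partial>\<sigma>) \<le> (\<integral>\<^sup>+x. ennreal (f x) \<partial>\<sigma>)" for A
      by (intro nn_integral_mono) (auto split: split_indicator)
    moreover have "borel_distribution (return borel undefined)"
      by (simp add: borel_distribution_def borel_distribution_axioms_def prob_space_return)
    ultimately show ?thesis using that mass True by (simp add: t_def)
  next
    case False
    define R where "R = density \<sigma> (\<lambda>x. ennreal (f x / t))"
    have R: "ennreal t * emeasure R A = (\<integral>\<^sup>+x. ennreal (f x) * indicator A x \<partial>\<sigma>)"
      if [measurable]: "A \<in> sets borel" for A
    proof -
      have "ennreal t * emeasure R A = (\<integral>\<^sup>+x. ennreal t * (ennreal (f x / t) * indicator A x) \<partial>\<sigma>)"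
        by (simp add: R_def emeasure_density nn_integral_cmult)
      also have "\<dots> = (\<integral>\<^sup>+x. ennreal (f x) * indicator A x \<partial>\<sigma>)"
        using False t f(2) by (intro nn_integral_cong) (simp add: mult.assoc[symmetric] ennreal_mult[symmetric])
      finally show ?thesis .
    qed
    have "ennreal t * emeasure R UNIV = ennreal t * 1" using R[of UNIV] mass by simp
    then have "emeasure R UNIV = 1"
      using False t by (subst (asm) ennreal_mult_cancel_left) auto
    then have "borel_distribution R"
      using sets_eq_imp_space_eq[OF \<sigma>] \<sigma>
      by (intro borel_distribution.intro prob_spaceI borel_distribution_axioms.intro) (simp_all add: R_def)
    then show ?thesis using that R by (simp add: t_def)
  qed
qed

lemma density_deficit_le_dTV:
  fixes a b :: "'a::topological_space \<Rightarrow> real"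
  assumes \<sigma> [measurable_cong]: "sets \<sigma> = sets borel"
    and a [measurable]: "a \<in> borel_measurable borel" "\<And>x. 0 \<le> a x"
    and \<mu>: "borel_distribution (density \<sigma> (\<lambda>x. ennreal (a x)))"
    and b [measurable]: "b \<in> borel_measurable borel" "\<And>x. 0 \<le> b x"
    and \<nu>: "borel_distribution (density \<sigma> (\<lambda>x. ennreal (b x)))"
  shows "(\<integral>x. a x - min (a x) (b x) \<partial>\<sigma>) \<le> dTV (density \<sigma> (\<lambda>x. ennreal (a x))) (density \<sigma> (\<lambda>x. ennreal (b x)))"
proof -
  note int_a = borel_distribution_densityD[OF \<mu> \<sigma> a] and int_b = borel_distribution_densityD[OF \<nu> \<sigma> b]
  define A where "A = {x. b x < a x}"
  have A: "A \<in> sets borel" unfolding A_def by measurable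
  have "integrable \<sigma> (\<lambda>x. a x * indicator A x)" "integrable \<sigma> (\<lambda>x. b x * indicator A x)"
    using int_a(1) int_b(1) A by (auto intro!: integrable_real_mult_indicator)
  moreover have "(\<integral>x. a x - min (a x) (b x) \<partial>\<sigma>) = (\<integral>x. a x * indicator A x - b x * indicator A x \<partial>\<sigma>)"
    by (intro Bochner_Integration.integral_cong) (auto simp: A_def split: split_indicator)
  ultimately show ?thesis
    using measure_diff_le_dTV[OF \<mu> \<nu> A] by (simp add: int_a(3)[OF A] int_b(3)[OF A])
qed

lemma emeasure_density_split:
  fixes m b :: "'a::topological_space \<Rightarrow> real"
  assumes [measurable_cong]: "sets \<sigma> = sets borel"
    and [measurable]: "m \<in> borel_measurable borel" "b \<in> borel_measurable borel"
    and m: "\<And>x. 0 \<le> m x" "\<And>x. m x \<le> b x" and [measurable]: "A \<in> sets borel"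
  shows "emeasure (density \<sigma> (\<lambda>x. ennreal (b x))) A
    = (\<integral>\<^sup>+x. ennreal (m x) * indicator A x \<partial>\<sigma>) + (\<integral>\<^sup>+x. ennreal (b x - m x) * indicator A x \<partial>\<sigma>)"
proof -
  have "emeasure (density \<sigma> (\<lambda>x. ennreal (b x))) A
      = (\<integral>\<^sup>+x. ennreal (m x) * indicator A x + ennreal (b x - m x) * indicator A x \<partial>\<sigma>)"
    using m by (subst emeasure_density) (auto intro!: nn_integral_cong simp flip: distrib_right ennreal_plus)
  also have "\<dots> = (\<integral>\<^sup>+x. ennreal (m x) * indicator A x \<partial>\<sigma>) + (\<integral>\<^sup>+x. ennreal (b x - m x) * indicator A x \<partial>\<sigma>)"
    by (rule nn_integral_add) measurable
  finally show ?thesis .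
qed

lemma nn_integral_density_mult:
  fixes a c :: "'a \<Rightarrow> real"
  assumes [measurable]: "a \<in> borel_measurable \<sigma>" "c \<in> borel_measurable \<sigma>" "g \<in> borel_measurable \<sigma>" and a: "\<And>x. 0 \<le> a x"
  shows "(\<integral>\<^sup>+x. ennreal (c x) * g x \<partial>density \<sigma> (\<lambda>x. ennreal (a x))) = (\<integral>\<^sup>+x. ennreal (a x * c x) * g x \<partial>\<sigma>)"
  using a by (subst nn_integral_density) (auto simp: ennreal_mult' mult.assoc)

text \<open>With densities \<open>a\<close> and \<open>b\<close> of \<open>\<mu>\<close> and \<open>\<nu>\<close>, the retained fraction is \<open>min a b / a\<close> and the
  replacement has density proportional to \<open>b - min a b\<close>.\<close>
lemma total_variation_decomposition:
  fixes \<mu> \<nu> :: "'a::topological_space measure"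
  assumes "borel_distribution \<mu>" "borel_distribution \<nu>"
  obtains \<rho> R where "\<rho> \<in> borel_measurable borel" "\<And>x. 0 \<le> (\<rho> x :: real)" "\<And>x. \<rho> x \<le> 1"
    "borel_distribution R" "(\<integral>\<^sup>+x. ennreal (1 - \<rho> x) \<partial>\<mu>) \<le> ennreal (dTV \<mu> \<nu>)"
    "\<And>A. A \<in> sets borel \<Longrightarrow> emeasure \<nu> A
      = (\<integral>\<^sup>+x. ennreal (\<rho> x) * indicator A x \<partial>\<mu>) + (\<integral>\<^sup>+x. ennreal (1 - \<rho> x) \<partial>\<mu>) * emeasure R A"
proof -
  obtain \<sigma> a b where \<sigma> [measurable_cong]: "sets \<sigma> = sets borel"
    and a [measurable]: "a \<in> borel_measurable borel" and a0: "\<And>x. 0 \<le> (a x :: real)"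
    and \<mu>: "\<mu> = density \<sigma> (\<lambda>x. ennreal (a x))"
    and b [measurable]: "b \<in> borel_measurable borel" and b0: "\<And>x. 0 \<le> (b x :: real)"
    and \<nu>: "\<nu> = density \<sigma> (\<lambda>x. ennreal (b x))"
    using borel_distributions_common_density[OF assms] by metis
  note int_a = borel_distribution_densityD[OF assms(1)[unfolded \<mu>] \<sigma> a a0]
  note int_b = borel_distribution_densityD[OF assms(2)[unfolded \<nu>] \<sigma> b b0]
  define m where "m x = min (a x) (b x)" for x
  define \<rho> where "\<rho> x = (if a x \<le> b x then 1 else b x / a x)" for x
  have m [measurable]: "m \<in> borel_measurable borel" and \<rho> [measurable]: "\<rho> \<in> borel_measurable borel"
    unfolding m_def \<rho>_def by measurable
  have m0: "0 \<le> m x" "m x \<le> a x" "m x \<le> b x" for x using a0 b0 by (auto simp: m_def)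
  have \<rho>01: "0 \<le> \<rho> x" "\<rho> x \<le> 1" and \<rho>a: "a x * \<rho> x = m x" for x
    using a0[of x] b0[of x] by (auto simp: \<rho>_def m_def divide_simps)
  have int_m: "integrable \<sigma> m"
    by (rule Bochner_Integration.integrable_bound[OF int_a(1)]) (use m0 a0 in auto)
  define t where "t = (\<integral>x. b x - m x \<partial>\<sigma>)"
  have deficit: "(\<integral>x. a x - m x \<partial>\<sigma>) = t" using int_a int_b int_m by (simp add: t_def)
  obtain R where R: "borel_distribution R"
    "\<And>A. A \<in> sets borel \<Longrightarrow> ennreal t * emeasure R A = (\<integral>\<^sup>+x. ennreal (b x - m x) * indicator A x \<partial>\<sigma>)"
    using normalised_density[OF \<sigma>, of "\<lambda>x. b x - m x"] int_b(1) int_m m0(3) unfolding t_def by auto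
  have moved: "(\<integral>\<^sup>+x. ennreal (1 - \<rho> x) \<partial>\<mu>) = ennreal t"
  proof -
    have "(\<integral>\<^sup>+x. ennreal (1 - \<rho> x) \<partial>\<mu>) = (\<integral>\<^sup>+x. ennreal (a x - m x) \<partial>\<sigma>)"
      using nn_integral_density_mult[of a \<sigma> "\<lambda>x. 1 - \<rho> x" "\<lambda>_. 1"] a0 by (simp add: \<mu> \<rho>a right_diff_distrib)
    also have "\<dots> = ennreal t"
      unfolding deficit[symmetric] using int_a(1) int_m m0 by (intro nn_integral_eq_integral) auto
    finally show ?thesis .
  qed
  have "t \<le> dTV \<mu> \<nu>"
    using density_deficit_le_dTV[OF \<sigma> a a0 _ b b0] assms unfolding deficit[symmetric] m_def \<mu> \<nu> by blast
  moreover have "emeasure \<nu> A = (\<integral>\<^sup>+x. ennreal (\<rho> x) * indicator A x \<partial>\<mu>) + ennreal t * emeasure R A"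
    if [measurable]: "A \<in> sets borel" for A
    using emeasure_density_split[OF \<sigma> m b m0(1,3) that] nn_integral_density_mult[of a \<sigma> \<rho> "indicator A"] a0
    by (simp add: \<mu> \<nu> \<rho>a R(2))
  ultimately show ?thesis
    using that[OF \<rho> \<rho>01 R(1)] by (simp add: moved ennreal_leI)
qed

definition replacement_kernel :: "('a::topological_space \<Rightarrow> real) \<Rightarrow> 'a measure \<Rightarrow> 'a \<Rightarrow> 'a measure" where
  "replacement_kernel \<rho> R x =
     distr (uniform_measure lborel {0..1} \<Otimes>\<^sub>M R) borel (\<lambda>(u, y). if u \<le> \<rho> x then x else y)"

context
  fixes \<rho> :: "'a::topological_space \<Rightarrow> real" and R :: "'a measure"
  assumes \<rho> [measurable]: "\<rho> \<in> borel_measurable borel" and \<rho>01: "\<And>x. 0 \<le> \<rho> x" "\<And>x. \<rho> x \<le> 1"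
    and R: "borel_distribution R"
begin

interpretation R: borel_distribution R by (rule R)

interpretation U: prob_space "uniform_measure lborel {0..1::real}"
  by (rule prob_space_uniform_measure) auto

interpretation UR: pair_prob_space "uniform_measure lborel {0..1::real}" R ..

lemma replacement_kernel_measurable: "replacement_kernel \<rho> R \<in> borel \<rightarrow>\<^sub>M prob_algebra borel"
proof -
  have "uniform_measure lborel {0..1::real} \<Otimes>\<^sub>M R \<in> space (prob_algebra (borel \<Otimes>\<^sub>M borel))"
    using UR.prob_space_axioms by (simp add: space_prob_algebra cong: sets_pair_measure_cong)
  then have "(\<lambda>_. uniform_measure lborel {0..1::real} \<Otimes>\<^sub>M R) \<in> borel \<rightarrow>\<^sub>M prob_algebra (borel \<Otimes>\<^sub>M borel)"
    by simp
  then show ?thesis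
    unfolding replacement_kernel_def[abs_def] by (rule measurable_distr_prob_space2) measurable
qed

lemma nn_integral_replacement_kernel:
  assumes [measurable]: "f \<in> borel_measurable borel"
  shows "(\<integral>\<^sup>+y. f y \<partial>replacement_kernel \<rho> R x) = ennreal (\<rho> x) * f x + ennreal (1 - \<rho> x) * (\<integral>\<^sup>+y. f y \<partial>R)"
proof -
  have "(\<integral>\<^sup>+y. f y \<partial>replacement_kernel \<rho> R x)
      = (\<integral>\<^sup>+z. f (if fst z \<le> \<rho> x then x else snd z) \<partial>(uniform_measure lborel {0..1} \<Otimes>\<^sub>M R))"
    unfolding replacement_kernel_def by (subst nn_integral_distr) (auto simp: split_beta')
  also have "\<dots> = (\<integral>\<^sup>+u. \<integral>\<^sup>+y. f (if u \<le> \<rho> x then x else y) \<partial>R \<partial>uniform_measure lborel {0..1})"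
    by (subst R.nn_integral_fst[symmetric]) (auto cong: if_cong)
  also have "\<dots> = (\<integral>\<^sup>+u. (if u \<le> \<rho> x then f x else (\<integral>\<^sup>+y. f y \<partial>R)) \<partial>uniform_measure lborel {0..1})"
    by (intro nn_integral_cong) auto
  also have "\<dots> = ennreal (\<rho> x) * f x + ennreal (1 - \<rho> x) * (\<integral>\<^sup>+y. f y \<partial>R)"
    by (rule nn_integral_uniform_threshold[OF \<rho>01])
  finally show ?thesis .
qed

end

lemma total_variation_kernel:
  fixes \<mu> \<nu> :: "'a::t1_space measure"
  assumes "borel_distribution \<mu>" "borel_distribution \<nu>"
  obtains \<kappa> \<tau> where "\<kappa> \<in> borel \<rightarrow>\<^sub>M prob_algebra borel" "\<mu> \<bind> \<kappa> = \<nu>" "\<tau> \<in> borel_measurable borel"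
    "\<And>x. emeasure (\<kappa> x) (- {x}) \<le> \<tau> x" "(\<integral>\<^sup>+x. \<tau> x \<partial>\<mu>) \<le> ennreal (dTV \<mu> \<nu>)"
proof -
  interpret \<mu>: borel_distribution \<mu> by fact
  interpret \<nu>: borel_distribution \<nu> by fact
  obtain \<rho> R where \<rho> [measurable]: "\<rho> \<in> borel_measurable borel" and \<rho>01: "\<And>x. 0 \<le> (\<rho> x :: real)" "\<And>x. \<rho> x \<le> 1"
    and R: "borel_distribution R" and moved: "(\<integral>\<^sup>+x. ennreal (1 - \<rho> x) \<partial>\<mu>) \<le> ennreal (dTV \<mu> \<nu>)"
    and \<nu>: "\<And>A. A \<in> sets borel \<Longrightarrow> emeasure \<nu> A
      = (\<integral>\<^sup>+x. ennreal (\<rho> x) * indicator A x \<partial>\<mu>) + (\<integral>\<^sup>+x. ennreal (1 - \<rho> x) \<partial>\<mu>) * emeasure R A"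
    using total_variation_decomposition[OF assms] by blast
  interpret R: borel_distribution R by (rule R)
  note kernel [measurable] = replacement_kernel_measurable[OF \<rho> \<rho>01 R]
  note nn_integral = nn_integral_replacement_kernel[OF \<rho> \<rho>01 R]
  have \<kappa>\<mu>: "replacement_kernel \<rho> R \<in> \<mu> \<rightarrow>\<^sub>M prob_algebra borel" by measurable
  have emeasure: "emeasure (replacement_kernel \<rho> R x) A
      = ennreal (\<rho> x) * indicator A x + ennreal (1 - \<rho> x) * emeasure R A"
    if [measurable]: "A \<in> sets borel" for A x
    using nn_integral[of "indicator A" x] by (simp add: replacement_kernel_def)
  show ?thesis
  proof (rule that[OF kernel _ _ _ moved])
    interpret bind: borel_distribution "\<mu> \<bind> replacement_kernel \<rho> R"
      by (rule borel_distribution_bind[OF \<mu>.prob_space_axioms \<kappa>\<mu>])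
    show "\<mu> \<bind> replacement_kernel \<rho> R = \<nu>"
    proof (rule measure_eqI)
      fix A assume "A \<in> sets (\<mu> \<bind> replacement_kernel \<rho> R)"
      then have [measurable]: "A \<in> sets borel" by simp
      have "emeasure (\<mu> \<bind> replacement_kernel \<rho> R) A = (\<integral>\<^sup>+x. emeasure (replacement_kernel \<rho> R x) A \<partial>\<mu>)"
        using emeasure_bind[OF _ measurable_prob_algebraD[OF \<kappa>\<mu>]] by simp
      also have "\<dots> = emeasure \<nu> A"
        by (simp add: emeasure \<nu> nn_integral_add nn_integral_multc)
      finally show "emeasure (\<mu> \<bind> replacement_kernel \<rho> R) A = emeasure \<nu> A" .
    qed simp
    show "(\<lambda>x. ennreal (1 - \<rho> x)) \<in> borel_measurable borel" by measurable
    show "emeasure (replacement_kernel \<rho> R x) (- {x}) \<le> ennreal (1 - \<rho> x)" for x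
      using mult_left_mono[OF R.emeasure_le_1[of "- {x}"], of "ennreal (1 - \<rho> x)"] by (simp add: emeasure)
  qed
qed

lemma total_variation_coupling:
  fixes X Y :: "'w \<Rightarrow> 'a::t1_space" and \<nu> :: "'a measure"
  assumes M: "prob_space M" and X [measurable]: "X \<in> M \<rightarrow>\<^sub>M borel" and Y [measurable]: "Y \<in> M \<rightarrow>\<^sub>M borel"
    and \<nu>: "borel_distribution \<nu>"
  obtains c where "c \<in> couplings (distr M borel X) \<nu>"
    "\<And>g. g \<in> borel_measurable (borel \<Otimes>\<^sub>M borel) \<Longrightarrow> (\<And>z. g z \<le> 1) \<Longrightarrow>
      (\<integral>\<^sup>+z. g z \<partial>c) \<le> (\<integral>\<^sup>+\<omega>. g (X \<omega>, Y \<omega>) \<partial>M) + ennreal (dTV (distr M borel Y) \<nu>)"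
proof -
  obtain \<kappa> \<tau> where \<kappa> [measurable]: "\<kappa> \<in> borel \<rightarrow>\<^sub>M prob_algebra borel" and bind: "distr M borel Y \<bind> \<kappa> = \<nu>"
    and \<tau> [measurable]: "\<tau> \<in> borel_measurable borel" and moved: "\<And>x. emeasure (\<kappa> x) (- {x}) \<le> \<tau> x"
    and cost: "(\<integral>\<^sup>+y. \<tau> y \<partial>distr M borel Y) \<le> ennreal (dTV (distr M borel Y) \<nu>)"
    using total_variation_kernel[OF borel_distribution_distr[OF M Y] \<nu>] by blast
  have \<kappa>Y: "(\<lambda>\<omega>. \<kappa> (Y \<omega>)) \<in> M \<rightarrow>\<^sub>M prob_algebra borel" by measurable
  have "M \<bind> (\<lambda>\<omega>. \<kappa> (Y \<omega>)) = \<nu>"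
    using bind_distr[OF Y measurable_prob_algebraD[OF \<kappa>]] prob_space.not_empty[OF M] by (simp add: bind)
  then have c: "kernel_joint M X (\<lambda>\<omega>. \<kappa> (Y \<omega>)) \<in> couplings (distr M borel X) \<nu>"
    using kernel_joint_coupling[OF M X \<kappa>Y] by simp
  show ?thesis
  proof (rule that[OF c])
    fix g :: "'a \<times> 'a \<Rightarrow> ennreal" assume g [measurable]: "g \<in> borel_measurable (borel \<Otimes>\<^sub>M borel)" and g1: "\<And>z. g z \<le> 1"
    have "(\<integral>\<^sup>+y. g (X \<omega>, y) \<partial>\<kappa> (Y \<omega>)) \<le> g (X \<omega>, Y \<omega>) + \<tau> (Y \<omega>)" for \<omega>
    proof -
      interpret borel_distribution "\<kappa> (Y \<omega>)" by (rule borel_distribution_kernel[OF \<kappa>]) simp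
      have "(\<integral>\<^sup>+y. g (X \<omega>, y) \<partial>\<kappa> (Y \<omega>)) \<le> (\<integral>\<^sup>+y. g (X \<omega>, Y \<omega>) + indicator (- {Y \<omega>}) y \<partial>\<kappa> (Y \<omega>))"
        by (intro nn_integral_mono) (auto split: split_indicator intro: order_trans[OF g1])
      also have "\<dots> = g (X \<omega>, Y \<omega>) + emeasure (\<kappa> (Y \<omega>)) (- {Y \<omega>})"
        by (subst nn_integral_add) auto
      also have "\<dots> \<le> g (X \<omega>, Y \<omega>) + \<tau> (Y \<omega>)" by (intro add_left_mono moved)
      finally show ?thesis .
    qed
    then have "(\<integral>\<^sup>+z. g z \<partial>kernel_joint M X (\<lambda>\<omega>. \<kappa> (Y \<omega>))) \<le> (\<integral>\<^sup>+\<omega>. g (X \<omega>, Y \<omega>) + \<tau> (Y \<omega>) \<partial>M)"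
      unfolding nn_integral_kernel_joint[OF M X \<kappa>Y g] by (intro nn_integral_mono)
    also have "\<dots> = (\<integral>\<^sup>+\<omega>. g (X \<omega>, Y \<omega>) \<partial>M) + (\<integral>\<^sup>+y. \<tau> y \<partial>distr M borel Y)"
      by (simp add: nn_integral_add nn_integral_distr)
    also have "\<dots> \<le> (\<integral>\<^sup>+\<omega>. g (X \<omega>, Y \<omega>) \<partial>M) + ennreal (dTV (distr M borel Y) \<nu>)"
      by (intro add_left_mono cost)
    finally show "(\<integral>\<^sup>+z. g z \<partial>kernel_joint M X (\<lambda>\<omega>. \<kappa> (Y \<omega>))) \<le> \<dots>" .
  qed
qed

section \<open>The Kantorovich distance of the truncated metric\<close>

definition trunc_dist :: "'a::metric_space \<Rightarrow> 'a \<Rightarrow> real" where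
  "trunc_dist x y = min (dist x y) 1"

definition trunc_Lipschitz :: "('a::metric_space \<Rightarrow> real) \<Rightarrow> bool" where
  "trunc_Lipschitz f \<longleftrightarrow> (\<forall>x y. f x - f y \<le> trunc_dist x y)"

lemma trunc_dist_nonneg [simp]: "0 \<le> trunc_dist x y" and trunc_dist_le_1 [simp]: "trunc_dist x y \<le> 1"
  and trunc_dist_self [simp]: "trunc_dist x x = 0" and trunc_dist_commute: "trunc_dist x y = trunc_dist y x"
  by (auto simp: trunc_dist_def dist_commute)

lemma trunc_dist_triangle: "trunc_dist x z \<le> trunc_dist x y + trunc_dist y z"
  using dist_triangle[of x z y] zero_le_dist[of x y] zero_le_dist[of y z] unfolding trunc_dist_def by linarith

lemma trunc_dist_measurable [measurable]:
  fixes f g :: "'w \<Rightarrow> 'a::{second_countable_topology, metric_space}"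
  shows "f \<in> M \<rightarrow>\<^sub>M borel \<Longrightarrow> g \<in> M \<rightarrow>\<^sub>M borel \<Longrightarrow> (\<lambda>x. trunc_dist (f x) (g x)) \<in> borel_measurable M"
  unfolding trunc_dist_def by measurable

lemma trunc_Lipschitz_abs_diff: "trunc_Lipschitz f \<Longrightarrow> \<bar>f x - f y\<bar> \<le> trunc_dist x y"
  unfolding trunc_Lipschitz_def by (metis abs_le_iff trunc_dist_commute minus_diff_eq)

lemma trunc_Lipschitz_minus: "trunc_Lipschitz f \<Longrightarrow> trunc_Lipschitz (\<lambda>x. - f x)"
  using trunc_Lipschitz_abs_diff[of f] by (auto simp: trunc_Lipschitz_def abs_le_iff)

lemma trunc_Lipschitz_abs_diff_le_1: "trunc_Lipschitz f \<Longrightarrow> \<bar>f x - f y\<bar> \<le> 1"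
  using trunc_Lipschitz_abs_diff[of f x y] trunc_dist_le_1[of x y] by linarith

lemma trunc_Lipschitz_abs_le: "trunc_Lipschitz f \<Longrightarrow> \<bar>f x\<bar> \<le> \<bar>f y\<bar> + 1"
  using trunc_Lipschitz_abs_diff_le_1[of f x y] by linarith

lemma trunc_Lipschitz_bounded: "trunc_Lipschitz f \<Longrightarrow> bounded (range f)"
  using trunc_Lipschitz_abs_le[of f _ undefined] by (auto simp: bounded_iff)

lemma trunc_Lipschitz_continuous:
  assumes "trunc_Lipschitz f"
  shows "continuous_on UNIV f"
proof (rule lipschitz_on_continuous_on)
  show "1-lipschitz_on UNIV f"
    by (rule lipschitz_onI) (use trunc_Lipschitz_abs_diff[OF assms] in \<open>auto simp: dist_real_def trunc_dist_def\<close>)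
qed

lemma trunc_Lipschitz_measurable [measurable_dest]: "trunc_Lipschitz f \<Longrightarrow> f \<in> borel_measurable borel"
  by (intro borel_measurable_continuous_onI trunc_Lipschitz_continuous)

lemma trunc_Lipschitz_comp_integrable:
  assumes "prob_space M" "trunc_Lipschitz f" "X \<in> M \<rightarrow>\<^sub>M borel"
  shows "integrable M (\<lambda>\<omega>. f (X \<omega>))"
proof -
  interpret prob_space M by fact
  have "\<bar>f (X \<omega>)\<bar> \<le> \<bar>f undefined\<bar> + 1" for \<omega> by (rule trunc_Lipschitz_abs_le[OF assms(2)])
  then show ?thesis
    using trunc_Lipschitz_measurable[OF assms(2)] assms(3)
    by (intro integrable_const_bound[where B="\<bar>f undefined\<bar> + 1"]) auto
qed

lemma trunc_Lipschitz_integrable: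
  assumes "borel_distribution \<mu>" "trunc_Lipschitz f"
  shows "integrable \<mu> f"
proof -
  interpret borel_distribution \<mu> by fact
  show ?thesis using trunc_Lipschitz_comp_integrable[OF prob_space_axioms assms(2), of "\<lambda>x. x"] by simp
qed

definition kantorovich_dist :: "'a::metric_space measure \<Rightarrow> 'a measure \<Rightarrow> real" where
  "kantorovich_dist \<mu> \<nu> = (SUP f\<in>{f. trunc_Lipschitz f}. (\<integral>x. f x \<partial>\<mu>) - (\<integral>x. f x \<partial>\<nu>))"

lemma kantorovich_dist_leI:
  assumes "\<And>f. trunc_Lipschitz f \<Longrightarrow> (\<integral>x. f x \<partial>\<mu>) - (\<integral>x. f x \<partial>\<nu>) \<le> D"
  shows "kantorovich_dist \<mu> \<nu> \<le> D"
proof -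
  have "trunc_Lipschitz (\<lambda>_::'a. 0)" by (simp add: trunc_Lipschitz_def)
  then show ?thesis unfolding kantorovich_dist_def using assms by (intro cSUP_least) auto
qed

context
  fixes \<mu> \<nu> :: "'a::metric_space measure"
  assumes \<mu>: "borel_distribution \<mu>" and \<nu>: "borel_distribution \<nu>"
begin

interpretation \<mu>: borel_distribution \<mu> by (rule \<mu>)
interpretation \<nu>: borel_distribution \<nu> by (rule \<nu>)

lemma trunc_Lipschitz_integral_diff_le_1:
  assumes f: "trunc_Lipschitz f"
  shows "\<bar>(\<integral>x. f x \<partial>\<mu>) - (\<integral>x. f x \<partial>\<nu>)\<bar> \<le> 1"
proof -
  note c = product_coupling[OF \<mu> \<nu>]
  interpret pair: prob_space "\<mu> \<Otimes>\<^sub>M \<nu>" by (rule couplingsD(1)[OF c])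
  have "\<bar>(\<integral>x. f x \<partial>\<mu>) - (\<integral>x. f x \<partial>\<nu>)\<bar> \<le> (\<integral>z. 1 \<partial>(\<mu> \<Otimes>\<^sub>M \<nu>))"
    using f by (intro coupling_integral_diff_le[OF c] trunc_Lipschitz_integrable[OF \<mu>] trunc_Lipschitz_integrable[OF \<nu>]
        trunc_Lipschitz_measurable trunc_Lipschitz_abs_diff_le_1) auto
  then show ?thesis by (simp add: pair.prob_space)
qed

lemma integral_diff_le_kantorovich_dist:
  assumes f: "trunc_Lipschitz f"
  shows "(\<integral>x. f x \<partial>\<mu>) - (\<integral>x. f x \<partial>\<nu>) \<le> kantorovich_dist \<mu> \<nu>"
  unfolding kantorovich_dist_def
proof (rule cSUP_upper)
  show "bdd_above ((\<lambda>f. (\<integral>x. f x \<partial>\<mu>) - (\<integral>x. f x \<partial>\<nu>)) ` {f. trunc_Lipschitz f})"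
    using trunc_Lipschitz_integral_diff_le_1 by (intro bdd_aboveI2[where M=1]) (auto dest: abs_le_D1)
qed (use f in simp)

lemma abs_integral_diff_le_kantorovich_dist:
  "trunc_Lipschitz f \<Longrightarrow> \<bar>(\<integral>x. f x \<partial>\<mu>) - (\<integral>x. f x \<partial>\<nu>)\<bar> \<le> kantorovich_dist \<mu> \<nu>"
  using integral_diff_le_kantorovich_dist[of f] integral_diff_le_kantorovich_dist[OF trunc_Lipschitz_minus[of f]]
  by simp

lemma kantorovich_dist_nonneg: "0 \<le> kantorovich_dist \<mu> \<nu>"
  using integral_diff_le_kantorovich_dist[of "\<lambda>_. 0"] by (simp add: trunc_Lipschitz_def)

lemma kantorovich_dist_le_1: "kantorovich_dist \<mu> \<nu> \<le> 1"
  using trunc_Lipschitz_integral_diff_le_1 by (intro kantorovich_dist_leI) (auto dest: abs_le_D1)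

end

lemma kantorovich_dist_bind_le:
  fixes \<nu> :: "'a::topological_space measure" and \<kappa> :: "'a \<Rightarrow> 'b::metric_space measure"
  assumes \<nu>: "borel_distribution \<nu>" and \<mu>: "borel_distribution \<mu>" and \<kappa>: "\<kappa> \<in> borel \<rightarrow>\<^sub>M prob_algebra borel"
    and \<Psi>: "integrable \<nu> \<Psi>" "\<And>x. kantorovich_dist (\<kappa> x) \<mu> \<le> \<Psi> x"
  shows "kantorovich_dist (\<nu> \<bind> \<kappa>) \<mu> \<le> (\<integral>x. \<Psi> x \<partial>\<nu>)"
proof (rule kantorovich_dist_leI)
  interpret \<nu>: borel_distribution \<nu> by (rule \<nu>)
  fix f :: "'b \<Rightarrow> real" assume f: "trunc_Lipschitz f"
  define g where "g x = (\<integral>y. f y \<partial>\<kappa> x) - (\<integral>y. f y \<partial>\<mu>)" for x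
  have kernels: "borel_distribution (\<kappa> x)" for x by (rule borel_distribution_kernel[OF \<kappa>]) simp
  have [measurable]: "f \<in> borel_measurable borel" by (rule trunc_Lipschitz_measurable[OF f])
  have [measurable]: "(\<lambda>x. \<integral>y. f y \<partial>\<kappa> x) \<in> borel_measurable borel"
    by (rule measurable_compose[OF measurable_prob_algebraD[OF \<kappa>] integral_measurable_subprob_algebra]) measurable
  have "\<bar>g x\<bar> \<le> 1" for x unfolding g_def by (rule trunc_Lipschitz_integral_diff_le_1[OF kernels \<mu> f])
  then have g: "integrable \<nu> g" by (intro \<nu>.integrable_const_bound[where B=1]) (auto simp: g_def[abs_def])
  have "(\<integral>y. f y \<partial>(\<nu> \<bind> \<kappa>)) = (\<integral>x. g x + (\<integral>y. f y \<partial>\<mu>) \<partial>\<nu>)"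
    unfolding g_def using \<kappa> trunc_Lipschitz_abs_le[OF f, of _ undefined]
    by (subst integral_bind_kernel) (auto intro!: \<nu>.prob_space_axioms cong: measurable_cong_sets)
  also have "\<dots> = (\<integral>x. g x \<partial>\<nu>) + (\<integral>y. f y \<partial>\<mu>)" using g by simp
  finally have "(\<integral>y. f y \<partial>(\<nu> \<bind> \<kappa>)) - (\<integral>y. f y \<partial>\<mu>) = (\<integral>x. g x \<partial>\<nu>)" by simp
  also have "\<dots> \<le> (\<integral>x. \<Psi> x \<partial>\<nu>)"
    using integral_diff_le_kantorovich_dist[OF kernels \<mu> f] \<Psi>(2) unfolding g_def
    by (intro integral_mono g[unfolded g_def] \<Psi>(1)) (rule order_trans)
  finally show "(\<integral>y. f y \<partial>(\<nu> \<bind> \<kappa>)) - (\<integral>y. f y \<partial>\<mu>) \<le> (\<integral>x. \<Psi> x \<partial>\<nu>)" .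
qed

lemma kantorovich_dist_commute:
  assumes "borel_distribution \<mu>" "borel_distribution \<nu>"
  shows "kantorovich_dist \<mu> \<nu> = kantorovich_dist \<nu> \<mu>"
proof -
  have "kantorovich_dist \<mu> \<nu> \<le> kantorovich_dist \<nu> \<mu>"
    if "borel_distribution \<mu>" "borel_distribution \<nu>" for \<mu> \<nu> :: "'a measure"
    using abs_integral_diff_le_kantorovich_dist[OF that(2,1)]
    by (intro kantorovich_dist_leI) (metis abs_le_D1 abs_minus_commute)
  then show ?thesis using assms by (intro antisym) auto
qed

lemma kantorovich_dist_triangle:
  assumes "borel_distribution \<mu>" "borel_distribution \<nu>" "borel_distribution \<rho>"
  shows "kantorovich_dist \<mu> \<rho> \<le> kantorovich_dist \<mu> \<nu> + kantorovich_dist \<nu> \<rho>"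
proof (rule kantorovich_dist_leI)
  fix f :: "'a \<Rightarrow> real" assume "trunc_Lipschitz f"
  then show "(\<integral>x. f x \<partial>\<mu>) - (\<integral>x. f x \<partial>\<rho>) \<le> kantorovich_dist \<mu> \<nu> + kantorovich_dist \<nu> \<rho>"
    using integral_diff_le_kantorovich_dist[OF assms(1,2), of f]
      integral_diff_le_kantorovich_dist[OF assms(2,3), of f]
    by linarith
qed

definition closed_set_bump :: "'a::metric_space set \<Rightarrow> nat \<Rightarrow> 'a \<Rightarrow> real" where
  "closed_set_bump F k x = max 0 (1 - real k * infdist x F)"

lemma closed_set_bump_bounds: "0 \<le> closed_set_bump F k x" "closed_set_bump F k x \<le> 1"
  by (auto simp: closed_set_bump_def infdist_nonneg)

lemma closed_set_bump_Lipschitz: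
  assumes "0 < k"
  shows "trunc_Lipschitz (\<lambda>x. closed_set_bump F k x / real k)"
  unfolding trunc_Lipschitz_def
proof (intro allI)
  fix x y
  have "closed_set_bump F k x - closed_set_bump F k y \<le> real k * trunc_dist x y"
  proof (cases "dist x y \<le> 1")
    case True
    have "real k * infdist y F \<le> real k * (infdist x F + dist y x)"
      by (intro mult_left_mono infdist_triangle) auto
    moreover have "0 \<le> real k * dist y x" by simp
    ultimately show ?thesis
      using True unfolding closed_set_bump_def trunc_dist_def
      by (simp add: algebra_simps max_def dist_commute)
  next
    case False
    then show ?thesis
      using closed_set_bump_bounds[of F k x] closed_set_bump_bounds[of F k y] assms by (simp add: trunc_dist_def)
  qed
  then show "closed_set_bump F k x / real k - closed_set_bump F k y / real k \<le> trunc_dist x y"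
    using assms by (simp add: field_simps)
qed

lemma closed_set_bump_tendsto_indicator:
  assumes "closed F" "F \<noteq> {}"
  shows "(\<lambda>k. closed_set_bump F (Suc k) x) \<longlonglongrightarrow> indicator F x"
proof (cases "x \<in> F")
  case True
  then show ?thesis by (simp add: closed_set_bump_def)
next
  case False
  then have pos: "infdist x F > 0" using assms infdist_pos_not_in_closed by blast
  obtain n where n: "real n * infdist x F > 1" using reals_Archimedean3[OF pos] by blast
  have "eventually (\<lambda>k. closed_set_bump F (Suc k) x = 0) sequentially"
    using eventually_ge_at_top[of n]
  proof eventually_elim
    case (elim k)
    have "real n * infdist x F \<le> real (Suc k) * infdist x F" using elim pos by (intro mult_right_mono) auto
    then show ?case using n by (simp add: closed_set_bump_def)
  qed
  then show ?thesis using False by (simp add: tendsto_eventually)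
qed

lemma closed_set_bump_integral_tendsto:
  assumes M: "borel_distribution M" and F: "closed F" "F \<noteq> {}"
  shows "(\<lambda>k. \<integral>x. closed_set_bump F (Suc k) x \<partial>M) \<longlonglongrightarrow> measure M F"
proof -
  interpret borel_distribution M by (rule M)
  have [measurable]: "closed_set_bump F k \<in> borel_measurable borel" for k
    unfolding closed_set_bump_def by (intro borel_measurable_continuous_onI continuous_intros)
  have [measurable]: "F \<in> sets borel" using F(1) by simp
  have "(\<lambda>k. \<integral>x. closed_set_bump F (Suc k) x \<partial>M) \<longlonglongrightarrow> (\<integral>x. indicator F x \<partial>M)"
    using closed_set_bump_bounds[of F]
    by (intro integral_dominated_convergence[where w="\<lambda>_. 1"] AE_I2 closed_set_bump_tendsto_indicator F)
      (auto simp: abs_of_nonneg)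
  then show ?thesis by simp
qed

lemma borel_distribution_eqI_trunc_Lipschitz:
  fixes \<mu> \<nu> :: "'a::metric_space measure"
  assumes \<mu>: "borel_distribution \<mu>" and \<nu>: "borel_distribution \<nu>"
    and eq: "\<And>f. trunc_Lipschitz f \<Longrightarrow> (\<integral>x. f x \<partial>\<mu>) = (\<integral>x. f x \<partial>\<nu>)"
  shows "\<mu> = \<nu>"
proof (rule measure_eqI_generator_eq[where \<Omega>=UNIV and E="Collect closed" and A="\<lambda>_. UNIV"])
  interpret \<mu>: borel_distribution \<mu> by fact
  interpret \<nu>: borel_distribution \<nu> by fact
  show "Int_stable (Collect closed :: 'a set set)" by (auto simp: Int_stable_def)
  have "sets (borel :: 'a measure) = sigma_sets UNIV (Collect closed)"
    by (subst borel_eq_closed) (simp add: sets_measure_of)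
  then show "sets \<mu> = sigma_sets UNIV (Collect closed)" "sets \<nu> = sigma_sets UNIV (Collect closed)" by simp_all
  show "emeasure \<mu> UNIV \<noteq> \<infinity>" by (simp add: \<mu>.emeasure_eq_measure)
  show "emeasure \<mu> F = emeasure \<nu> F" if "F \<in> Collect closed" for F
  proof (cases "F = {}")
    case False
    have "(\<integral>x. closed_set_bump F (Suc k) x \<partial>\<mu>) = (\<integral>x. closed_set_bump F (Suc k) x \<partial>\<nu>)" for k
      using eq[OF closed_set_bump_Lipschitz[of "Suc k" F]] by simp
    then have "measure \<mu> F = measure \<nu> F"
      using closed_set_bump_integral_tendsto[OF \<mu>, of F] closed_set_bump_integral_tendsto[OF \<nu>, of F] that False
      by (auto intro: LIMSEQ_unique)
    then show ?thesis by (simp add: \<mu>.emeasure_eq_measure \<nu>.emeasure_eq_measure)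
  qed simp
qed auto

lemma kantorovich_dist_eq_0_imp_eq:
  assumes "borel_distribution \<mu>" "borel_distribution \<nu>" "kantorovich_dist \<mu> \<nu> \<le> 0"
  shows "\<mu> = \<nu>"
  using abs_integral_diff_le_kantorovich_dist[OF assms(1,2)] assms(3)
  by (intro borel_distribution_eqI_trunc_Lipschitz[OF assms(1,2)]) (fastforce intro: order_antisym)

section \<open>Duality for finite transport problems\<close>

lemma compact_function_box: "compact {p :: 'b \<Rightarrow> real. \<forall>z. 0 \<le> p z \<and> p z \<le> B}"
proof -
  have "{p :: 'b \<Rightarrow> real. \<forall>z. 0 \<le> p z \<and> p z \<le> B} = PiE UNIV (\<lambda>_. {0..B})"
    by (auto simp: PiE_iff)
  moreover have "compactin (product_topology (\<lambda>_::'b. euclidean) UNIV) (PiE UNIV (\<lambda>_. {0..B}))"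
    by (subst compactin_PiE) auto
  ultimately show ?thesis
    by (simp add: euclidean_product_topology flip: compactin_euclidean_iff)
qed

lemma quadratic_germ_nonneg:
  fixes G \<tau> b :: real
  assumes "b > 0" "\<tau> > 0" and germ: "\<And>e. 0 < e \<Longrightarrow> e \<le> b \<Longrightarrow> 0 \<le> e * G + e\<^sup>2 / \<tau>"
  shows "0 \<le> G"
proof (rule ccontr)
  assume "\<not> 0 \<le> G"
  define e where "e = min b (- G * \<tau> / 2)"
  have e: "e > 0" "e \<le> b" "e \<le> - G * \<tau> / 2"
    using \<open>\<not> 0 \<le> G\<close> assms(1,2) by (auto simp: e_def mult_neg_pos)
  then have "0 \<le> e * (G + e / \<tau>)"
    using germ[of e] by (simp add: power2_eq_square algebra_simps)
  then have "0 \<le> G + e / \<tau>"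
    using e(1) by (simp add: zero_le_mult_iff)
  moreover have "e / \<tau> \<le> - G / 2"
    using e(3) assms(2) by (simp add: field_simps)
  ultimately show False
    using \<open>\<not> 0 \<le> G\<close> by simp
qed

text \<open>Minimising the transport cost plus a quadratic penalty of strength \<open>1 / \<tau>\<close> for the marginal
  errors makes the rescaled errors dual potentials, so that duality becomes the first-order
  optimality condition; the constraints are recovered as \<open>\<tau>\<close> tends to 0.\<close>
locale finite_transport =
  fixes I :: "'a set" and m k :: "'a \<Rightarrow> real" and c :: "'a \<Rightarrow> 'a \<Rightarrow> real"
  assumes finite: "finite I"
    and m_nonneg: "\<And>x. x \<in> I \<Longrightarrow> 0 \<le> m x" and m_sum: "sum m I = 1"
    and k_nonneg: "\<And>x. x \<in> I \<Longrightarrow> 0 \<le> k x" and k_sum: "sum k I = 1"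
    and c_nonneg: "\<And>x y. 0 \<le> c x y" and c_le_1: "\<And>x y. c x y \<le> 1" and c_self: "\<And>x. c x x = 0"
    and c_triangle: "\<And>x y z. c x z \<le> c x y + c y z"
begin

definition row_sum :: "('a \<times> 'a \<Rightarrow> real) \<Rightarrow> 'a \<Rightarrow> real" where
  "row_sum p x = (\<Sum>y\<in>I. p (x, y))"

definition col_sum :: "('a \<times> 'a \<Rightarrow> real) \<Rightarrow> 'a \<Rightarrow> real" where
  "col_sum p y = (\<Sum>x\<in>I. p (x, y))"

definition cost :: "('a \<times> 'a \<Rightarrow> real) \<Rightarrow> real" where
  "cost p = (\<Sum>x\<in>I. \<Sum>y\<in>I. p (x, y) * c x y)"

definition marginal_error :: "('a \<times> 'a \<Rightarrow> real) \<Rightarrow> real" where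
  "marginal_error p = (\<Sum>x\<in>I. (row_sum p x - m x)\<^sup>2) + (\<Sum>y\<in>I. (col_sum p y - k y)\<^sup>2)"

definition penalised_cost :: "real \<Rightarrow> ('a \<times> 'a \<Rightarrow> real) \<Rightarrow> real" where
  "penalised_cost \<tau> p = cost p + marginal_error p / (2 * \<tau>)"

text \<open>The bound 4 only serves compactness: it is inactive at minimisers of the penalised cost, whose
  entries are at most 3.\<close>
abbreviation bounded_plans :: "('a \<times> 'a \<Rightarrow> real) set" where
  "bounded_plans \<equiv> {p. \<forall>z. 0 \<le> p z \<and> p z \<le> 4}"

lemma m_le_1: "x \<in> I \<Longrightarrow> m x \<le> 1" and k_le_1: "x \<in> I \<Longrightarrow> k x \<le> 1"
  using member_le_sum[of x I m] member_le_sum[of x I k] finite m_nonneg m_sum k_nonneg k_sum by auto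

lemma continuous_on_cost: "continuous_on S cost"
  and continuous_on_marginal_error: "continuous_on S marginal_error"
  unfolding cost_def marginal_error_def row_sum_def col_sum_def
  by (intro continuous_intros continuous_on_subset[OF continuous_on_product_coordinates] subset_UNIV)+

lemma bounded_plans_attain_inf:
  assumes "continuous_on bounded_plans F"
  obtains p where "p \<in> bounded_plans" "\<And>p'. p' \<in> bounded_plans \<Longrightarrow> (F p :: real) \<le> F p'"
proof -
  have "bounded_plans \<noteq> {}" by (auto intro!: exI[of _ "\<lambda>_. 0"])
  then show ?thesis
    using continuous_attains_inf[OF compact_function_box _ assms] that by blast
qed

lemma cost_nonneg: "p \<in> bounded_plans \<Longrightarrow> 0 \<le> cost p"
  unfolding cost_def by (intro sum_nonneg mult_nonneg_nonneg c_nonneg) auto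

lemma marginal_error_nonneg: "0 \<le> marginal_error p"
  unfolding marginal_error_def by (intro add_nonneg_nonneg sum_nonneg) auto

lemma squared_errors_le_marginal_error:
  assumes "x \<in> I"
  shows "(row_sum p x - m x)\<^sup>2 \<le> marginal_error p" "(col_sum p x - k x)\<^sup>2 \<le> marginal_error p"
  using member_le_sum[of x I "\<lambda>x. (row_sum p x - m x)\<^sup>2"] member_le_sum[of x I "\<lambda>x. (col_sum p x - k x)\<^sup>2"]
    sum_nonneg[of I "\<lambda>x. (row_sum p x - m x)\<^sup>2"] sum_nonneg[of I "\<lambda>y. (col_sum p y - k y)\<^sup>2"] assms finite
  by (auto simp: marginal_error_def)

lemma product_plan_penalised_cost:
  obtains p where "p \<in> bounded_plans" "penalised_cost \<tau> p \<le> 1"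
proof -
  define p where "p z = (if z \<in> I \<times> I then m (fst z) * k (snd z) else 0)" for z
  have p: "p \<in> bounded_plans"
    by (auto simp: p_def m_nonneg k_nonneg intro!: order_trans[OF mult_mono[OF m_le_1 k_le_1]])
  have "row_sum p x = m x" "col_sum p x = k x" if "x \<in> I" for x
    using that m_sum k_sum by (simp_all add: row_sum_def col_sum_def p_def flip: sum_distrib_left sum_distrib_right)
  then have "penalised_cost \<tau> p = cost p" by (simp add: penalised_cost_def marginal_error_def)
  also have "\<dots> \<le> (\<Sum>x\<in>I. \<Sum>y\<in>I. p (x, y))"
    unfolding cost_def using p by (intro sum_mono mult_left_le c_le_1) auto
  also have "\<dots> = 1"
    using m_sum k_sum by (simp add: p_def flip: sum_distrib_left)
  finally show ?thesis using that p by blast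
qed

lemma penalised_cost_perturb:
  assumes ab: "a \<in> I" "b \<in> I" and "\<tau> > 0"
  shows "penalised_cost \<tau> (p((a, b) := p (a, b) + e)) = penalised_cost \<tau> p
    + e * (c a b + (row_sum p a - m a) / \<tau> + (col_sum p b - k b) / \<tau>) + e\<^sup>2 / \<tau>"
proof -
  define p' where "p' = p((a, b) := p (a, b) + e)"
  have p': "p' (x, y) = p (x, y) + (if x = a then if y = b then e else 0 else 0)" for x y
    by (auto simp: p'_def)
  have "(row_sum p' x - m x)\<^sup>2
      = (row_sum p x - m x)\<^sup>2 + (if x = a then 2 * e * (row_sum p a - m a) + e\<^sup>2 else 0)" for x
    using ab finite by (auto simp: row_sum_def p' sum.distrib power2_eq_square algebra_simps)
  moreover have "(col_sum p' x - k x)\<^sup>2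
      = (col_sum p x - k x)\<^sup>2 + (if x = b then 2 * e * (col_sum p b - k b) + e\<^sup>2 else 0)" for x
    using ab finite by (auto simp: col_sum_def p' sum.distrib power2_eq_square algebra_simps)
  ultimately have "marginal_error p' = marginal_error p
      + (2 * e * (row_sum p a - m a) + e\<^sup>2) + (2 * e * (col_sum p b - k b) + e\<^sup>2)"
    using ab finite by (simp add: marginal_error_def sum.distrib)
  moreover have "cost p' = cost p + e * c a b"
  proof -
    have "p' (x, y) * c x y = p (x, y) * c x y + (if x = a then if y = b then e * c a b else 0 else 0)" for x y
      by (auto simp: p' algebra_simps)
    moreover have "(\<Sum>x\<in>I. \<Sum>y\<in>I. if x = a then if y = b then e * c a b else 0 else 0)
        = (\<Sum>x\<in>I. if x = a then e * c a b else 0)"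
      using ab finite by (intro sum.cong) auto
    ultimately show ?thesis
      using ab finite by (simp add: cost_def sum.distrib)
  qed
  ultimately show ?thesis
    unfolding p'_def[symmetric] penalised_cost_def using \<open>\<tau> > 0\<close> by (simp add: divide_simps) (simp add: algebra_simps)
qed

context
  fixes \<tau> :: real and p :: "'a \<times> 'a \<Rightarrow> real"
  assumes \<tau>: "0 < \<tau>" "\<tau> \<le> 1" and p: "p \<in> bounded_plans"
    and minimal: "\<And>p'. p' \<in> bounded_plans \<Longrightarrow> penalised_cost \<tau> p \<le> penalised_cost \<tau> p'"
begin

definition row_potential :: "'a \<Rightarrow> real" where
  "row_potential x = (m x - row_sum p x) / \<tau>"

definition col_potential :: "'a \<Rightarrow> real" where
  "col_potential y = (k y - col_sum p y) / \<tau>"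

lemma minimiser_marginal_error: "marginal_error p \<le> 2 * \<tau>"
proof -
  obtain p\<^sub>0 where "p\<^sub>0 \<in> bounded_plans" "penalised_cost \<tau> p\<^sub>0 \<le> 1" by (rule product_plan_penalised_cost)
  then have "penalised_cost \<tau> p \<le> 1" using minimal order_trans by blast
  then have "marginal_error p / (2 * \<tau>) \<le> 1"
    using cost_nonneg[OF p] by (simp add: penalised_cost_def)
  then show ?thesis using \<tau> by (simp add: field_simps)
qed

lemma minimiser_le_3:
  assumes "x \<in> I" "y \<in> I"
  shows "p (x, y) \<le> 3"
proof -
  have "p (x, y) \<le> row_sum p x"
    unfolding row_sum_def using member_le_sum[of y I "\<lambda>y. p (x, y)"] assms finite p by simp
  moreover have "(row_sum p x - m x)\<^sup>2 \<le> 2\<^sup>2"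
    using squared_errors_le_marginal_error(1)[OF assms(1), of p] minimiser_marginal_error \<tau> by simp
  then have "row_sum p x - m x \<le> 2"
    by (rule power2_le_imp_le) simp
  ultimately show ?thesis using m_le_1[OF assms(1)] by simp
qed

lemma minimiser_first_order:
  assumes "a \<in> I" "b \<in> I" "0 \<le> p (a, b) + e" "p (a, b) + e \<le> 4"
  shows "0 \<le> e * (c a b - row_potential a - col_potential b) + e\<^sup>2 / \<tau>"
proof -
  have "p((a, b) := p (a, b) + e) \<in> bounded_plans" using p assms(3,4) by auto
  from minimal[OF this] have "0 \<le> e * (c a b + (row_sum p a - m a) / \<tau> + (col_sum p b - k b) / \<tau>) + e\<^sup>2 / \<tau>"
    using penalised_cost_perturb[OF assms(1,2) \<tau>(1), of p e] by linarith
  moreover have "c a b + (row_sum p a - m a) / \<tau> + (col_sum p b - k b) / \<tau>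
      = c a b - row_potential a - col_potential b"
    by (simp add: row_potential_def col_potential_def diff_divide_distrib)
  ultimately show ?thesis by simp
qed

lemma potentials_feasible:
  assumes "a \<in> I" "b \<in> I"
  shows "row_potential a + col_potential b \<le> c a b"
proof -
  have "0 \<le> c a b - row_potential a - col_potential b"
  proof (rule quadratic_germ_nonneg[of 1 \<tau>])
    show "0 \<le> e * (c a b - row_potential a - col_potential b) + e\<^sup>2 / \<tau>" if "0 < e" "e \<le> 1" for e
      using that p minimiser_le_3[OF assms] by (intro minimiser_first_order[OF assms]) auto
  qed (use \<tau> in auto)
  then show ?thesis by simp
qed

lemma complementary_slackness:
  assumes "a \<in> I" "b \<in> I"
  shows "p (a, b) * c a b = p (a, b) * (row_potential a + col_potential b)"
proof (cases "p (a, b) = 0")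
  case False
  have "0 \<le> - (c a b - row_potential a - col_potential b)"
  proof (rule quadratic_germ_nonneg[of "p (a, b)" \<tau>])
    show "0 \<le> e * - (c a b - row_potential a - col_potential b) + e\<^sup>2 / \<tau>" if "0 < e" "e \<le> p (a, b)" for e
      using that minimiser_le_3[OF assms] minimiser_first_order[OF assms, of "- e"] by (simp add: algebra_simps)
    show "0 < p (a, b)" using p False by (simp add: less_le)
  qed (rule \<tau>)
  then show ?thesis using potentials_feasible[OF assms] by simp
qed simp

lemma Lipschitz_potential:
  obtains f where "\<And>x y. f x - f y \<le> c x y" "\<And>x. x \<in> I \<Longrightarrow> row_potential x \<le> f x" "\<And>x. x \<in> I \<Longrightarrow> f x \<le> - col_potential x"
proof -
  have "I \<noteq> {}" using m_sum by auto
  define f where "f x = Min ((\<lambda>j. c x j - col_potential j) ` I)" for x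
  have f_le: "f x \<le> c x j - col_potential j" if "j \<in> I" for x j
    unfolding f_def using that finite by (intro Min_le) auto
  have f_attained: "\<exists>j\<in>I. f x = c x j - col_potential j" for x
  proof -
    have "f x \<in> (\<lambda>j. c x j - col_potential j) ` I"
      unfolding f_def using finite \<open>I \<noteq> {}\<close> by (intro Min_in) auto
    then show ?thesis by auto
  qed
  show ?thesis
  proof (rule that)
    show "f x - f y \<le> c x y" for x y
    proof -
      obtain j where "j \<in> I" "f y = c y j - col_potential j" using f_attained by blast
      then show ?thesis using f_le[of j x] c_triangle[of x j y] by simp
    qed
    show "row_potential x \<le> f x" if "x \<in> I" for x
      using f_attained[of x] potentials_feasible[OF that] by force
    show "f x \<le> - col_potential x" if "x \<in> I" for x
      using f_le[OF that, of x] by (simp add: c_self)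
  qed
qed

lemma minimiser_cost_le:
  assumes dual: "\<And>f. (\<And>x y. f x - f y \<le> c x y) \<Longrightarrow> (\<Sum>x\<in>I. f x * (m x - k x)) \<le> D"
  shows "cost p \<le> D"
proof -
  obtain f where Lip: "\<And>x y. f x - f y \<le> c x y"
    and f: "\<And>x. x \<in> I \<Longrightarrow> row_potential x \<le> f x" "\<And>x. x \<in> I \<Longrightarrow> f x \<le> - col_potential x"
    using Lipschitz_potential by blast
  have marginals: "row_sum p x = m x - \<tau> * row_potential x" "col_sum p x = k x - \<tau> * col_potential x" for x
    using \<tau> by (auto simp: row_potential_def col_potential_def)
  have "cost p = (\<Sum>x\<in>I. \<Sum>y\<in>I. p (x, y) * row_potential x + p (x, y) * col_potential y)"
    unfolding cost_def by (intro sum.cong refl) (simp add: complementary_slackness distrib_left)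
  also have "\<dots> = (\<Sum>x\<in>I. row_sum p x * row_potential x) + (\<Sum>y\<in>I. col_sum p y * col_potential y)"
    unfolding sum.distrib row_sum_def col_sum_def sum_distrib_right by (subst (2) sum.swap) simp
  also have "\<dots> \<le> (\<Sum>x\<in>I. m x * row_potential x) + (\<Sum>y\<in>I. k y * col_potential y)"
    using \<tau> by (intro add_mono sum_mono) (auto simp: marginals algebra_simps)
  also have "\<dots> \<le> (\<Sum>x\<in>I. m x * f x) + (\<Sum>y\<in>I. k y * (- f y))"
    using f m_nonneg k_nonneg by (intro add_mono sum_mono mult_left_mono) (auto simp: le_minus_iff)
  also have "\<dots> = (\<Sum>x\<in>I. f x * (m x - k x))"
    by (simp add: algebra_simps sum_negf sum_subtractf)
  also have "\<dots> \<le> D" by (intro dual Lip)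
  finally show ?thesis .
qed

end

theorem finite_transport_duality:
  assumes dual: "\<And>f. (\<And>x y. f x - f y \<le> c x y) \<Longrightarrow> (\<Sum>x\<in>I. f x * (m x - k x)) \<le> D"
  obtains p where "\<And>x y. 0 \<le> p (x, y)" "\<And>x. x \<in> I \<Longrightarrow> (\<Sum>y\<in>I. p (x, y)) = m x"
    "\<And>y. y \<in> I \<Longrightarrow> (\<Sum>x\<in>I. p (x, y)) = k y" "(\<Sum>x\<in>I. \<Sum>y\<in>I. p (x, y) * c x y) \<le> D"
proof -
  define defect where "defect p = marginal_error p + max 0 (cost p - D)" for p
  obtain p where p: "p \<in> bounded_plans" and minimal: "\<And>p'. p' \<in> bounded_plans \<Longrightarrow> defect p \<le> defect p'"
    by (rule bounded_plans_attain_inf[of defect])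
      (auto simp: defect_def[abs_def] intro!: continuous_intros continuous_on_cost continuous_on_marginal_error)
  have "defect p \<le> 0 + e" if "e > 0" for e
  proof -
    define \<tau> where "\<tau> = min 1 (e / 2)"
    have \<tau>: "0 < \<tau>" "\<tau> \<le> 1" "2 * \<tau> \<le> e" using that by (auto simp: \<tau>_def)
    obtain p' where p': "p' \<in> bounded_plans" "\<And>p''. p'' \<in> bounded_plans \<Longrightarrow> penalised_cost \<tau> p' \<le> penalised_cost \<tau> p''"
      by (rule bounded_plans_attain_inf[of "penalised_cost \<tau>"])
        (auto simp: penalised_cost_def[abs_def]
          intro!: continuous_intros continuous_on_cost continuous_on_marginal_error, use \<tau> in auto)
    have "defect p' \<le> 2 * \<tau>"
      using minimiser_marginal_error[OF \<tau>(1,2) p'] minimiser_cost_le[OF \<tau>(1,2) p' dual] by (simp add: defect_def)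
    then show ?thesis using minimal[OF p'(1)] \<tau>(3) by simp
  qed
  then have "defect p \<le> 0" by (rule field_le_epsilon)
  then have "marginal_error p = 0" "cost p \<le> D"
    using marginal_error_nonneg[of p] by (auto simp: defect_def)
  then have "row_sum p x = m x" "col_sum p x = k x" if "x \<in> I" for x
    using squared_errors_le_marginal_error[OF that, of p] by auto
  then show ?thesis
    using that[of p] p \<open>cost p \<le> D\<close> by (auto simp: row_sum_def col_sum_def cost_def)
qed

end

section \<open>Kantorovich duality for the truncated metric\<close>

lemma (in prob_space) integral_finite_partition:
  fixes h :: "'b \<Rightarrow> real"
  assumes I: "finite I" "S \<in> space M \<rightarrow> I" and S: "\<And>a. a \<in> I \<Longrightarrow> {\<omega> \<in> space M. S \<omega> = a} \<in> events"
  shows "integrable M (\<lambda>\<omega>. h (S \<omega>))" "(\<integral>\<omega>. h (S \<omega>) \<partial>M) = (\<Sum>a\<in>I. h a * prob {\<omega> \<in> space M. S \<omega> = a})"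
proof -
  have step: "h (S \<omega>) = (\<Sum>a\<in>I. h a * indicator {\<omega> \<in> space M. S \<omega> = a} \<omega>)" if "\<omega> \<in> space M" for \<omega>
  proof -
    have "S \<omega> \<in> I" using I(2) that by auto
    then have "h (S \<omega>) = (\<Sum>a\<in>I. if a = S \<omega> then h a else 0)" using I(1) by simp
    also have "\<dots> = (\<Sum>a\<in>I. h a * indicator {\<omega> \<in> space M. S \<omega> = a} \<omega>)"
      using that by (intro sum.cong) auto
    finally show ?thesis .
  qed
  have int: "integrable M (\<lambda>\<omega>. h a * indicator {\<omega> \<in> space M. S \<omega> = a} \<omega>)" if "a \<in> I" for a
    using S[OF that] by (intro integrable_mult_right integrable_real_indicator) (auto simp: less_top[symmetric])
  show "integrable M (\<lambda>\<omega>. h (S \<omega>))"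
    using int by (subst Bochner_Integration.integrable_cong[OF refl step]) auto
  have "(\<integral>\<omega>. h (S \<omega>) \<partial>M) = (\<integral>\<omega>. (\<Sum>a\<in>I. h a * indicator {\<omega> \<in> space M. S \<omega> = a} \<omega>) \<partial>M)"
    by (rule Bochner_Integration.integral_cong[OF refl step])
  also have "\<dots> = (\<Sum>a\<in>I. h a * prob {\<omega> \<in> space M. S \<omega> = a})"
    using int S by (subst Bochner_Integration.integral_sum) auto
  finally show "(\<integral>\<omega>. h (S \<omega>) \<partial>M) = (\<Sum>a\<in>I. h a * prob {\<omega> \<in> space M. S \<omega> = a})" .
qed

lemma finite_range_quantizer:
  fixes \<mu> \<nu> :: "'a::{second_countable_topology, metric_space} measure"
  assumes "borel_distribution \<mu>" "borel_distribution \<nu>" "\<epsilon> > 0"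
  obtains T :: "'a \<Rightarrow> 'a" where "T \<in> borel \<rightarrow>\<^sub>M borel" "finite (range T)"
    "(\<integral>x. trunc_dist x (T x) \<partial>\<mu>) \<le> \<epsilon>" "(\<integral>x. trunc_dist x (T x) \<partial>\<nu>) \<le> \<epsilon>"
proof -
  obtain F :: "nat \<Rightarrow> 'a \<Rightarrow> 'a" where F: "\<And>i. simple_function borel (F i)" "\<And>x. (\<lambda>i. F i x) \<longlonglongrightarrow> x"
    using borel_measurable_implies_sequence_metric[of "\<lambda>x::'a. x" borel undefined] by auto
  have F_meas [measurable]: "F i \<in> borel \<rightarrow>\<^sub>M borel" for i by (rule borel_measurable_simple_function[OF F(1)])
  have lim: "(\<lambda>i. \<integral>x. trunc_dist x (F i x) \<partial>\<mu>) \<longlonglongrightarrow> 0" if "borel_distribution \<mu>" for \<mu>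
  proof -
    interpret borel_distribution \<mu> by fact
    have "(\<lambda>i. trunc_dist x (F i x)) \<longlonglongrightarrow> min (dist x x) 1" for x
      unfolding trunc_dist_def by (intro tendsto_intros F)
    then have "(\<lambda>i. \<integral>x. trunc_dist x (F i x) \<partial>\<mu>) \<longlonglongrightarrow> (\<integral>x. 0 \<partial>\<mu>)"
      by (intro integral_dominated_convergence[where w="\<lambda>_. 1"]) auto
    then show ?thesis by simp
  qed
  have "eventually (\<lambda>i. (\<integral>x. trunc_dist x (F i x) \<partial>\<mu>) < \<epsilon> \<and> (\<integral>x. trunc_dist x (F i x) \<partial>\<nu>) < \<epsilon>) sequentially"
    using order_tendstoD(2)[OF lim \<open>\<epsilon> > 0\<close>] assms(1,2) by (intro eventually_conj) auto
  then obtain i where "(\<integral>x. trunc_dist x (F i x) \<partial>\<mu>) < \<epsilon>" "(\<integral>x. trunc_dist x (F i x) \<partial>\<nu>) < \<epsilon>"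
    unfolding eventually_sequentially by auto
  moreover have "finite (range (F i))" using F(1)[of i] by (auto simp: simple_function_def)
  ultimately show ?thesis using that[of "F i"] by auto
qed

lemma density_transport_kernel:
  fixes \<mu> \<nu> :: "'a::topological_space measure"
  assumes \<mu>: "borel_distribution \<mu>" and \<nu>: "borel_distribution \<nu>"
    and G [measurable]: "G \<in> borel_measurable (borel \<Otimes>\<^sub>M borel)"
    and rows: "\<And>x. (\<integral>\<^sup>+y. G (x, y) \<partial>\<nu>) = 1" and cols: "AE y in \<nu>. (\<integral>\<^sup>+x. G (x, y) \<partial>\<mu>) = 1"
  shows "(\<lambda>x. density \<nu> (\<lambda>y. G (x, y))) \<in> borel \<rightarrow>\<^sub>M prob_algebra borel" (is "?\<kappa> \<in> _")
    and "\<mu> \<bind> (\<lambda>x. density \<nu> (\<lambda>y. G (x, y))) = \<nu>"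
proof -
  interpret \<mu>: borel_distribution \<mu> by fact
  interpret \<nu>: borel_distribution \<nu> by fact
  interpret pair_prob_space \<mu> \<nu> ..
  have emeasure: "emeasure (?\<kappa> x) A = (\<integral>\<^sup>+y. G (x, y) * indicator A y \<partial>\<nu>)" if "A \<in> sets borel" for x A
    using that by (intro emeasure_density) auto
  have prob: "prob_space (?\<kappa> x)" for x
    by (rule prob_spaceI) (use emeasure[of UNIV x] rows in simp)
  show kernel: "?\<kappa> \<in> borel \<rightarrow>\<^sub>M prob_algebra borel"
  proof (intro measurable_prob_algebraI measurable_subprob_algebra)
    fix A :: "'a set" assume [measurable]: "A \<in> sets borel"
    show "(\<lambda>x. emeasure (?\<kappa> x) A) \<in> borel_measurable borel"
      by (subst emeasure) (auto, measurable)
  qed (auto intro!: prob_space_imp_subprob_space prob)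
  have \<kappa>\<mu>: "?\<kappa> \<in> \<mu> \<rightarrow>\<^sub>M prob_algebra borel" using kernel by (simp cong: measurable_cong_sets)
  interpret bind: borel_distribution "\<mu> \<bind> ?\<kappa>" by (rule borel_distribution_bind[OF \<mu>.prob_space_axioms \<kappa>\<mu>])
  show "\<mu> \<bind> ?\<kappa> = \<nu>"
  proof (rule measure_eqI)
    fix A assume "A \<in> sets (\<mu> \<bind> ?\<kappa>)"
    then have A [measurable]: "A \<in> sets borel" by simp
    have "emeasure (\<mu> \<bind> ?\<kappa>) A = (\<integral>\<^sup>+x. \<integral>\<^sup>+y. G (x, y) * indicator A y \<partial>\<nu> \<partial>\<mu>)"
      using emeasure_bind[OF _ measurable_prob_algebraD[OF \<kappa>\<mu>] A] by (simp add: emeasure[OF A])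
    also have "\<dots> = (\<integral>\<^sup>+y. (\<integral>\<^sup>+x. G (x, y) \<partial>\<mu>) * indicator A y \<partial>\<nu>)"
      by (subst Fubini'[symmetric]) (auto simp: nn_integral_multc)
    also have "\<dots> = (\<integral>\<^sup>+y. indicator A y \<partial>\<nu>)"
      by (rule nn_integral_cong_AE) (use cols in \<open>eventually_elim, simp\<close>)
    finally show "emeasure (\<mu> \<bind> ?\<kappa>) A = emeasure \<nu> A" by simp
  qed simp
qed

context
  fixes T :: "'a::{second_countable_topology, metric_space} \<Rightarrow> 'a"
  assumes T [measurable]: "T \<in> borel \<rightarrow>\<^sub>M borel" and finite_range: "finite (range T)"
begin

lemma fibre_measurable: "T -` {a} \<in> sets borel"
  using measurable_sets[OF T, of "{a}"] by simp

lemma quantized_integral: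
  fixes f :: "'a \<Rightarrow> real"
  assumes "borel_distribution M"
  shows "integrable M (\<lambda>x. f (T x))" "(\<integral>x. f (T x) \<partial>M) = (\<Sum>a\<in>range T. f a * measure M (T -` {a}))"
proof -
  interpret borel_distribution M by fact
  have "{x. T x = a} = T -` {a}" for a by auto
  then show "integrable M (\<lambda>x. f (T x))" "(\<integral>x. f (T x) \<partial>M) = (\<Sum>a\<in>range T. f a * measure M (T -` {a}))"
    using integral_finite_partition[of "range T" T f] finite_range fibre_measurable by auto
qed

lemma quantized_function_measurable:
  fixes g :: "'a \<times> 'a \<Rightarrow> real"
  shows "(\<lambda>z. g (T (fst z), T (snd z))) \<in> borel_measurable (borel \<Otimes>\<^sub>M borel)"
proof -
  have simple: "simple_function N (\<lambda>z. T (f z))" if [measurable]: "f \<in> N \<rightarrow>\<^sub>M borel" for N and f :: "'c \<Rightarrow> 'a"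
    unfolding simple_function_def
  proof (intro conjI ballI)
    show "finite ((\<lambda>z. T (f z)) ` space N)" by (rule finite_subset[OF _ finite_range]) auto
    fix a
    have "(\<lambda>z. T (f z)) -` {a} \<inter> space N = f -` (T -` {a}) \<inter> space N" by auto
    also have "\<dots> \<in> sets N" by (rule measurable_sets[OF that fibre_measurable])
    finally show "(\<lambda>z. T (f z)) -` {a} \<inter> space N \<in> sets N" .
  qed
  have "simple_function (borel \<Otimes>\<^sub>M borel) (\<lambda>z. g (T (fst z), T (snd z)))"
    by (rule simple_function_compose2[where h="\<lambda>a b. g (a, b)", OF simple simple]) auto
  then show ?thesis by (rule borel_measurable_simple_function)
qed

lemma quantized_pair_integral:
  fixes h :: "'a \<Rightarrow> 'a \<Rightarrow> real"
  assumes c: "c \<in> couplings \<mu> \<nu>"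
  shows "(\<integral>z. h (T (fst z)) (T (snd z)) \<partial>c) = (\<Sum>a\<in>range T. \<Sum>b\<in>range T. h a b * measure c (T -` {a} \<times> T -` {b}))"
proof -
  interpret prob_space c by (rule couplingsD(1)[OF c])
  have space: "space c = UNIV"
    using sets_eq_imp_space_eq[OF couplingsD(2)[OF c]] by (simp add: space_pair_measure)
  have cell: "{z \<in> space c. (T (fst z), T (snd z)) = w} = T -` {fst w} \<times> T -` {snd w}" for w
    by (auto simp: space)
  have "T -` {fst w} \<times> T -` {snd w} \<in> sets c" for w
    unfolding couplingsD(2)[OF c] by (intro pair_measureI fibre_measurable)
  then show ?thesis
    using integral_finite_partition(2)[of "range T \<times> range T" "\<lambda>z. (T (fst z), T (snd z))"
        "\<lambda>w. h (fst w) (snd w)"] finite_range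
    by (simp add: cell sum.cartesian_product split_beta')
qed

lemma quantized_trunc_Lipschitz_integral:
  assumes f: "trunc_Lipschitz f" and M: "borel_distribution M"
  shows "\<bar>(\<integral>x. f (T x) \<partial>M) - (\<integral>x. f x \<partial>M)\<bar> \<le> (\<integral>x. trunc_dist x (T x) \<partial>M)"
proof -
  interpret M: borel_distribution M by fact
  have int: "integrable M (\<lambda>x. f (T x))" "integrable M f" "integrable M (\<lambda>x. trunc_dist x (T x))"
    using trunc_Lipschitz_comp_integrable[OF M.prob_space_axioms f, of T] trunc_Lipschitz_integrable[OF M f]
    by (auto intro!: M.integrable_const_bound[where B=1])
  have bound: "\<bar>f (T x) - f x\<bar> \<le> trunc_dist x (T x)" for x
    using trunc_Lipschitz_abs_diff[OF f, of "T x" x] by (simp add: trunc_dist_commute)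
  have "\<bar>(\<integral>x. f (T x) \<partial>M) - (\<integral>x. f x \<partial>M)\<bar> = \<bar>\<integral>x. f (T x) - f x \<partial>M\<bar>" using int by simp
  also have "\<dots> \<le> (\<integral>x. \<bar>f (T x) - f x\<bar> \<partial>M)" by (rule integral_abs_bound)
  also have "\<dots> \<le> (\<integral>x. trunc_dist x (T x) \<partial>M)"
    using int bound by (intro integral_mono) auto
  finally show ?thesis .
qed

lemma coupling_trunc_dist_le_quantized:
  assumes c: "c \<in> couplings \<mu> \<nu>"
  shows "(\<integral>z. trunc_dist (fst z) (snd z) \<partial>c) \<le>
    (\<integral>x. trunc_dist x (T x) \<partial>\<mu>) + (\<integral>z. trunc_dist (T (fst z)) (T (snd z)) \<partial>c) + (\<integral>y. trunc_dist y (T y) \<partial>\<nu>)"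
proof -
  interpret prob_space c by (rule couplingsD(1)[OF c])
  note [measurable_cong] = couplingsD(2)[OF c]
  have int: "integrable c (\<lambda>z. trunc_dist (f z) (g z))"
    if [measurable]: "f \<in> c \<rightarrow>\<^sub>M borel" "g \<in> c \<rightarrow>\<^sub>M borel" for f g :: "'a \<times> 'a \<Rightarrow> 'a"
    by (rule integrable_const_bound[where B=1]) auto
  have "trunc_dist x y \<le> trunc_dist x (T x) + trunc_dist (T x) (T y) + trunc_dist y (T y)" for x y
    using trunc_dist_triangle[of x y "T x"] trunc_dist_triangle[of "T x" y "T y"] trunc_dist_commute[of y "T y"]
    by linarith
  then have "(\<integral>z. trunc_dist (fst z) (snd z) \<partial>c) \<le> (\<integral>z. trunc_dist (fst z) (T (fst z))
      + trunc_dist (T (fst z)) (T (snd z)) + trunc_dist (snd z) (T (snd z)) \<partial>c)"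
    by (intro integral_mono Bochner_Integration.integrable_add int) measurable
  also have "\<dots> = (\<integral>z. trunc_dist (fst z) (T (fst z)) \<partial>c) + (\<integral>z. trunc_dist (T (fst z)) (T (snd z)) \<partial>c)
      + (\<integral>z. trunc_dist (snd z) (T (snd z)) \<partial>c)"
    by (simp add: int)
  finally show ?thesis
    by (simp add: coupling_integral[OF c, of "\<lambda>x. trunc_dist x (T x)"])
qed

context
  fixes \<mu> \<nu> :: "'a measure" and p :: "'a \<times> 'a \<Rightarrow> real"
  assumes \<mu>: "borel_distribution \<mu>" and \<nu>: "borel_distribution \<nu>"
    and plan_nonneg: "\<And>a b. 0 \<le> p (a, b)"
    and plan_rows: "\<And>a. a \<in> range T \<Longrightarrow> (\<Sum>b\<in>range T. p (a, b)) = measure \<mu> (T -` {a})"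
    and plan_cols: "\<And>b. b \<in> range T \<Longrightarrow> (\<Sum>a\<in>range T. p (a, b)) = measure \<nu> (T -` {b})"
begin

interpretation \<mu>: borel_distribution \<mu> by (rule \<mu>)
interpretation \<nu>: borel_distribution \<nu> by (rule \<nu>)

definition plan_density :: "'a \<times> 'a \<Rightarrow> real" where
  "plan_density z = (if measure \<mu> (T -` {fst z}) = 0 then 1
     else p z / (measure \<mu> (T -` {fst z}) * measure \<nu> (T -` {snd z})))"

lemma plan_density_nonneg: "0 \<le> plan_density (a, b)"
  by (simp add: plan_density_def plan_nonneg)

lemma plan_null:
  assumes "a \<in> range T" "b \<in> range T" "measure \<mu> (T -` {a}) = 0 \<or> measure \<nu> (T -` {b}) = 0"
  shows "p (a, b) = 0"
  using assms plan_nonneg plan_rows[OF assms(1)] plan_cols[OF assms(2)] finite_range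
  by (auto simp: sum_nonneg_eq_0_iff)

lemma plan_density_cell:
  assumes "a \<in> range T" "b \<in> range T"
  shows "plan_density (a, b) * measure \<mu> (T -` {a}) * measure \<nu> (T -` {b}) = p (a, b)"
  using plan_null[OF assms] by (auto simp: plan_density_def)

lemma plan_density_row_sum:
  assumes "a \<in> range T"
  shows "(\<Sum>b\<in>range T. plan_density (a, b) * measure \<nu> (T -` {b})) = 1"
proof (cases "measure \<mu> (T -` {a}) = 0")
  case True
  then show ?thesis
    using quantized_integral(2)[OF \<nu>, of "\<lambda>_. 1"] by (simp add: plan_density_def)
next
  case False
  have "(\<Sum>b\<in>range T. plan_density (a, b) * measure \<nu> (T -` {b})) = (\<Sum>b\<in>range T. p (a, b) / measure \<mu> (T -` {a}))"
    by (intro sum.cong refl) (use False plan_null[OF assms] in \<open>auto simp: plan_density_def\<close>)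
  also have "\<dots> = 1" using plan_rows[OF assms] False by (simp flip: sum_divide_distrib)
  finally show ?thesis .
qed

lemma plan_density_col_sum:
  assumes "b \<in> range T" "measure \<nu> (T -` {b}) \<noteq> 0"
  shows "(\<Sum>a\<in>range T. plan_density (a, b) * measure \<mu> (T -` {a})) = 1"
proof -
  have "(\<Sum>a\<in>range T. plan_density (a, b) * measure \<mu> (T -` {a})) = (\<Sum>a\<in>range T. p (a, b) / measure \<nu> (T -` {b}))"
    by (intro sum.cong refl) (use plan_null[OF _ assms(1)] in \<open>auto simp: plan_density_def\<close>)
  also have "\<dots> = 1" using plan_cols[OF assms(1)] assms(2) by (simp flip: sum_divide_distrib)
  finally show ?thesis .
qed

definition plan_kernel :: "'a \<Rightarrow> 'a measure" where
  "plan_kernel x = density \<nu> (\<lambda>y. ennreal (plan_density (T x, T y)))"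

lemma plan_kernel_transport: "plan_kernel \<in> borel \<rightarrow>\<^sub>M prob_algebra borel" "\<mu> \<bind> plan_kernel = \<nu>"
proof -
  define G where "G z = ennreal (plan_density (T (fst z), T (snd z)))" for z
  have G: "G \<in> borel_measurable (borel \<Otimes>\<^sub>M borel)"
    unfolding G_def using quantized_function_measurable by measurable
  have int: "(\<integral>\<^sup>+x. ennreal (f (T x)) \<partial>M) = ennreal (\<Sum>a\<in>range T. f a * measure M (T -` {a}))"
    if "borel_distribution M" "\<And>a. 0 \<le> f a" for M f
    using quantized_integral[OF that(1), of f] that(2) by (subst nn_integral_eq_integral) auto
  have rows: "(\<integral>\<^sup>+y. G (x, y) \<partial>\<nu>) = 1" for x
    using int[OF \<nu>, of "\<lambda>b. plan_density (T x, b)"] by (simp add: G_def plan_density_row_sum plan_density_nonneg)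
  have "AE y in \<nu>. \<forall>b\<in>{b \<in> range T. measure \<nu> (T -` {b}) = 0}. y \<notin> T -` {b}"
    using finite_range fibre_measurable
    by (intro AE_finite_allI AE_not_in null_setsI) (auto simp: \<nu>.emeasure_eq_measure)
  then have "AE y in \<nu>. measure \<nu> (T -` {T y}) \<noteq> 0" by eventually_elim auto
  then have cols: "AE y in \<nu>. (\<integral>\<^sup>+x. G (x, y) \<partial>\<mu>) = 1"
  proof eventually_elim
    case (elim y)
    then show ?case
      using int[OF \<mu>, of "\<lambda>a. plan_density (a, T y)"] by (simp add: G_def plan_density_col_sum plan_density_nonneg)
  qed
  show "plan_kernel \<in> borel \<rightarrow>\<^sub>M prob_algebra borel" "\<mu> \<bind> plan_kernel = \<nu>"
    using density_transport_kernel[OF \<mu> \<nu> G rows cols] by (simp_all add: G_def plan_kernel_def[abs_def])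
qed

lemma emeasure_plan_kernel_joint_cell:
  assumes "a \<in> range T" "b \<in> range T"
  shows "emeasure (kernel_joint \<mu> (\<lambda>x. x) plan_kernel) (T -` {a} \<times> T -` {b}) = ennreal (p (a, b))"
proof -
  have [measurable]: "T -` {a} \<times> T -` {b} \<in> sets (borel \<Otimes>\<^sub>M borel)" by (intro pair_measureI fibre_measurable)
  have [measurable]: "T -` {c} \<in> sets borel" for c by (rule fibre_measurable)
  have [measurable]: "(\<lambda>y. plan_density (T x, T y)) \<in> borel_measurable borel" for x
    using measurable_Pair2[OF quantized_function_measurable, of x plan_density] by simp
  have kernel: "plan_kernel \<in> \<mu> \<rightarrow>\<^sub>M prob_algebra borel" using plan_kernel_transport(1)
    by (simp cong: measurable_cong_sets)
  have "emeasure (kernel_joint \<mu> (\<lambda>x. x) plan_kernel) (T -` {a} \<times> T -` {b})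
      = (\<integral>\<^sup>+x. \<integral>\<^sup>+y. indicator (T -` {a} \<times> T -` {b}) (x, y) \<partial>plan_kernel x \<partial>\<mu>)"
    using nn_integral_kernel_joint[OF \<mu>.prob_space_axioms _ kernel, of "\<lambda>x. x" "indicator (T -` {a} \<times> T -` {b})"]
    by (simp add: sets_kernel_joint[OF \<mu>.prob_space_axioms _ kernel])
  also have "\<dots> = (\<integral>\<^sup>+x. \<integral>\<^sup>+y. (ennreal (plan_density (a, b)) * indicator (T -` {a}) x)
      * indicator (T -` {b}) y \<partial>\<nu> \<partial>\<mu>)"
  proof (rule nn_integral_cong)
    fix x
    have "(\<integral>\<^sup>+y. indicator (T -` {a} \<times> T -` {b}) (x, y) \<partial>plan_kernel x)
        = (\<integral>\<^sup>+y. ennreal (plan_density (T x, T y)) * indicator (T -` {a} \<times> T -` {b}) (x, y) \<partial>\<nu>)"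
      unfolding plan_kernel_def by (rule nn_integral_density) measurable
    also have "\<dots> = (\<integral>\<^sup>+y. (ennreal (plan_density (a, b)) * indicator (T -` {a}) x) * indicator (T -` {b}) y \<partial>\<nu>)"
      by (intro nn_integral_cong) (auto split: split_indicator)
    finally show "(\<integral>\<^sup>+y. indicator (T -` {a} \<times> T -` {b}) (x, y) \<partial>plan_kernel x) = \<dots>" .
  qed
  also have "\<dots> = ennreal (plan_density (a, b) * measure \<mu> (T -` {a}) * measure \<nu> (T -` {b}))"
    by (simp add: nn_integral_cmult_indicator nn_integral_multc \<mu>.emeasure_eq_measure \<nu>.emeasure_eq_measure
        ennreal_mult plan_density_nonneg)
  finally show ?thesis by (simp add: plan_density_cell[OF assms])
qed

lemma kernel_of_finite_plan:
  obtains \<kappa> where "\<kappa> \<in> borel \<rightarrow>\<^sub>M prob_algebra borel" "\<mu> \<bind> \<kappa> = \<nu>"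
    "\<And>a b. a \<in> range T \<Longrightarrow> b \<in> range T \<Longrightarrow>
      emeasure (kernel_joint \<mu> (\<lambda>x. x) \<kappa>) (T -` {a} \<times> T -` {b}) = ennreal (p (a, b))"
  using that plan_kernel_transport emeasure_plan_kernel_joint_cell by blast

end

end

lemma kernel_joint_id_coupling:
  assumes "borel_distribution \<mu>" "\<kappa> \<in> borel \<rightarrow>\<^sub>M prob_algebra borel"
  shows "kernel_joint \<mu> (\<lambda>x. x) \<kappa> \<in> couplings \<mu> (\<mu> \<bind> \<kappa>)"
proof -
  interpret borel_distribution \<mu> by fact
  show ?thesis
    using kernel_joint_coupling[OF prob_space_axioms, of "\<lambda>x. x" \<kappa>] assms(2)
    by (simp add: distr_id2 cong: measurable_cong_sets)
qed

lemma quantized_plan_exists: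
  fixes T :: "'a::{second_countable_topology, metric_space} \<Rightarrow> 'a"
  assumes \<mu>: "borel_distribution \<mu>" and \<nu>: "borel_distribution \<nu>" and T: "T \<in> borel \<rightarrow>\<^sub>M borel" "finite (range T)"
  obtains p where "\<And>a b. 0 \<le> p (a, b)"
    "\<And>a. a \<in> range T \<Longrightarrow> (\<Sum>b\<in>range T. p (a, b)) = measure \<mu> (T -` {a})"
    "\<And>b. b \<in> range T \<Longrightarrow> (\<Sum>a\<in>range T. p (a, b)) = measure \<nu> (T -` {b})"
    "(\<Sum>a\<in>range T. \<Sum>b\<in>range T. p (a, b) * trunc_dist a b)
      \<le> kantorovich_dist \<mu> \<nu> + ((\<integral>x. trunc_dist x (T x) \<partial>\<mu>) + (\<integral>x. trunc_dist x (T x) \<partial>\<nu>))"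
proof -
  note cells = quantized_integral[OF T]
  interpret finite_transport "range T" "\<lambda>a. measure \<mu> (T -` {a})" "\<lambda>a. measure \<nu> (T -` {a})" trunc_dist
    using T cells(2)[OF \<mu>, of "\<lambda>_. 1"] cells(2)[OF \<nu>, of "\<lambda>_. 1"] trunc_dist_triangle
      borel_distribution.prob_UNIV[OF \<mu>] borel_distribution.prob_UNIV[OF \<nu>] borel_distribution.space_eq_UNIV[OF \<mu>]
      borel_distribution.space_eq_UNIV[OF \<nu>]
    by unfold_locales auto
  have dual: "(\<Sum>a\<in>range T. f a * (measure \<mu> (T -` {a}) - measure \<nu> (T -` {a})))
      \<le> kantorovich_dist \<mu> \<nu> + ((\<integral>x. trunc_dist x (T x) \<partial>\<mu>) + (\<integral>x. trunc_dist x (T x) \<partial>\<nu>))"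
    if "\<And>x y. f x - f y \<le> trunc_dist x y" for f
  proof -
    have f: "trunc_Lipschitz f" using that by (simp add: trunc_Lipschitz_def)
    have "(\<Sum>a\<in>range T. f a * (measure \<mu> (T -` {a}) - measure \<nu> (T -` {a}))) = (\<integral>x. f (T x) \<partial>\<mu>) - (\<integral>x. f (T x) \<partial>\<nu>)"
      by (simp add: cells(2)[OF \<mu>] cells(2)[OF \<nu>] right_diff_distrib sum_subtractf)
    then show ?thesis
      using integral_diff_le_kantorovich_dist[OF \<mu> \<nu> f]
        quantized_trunc_Lipschitz_integral[OF T f \<mu>] quantized_trunc_Lipschitz_integral[OF T f \<nu>] by linarith
  qed
  show ?thesis by (rule finite_transport_duality[OF dual]) (rule that | blast)+
qed

lemma transport_kernel:
  fixes \<mu> \<nu> :: "'a::{second_countable_topology, metric_space} measure"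
  assumes \<mu>: "borel_distribution \<mu>" and \<nu>: "borel_distribution \<nu>" and "\<epsilon> > 0"
  obtains \<kappa> where "\<kappa> \<in> borel \<rightarrow>\<^sub>M prob_algebra borel" "\<mu> \<bind> \<kappa> = \<nu>"
    "(\<integral>\<^sup>+z. ennreal (trunc_dist (fst z) (snd z)) \<partial>kernel_joint \<mu> (\<lambda>x. x) \<kappa>) \<le> ennreal (kantorovich_dist \<mu> \<nu> + \<epsilon>)"
proof -
  obtain T :: "'a \<Rightarrow> 'a" where T [measurable]: "T \<in> borel \<rightarrow>\<^sub>M borel" and fin: "finite (range T)"
    and quant: "(\<integral>x. trunc_dist x (T x) \<partial>\<mu>) \<le> \<epsilon> / 4" "(\<integral>x. trunc_dist x (T x) \<partial>\<nu>) \<le> \<epsilon> / 4"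
    using finite_range_quantizer[OF \<mu> \<nu>, of "\<epsilon> / 4"] \<open>\<epsilon> > 0\<close> by auto
  obtain p where p: "\<And>a b. 0 \<le> p (a, b)"
    "\<And>a. a \<in> range T \<Longrightarrow> (\<Sum>b\<in>range T. p (a, b)) = measure \<mu> (T -` {a})"
    "\<And>b. b \<in> range T \<Longrightarrow> (\<Sum>a\<in>range T. p (a, b)) = measure \<nu> (T -` {b})"
    and p_cost: "(\<Sum>a\<in>range T. \<Sum>b\<in>range T. p (a, b) * trunc_dist a b)
      \<le> kantorovich_dist \<mu> \<nu> + ((\<integral>x. trunc_dist x (T x) \<partial>\<mu>) + (\<integral>x. trunc_dist x (T x) \<partial>\<nu>))"
    using quantized_plan_exists[OF \<mu> \<nu> T fin] by blast
  obtain \<kappa> where \<kappa>: "\<kappa> \<in> borel \<rightarrow>\<^sub>M prob_algebra borel" "\<mu> \<bind> \<kappa> = \<nu>"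
    and cell: "\<And>a b. a \<in> range T \<Longrightarrow> b \<in> range T \<Longrightarrow>
      emeasure (kernel_joint \<mu> (\<lambda>x. x) \<kappa>) (T -` {a} \<times> T -` {b}) = ennreal (p (a, b))"
    using kernel_of_finite_plan[OF T fin \<mu> \<nu> p] by blast
  define c where "c = kernel_joint \<mu> (\<lambda>x. x) \<kappa>"
  have c: "c \<in> couplings \<mu> \<nu>"
    using kernel_joint_id_coupling[OF \<mu> \<kappa>(1)] by (simp add: c_def \<kappa>(2))
  interpret c: prob_space c by (rule couplingsD(1)[OF c])
  note [measurable_cong] = couplingsD(2)[OF c]
  have "(\<integral>z. trunc_dist (T (fst z)) (T (snd z)) \<partial>c) = (\<Sum>a\<in>range T. \<Sum>b\<in>range T. p (a, b) * trunc_dist a b)"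
    unfolding quantized_pair_integral[OF T fin c]
    using cell p(1) by (intro sum.cong refl) (simp add: measure_def c_def)
  also note p_cost
  finally have "(\<integral>z. trunc_dist (fst z) (snd z) \<partial>c) \<le> kantorovich_dist \<mu> \<nu> + \<epsilon>"
    using coupling_trunc_dist_le_quantized[OF T fin c] quant by linarith
  then have "(\<integral>\<^sup>+z. ennreal (trunc_dist (fst z) (snd z)) \<partial>c) \<le> ennreal (kantorovich_dist \<mu> \<nu> + \<epsilon>)"
    by (subst nn_integral_eq_integral) (auto intro!: c.integrable_const_bound[where B=1] ennreal_leI)
  then show ?thesis using that[OF \<kappa>] by (simp add: c_def)
qed

theorem wasserstein_le_kantorovich_dist:
  fixes \<mu> \<nu> :: "'a::{second_countable_topology, metric_space} measure"
  assumes \<mu>: "borel_distribution \<mu>" and \<nu>: "borel_distribution \<nu>"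
  shows "wasserstein (\<lambda>x y. min (dist x y) 1) \<mu> \<nu> \<le> ennreal (kantorovich_dist \<mu> \<nu>)"
proof (rule ennreal_le_epsilon)
  fix \<epsilon> :: real assume "0 < \<epsilon>"
  obtain \<kappa> where \<kappa>: "\<kappa> \<in> borel \<rightarrow>\<^sub>M prob_algebra borel" "\<mu> \<bind> \<kappa> = \<nu>"
    and cost: "(\<integral>\<^sup>+z. ennreal (trunc_dist (fst z) (snd z)) \<partial>kernel_joint \<mu> (\<lambda>x. x) \<kappa>)
        \<le> ennreal (kantorovich_dist \<mu> \<nu> + \<epsilon>)"
    using transport_kernel[OF \<mu> \<nu> \<open>0 < \<epsilon>\<close>] by blast
  have "wasserstein (\<lambda>x y. min (dist x y) 1) \<mu> \<nu>
      \<le> (\<integral>\<^sup>+z. ennreal (trunc_dist (fst z) (snd z)) \<partial>kernel_joint \<mu> (\<lambda>x. x) \<kappa>)"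
    unfolding wasserstein_def trunc_dist_def[symmetric]
    using kernel_joint_id_coupling[OF \<mu> \<kappa>(1)] by (intro INF_lower) (simp add: \<kappa>(2))
  also note cost
  finally show "wasserstein (\<lambda>x y. min (dist x y) 1) \<mu> \<nu> \<le> ennreal (kantorovich_dist \<mu> \<nu>) + ennreal \<epsilon>"
    using kantorovich_dist_nonneg[OF \<mu> \<nu>] \<open>0 < \<epsilon>\<close> by simp
qed

section \<open>Completeness of the Kantorovich distance\<close>

context Ionescu_Tulcea
begin

lemma distr_lim_initial:
  "distr PF.lim (PiM {0..<n} M) (\<lambda>\<omega>. restrict \<omega> {0..<n}) = C 0 n (\<lambda>_. undefined)"
proof (rule measure_eqI)
  show "sets (distr PF.lim (PiM {0..<n} M) (\<lambda>\<omega>. restrict \<omega> {0..<n})) = sets (C 0 n (\<lambda>_. undefined))"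
    by (simp add: sets_C space_PiM)
  fix X assume "X \<in> sets (distr PF.lim (PiM {0..<n} M) (\<lambda>\<omega>. restrict \<omega> {0..<n}))"
  then have X: "X \<in> sets (PiM {0..<n} M)" by simp
  have "prod_emb {0..<n} M {0..<n} X = X"
    using sets.sets_into_space[OF X] by (intro prod_emb_id) (simp add: space_PiM)
  then show "emeasure (distr PF.lim (PiM {0..<n} M) (\<lambda>\<omega>. restrict \<omega> {0..<n})) X = emeasure (C 0 n (\<lambda>_. undefined)) X"
    using emeasure_CI[of "{0..<n}" n X] X by (simp add: distr_lim)
qed

lemma nn_integral_lim_initial:
  assumes "F \<in> borel_measurable (PiM {0..<n} M)"
  shows "(\<integral>\<^sup>+\<omega>. F (restrict \<omega> {0..<n}) \<partial>PF.lim) = (\<integral>\<^sup>+\<omega>. F \<omega> \<partial>C 0 n (\<lambda>_. undefined))"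
proof -
  have "(\<lambda>\<omega>. restrict \<omega> {0..<n}) \<in> PF.lim \<rightarrow>\<^sub>M PiM {0..<n} M"
    using measurable_restrict_subset[of "{0..<n}" UNIV M] by (simp cong: measurable_cong_sets)
  then show ?thesis
    unfolding distr_lim_initial[symmetric] using assms by (subst nn_integral_distr) auto
qed

lemma prob_space_lim: "prob_space PF.lim"
proof
  show "emeasure PF.lim (space PF.lim) = 1"
    using nn_integral_lim_initial[of "\<lambda>_. 1" 0] prob_space.emeasure_space_1[OF prob_space_C[of "\<lambda>_. undefined" 0 0]]
    by (simp add: space_PiM)
qed

lemma nn_integral_lim_Suc:
  assumes F: "F \<in> borel_measurable (PiM {0..<Suc n} M)"
  shows "(\<integral>\<^sup>+\<omega>. F (restrict \<omega> {0..<Suc n}) \<partial>PF.lim)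
    = (\<integral>\<^sup>+\<omega>. \<integral>\<^sup>+y. F ((restrict \<omega> {0..<n})(n := y)) \<partial>P n (restrict \<omega> {0..<n}) \<partial>PF.lim)"
proof -
  have undef: "(\<lambda>_. undefined) \<in> space (PiM {0..<0} M)" by (simp add: space_PiM)
  have eP: "eP n \<in> C 0 n (\<lambda>_. undefined) \<rightarrow>\<^sub>M subprob_algebra (PiM {0..<Suc n} M)"
    using measurable_eP[of n] sets_C[OF undef, of n] by (simp cong: measurable_cong_sets)
  have "(\<integral>\<^sup>+\<omega>. F (restrict \<omega> {0..<Suc n}) \<partial>PF.lim) = (\<integral>\<^sup>+\<omega>. \<integral>\<^sup>+\<omega>'. F \<omega>' \<partial>eP n \<omega> \<partial>C 0 n (\<lambda>_. undefined))"
    unfolding nn_integral_lim_initial[OF F] C.simps using nn_integral_bind[OF F eP] by simp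
  also have "\<dots> = (\<integral>\<^sup>+\<omega>. \<integral>\<^sup>+\<omega>'. F \<omega>' \<partial>eP n (restrict \<omega> {0..<n}) \<partial>PF.lim)"
    by (rule nn_integral_lim_initial[symmetric])
       (rule measurable_compose[OF measurable_eP nn_integral_measurable_subprob_algebra[OF F]])
  also have "\<dots> = (\<integral>\<^sup>+\<omega>. \<integral>\<^sup>+y. F ((restrict \<omega> {0..<n})(n := y)) \<partial>P n (restrict \<omega> {0..<n}) \<partial>PF.lim)"
  proof (rule nn_integral_cong)
    fix \<omega> assume "\<omega> \<in> space PF.lim"
    then have "restrict \<omega> {0..<n} \<in> space (PiM {0..<n} M)"
      using sets_eq_imp_space_eq[OF PF.sets_lim] by (auto simp: space_PiM PiE_iff)
    then show "(\<integral>\<^sup>+\<omega>'. F \<omega>' \<partial>eP n (restrict \<omega> {0..<n}))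
        = (\<integral>\<^sup>+y. F ((restrict \<omega> {0..<n})(n := y)) \<partial>P n (restrict \<omega> {0..<n}))"
      by (rule nn_integral_eP[OF _ F])
  qed
  finally show ?thesis .
qed

end

definition kernel_sequence ::
    "'a::topological_space measure \<Rightarrow> (nat \<Rightarrow> 'a \<Rightarrow> 'a measure) \<Rightarrow> nat \<Rightarrow> (nat \<Rightarrow> 'a) \<Rightarrow> 'a measure"
  where
  "kernel_sequence \<mu> \<kappa> i \<omega> = (case i of 0 \<Rightarrow> \<mu> | Suc j \<Rightarrow> \<kappa> j (\<omega> j))"

lemma Ionescu_Tulcea_kernel_sequence:
  assumes \<mu>: "borel_distribution \<mu>" and \<kappa>: "\<And>k. \<kappa> k \<in> borel \<rightarrow>\<^sub>M prob_algebra borel"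
  shows "Ionescu_Tulcea (kernel_sequence \<mu> \<kappa>) (\<lambda>_. borel)"
proof (rule Ionescu_Tulcea.intro)
  fix i
  show "kernel_sequence \<mu> \<kappa> i \<in> PiM {0..<i} (\<lambda>_. borel) \<rightarrow>\<^sub>M subprob_algebra borel"
  proof (cases i)
    case 0
    have "\<mu> \<in> space (prob_algebra borel)" using \<mu> by (simp add: in_prob_algebra_borel_iff)
    then have "(\<lambda>_. \<mu>) \<in> PiM {0..<i} (\<lambda>_. borel :: 'a measure) \<rightarrow>\<^sub>M prob_algebra borel" by simp
    then show ?thesis
      using measurable_prob_algebraD by (simp add: kernel_sequence_def[abs_def] 0)
  next
    case (Suc j)
    have "(\<lambda>\<omega>. \<kappa> j (\<omega> j)) \<in> PiM {0..<i} (\<lambda>_. borel) \<rightarrow>\<^sub>M subprob_algebra borel"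
      by (rule measurable_compose[OF _ measurable_prob_algebraD[OF \<kappa>]]) (simp add: Suc)
    then show ?thesis by (simp add: kernel_sequence_def[abs_def] Suc)
  qed
next
  fix i and \<omega> :: "nat \<Rightarrow> 'a"
  show "prob_space (kernel_sequence \<mu> \<kappa> i \<omega>)"
    using \<mu> borel_distribution_kernel[OF \<kappa>]
    by (auto simp: kernel_sequence_def borel_distribution_def split: nat.split)
qed

lemma chain_marginals:
  fixes \<mu> :: "nat \<Rightarrow> 'a::topological_space measure" and X :: "nat \<Rightarrow> 'w \<Rightarrow> 'a"
  assumes \<mu>: "\<And>k. borel_distribution (\<mu> k)" and \<kappa>: "\<And>k. \<kappa> k \<in> borel \<rightarrow>\<^sub>M prob_algebra borel"
    and step: "\<And>k. \<mu> k \<bind> \<kappa> k = \<mu> (Suc k)"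
    and initial: "\<And>f. f \<in> borel_measurable borel \<Longrightarrow> (\<integral>\<^sup>+\<omega>. f (X 0 \<omega>) \<partial>\<Omega>) = (\<integral>\<^sup>+x. f x \<partial>\<mu> 0)"
    and transition: "\<And>k f. f \<in> borel_measurable borel \<Longrightarrow>
      (\<integral>\<^sup>+\<omega>. f (X (Suc k) \<omega>) \<partial>\<Omega>) = (\<integral>\<^sup>+\<omega>. \<integral>\<^sup>+y. f y \<partial>\<kappa> k (X k \<omega>) \<partial>\<Omega>)"
    and f: "f \<in> borel_measurable borel"
  shows "(\<integral>\<^sup>+\<omega>. f (X k \<omega>) \<partial>\<Omega>) = (\<integral>\<^sup>+x. f x \<partial>\<mu> k)"
  using f
proof (induction k arbitrary: f)
  case 0
  then show ?case by (rule initial)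
next
  case (Suc k)
  interpret borel_distribution "\<mu> k" by (rule \<mu>)
  have \<kappa>\<mu>: "\<kappa> k \<in> \<mu> k \<rightarrow>\<^sub>M prob_algebra borel" using \<kappa> by (simp cong: measurable_cong_sets)
  have "(\<integral>\<^sup>+\<omega>. f (X (Suc k) \<omega>) \<partial>\<Omega>) = (\<integral>\<^sup>+x. \<integral>\<^sup>+y. f y \<partial>\<kappa> k x \<partial>\<mu> k)"
    unfolding transition[OF Suc.prems]
    by (rule Suc.IH)
      (rule measurable_compose[OF measurable_prob_algebraD[OF \<kappa>] nn_integral_measurable_subprob_algebra[OF Suc.prems]])
  also have "\<dots> = (\<integral>\<^sup>+y. f y \<partial>\<mu> (Suc k))"
    unfolding step[symmetric] by (rule nn_integral_bind_kernel[OF prob_space_axioms \<kappa>\<mu> Suc.prems, symmetric])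
  finally show ?case .
qed

lemma glue_kernels:
  fixes \<mu> :: "nat \<Rightarrow> 'a::topological_space measure"
  assumes \<mu>: "\<And>k. borel_distribution (\<mu> k)" and \<kappa>: "\<And>k. \<kappa> k \<in> borel \<rightarrow>\<^sub>M prob_algebra borel"
    and step: "\<And>k. \<mu> k \<bind> \<kappa> k = \<mu> (Suc k)"
  obtains \<Omega> :: "(nat \<Rightarrow> 'a) measure" where "prob_space \<Omega>" "\<And>k. (\<lambda>\<omega>. \<omega> k) \<in> \<Omega> \<rightarrow>\<^sub>M borel"
    "\<And>k. distr \<Omega> borel (\<lambda>\<omega>. \<omega> k) = \<mu> k"
    "\<And>k F. F \<in> borel_measurable (borel \<Otimes>\<^sub>M borel) \<Longrightarrow>
      (\<integral>\<^sup>+\<omega>. F (\<omega> k, \<omega> (Suc k)) \<partial>\<Omega>) = (\<integral>\<^sup>+z. F z \<partial>kernel_joint (\<mu> k) (\<lambda>x. x) (\<kappa> k))"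
proof -
  interpret IT: Ionescu_Tulcea "kernel_sequence (\<mu> 0) \<kappa>" "\<lambda>_. borel"
    by (rule Ionescu_Tulcea_kernel_sequence[OF \<mu> \<kappa>])
  define \<Omega> where "\<Omega> = IT.PF.lim"
  have sets_\<Omega> [measurable_cong]: "sets \<Omega> = sets (PiM UNIV (\<lambda>_. borel))" by (simp add: \<Omega>_def)
  have coord [measurable]: "(\<lambda>\<omega>. \<omega> k) \<in> \<Omega> \<rightarrow>\<^sub>M borel" for k by measurable
  have initial: "(\<integral>\<^sup>+\<omega>. f (\<omega> 0) \<partial>\<Omega>) = (\<integral>\<^sup>+x. f x \<partial>\<mu> 0)" if [measurable]: "f \<in> borel_measurable borel" for f
    using IT.nn_integral_lim_Suc[of "\<lambda>\<omega>. f (\<omega> 0)" 0] prob_space.emeasure_space_1[OF IT.prob_space_lim]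
    by (simp add: \<Omega>_def kernel_sequence_def)
  have transition: "(\<integral>\<^sup>+\<omega>. F (\<omega> k, \<omega> (Suc k)) \<partial>\<Omega>) = (\<integral>\<^sup>+\<omega>. \<integral>\<^sup>+y. F (\<omega> k, y) \<partial>\<kappa> k (\<omega> k) \<partial>\<Omega>)"
    if [measurable]: "F \<in> borel_measurable (borel \<Otimes>\<^sub>M borel)" for F k
    using IT.nn_integral_lim_Suc[of "\<lambda>\<omega>. F (\<omega> k, \<omega> (Suc k))" "Suc k"] by (simp add: \<Omega>_def kernel_sequence_def)
  have marginal: "(\<integral>\<^sup>+\<omega>. f (\<omega> k) \<partial>\<Omega>) = (\<integral>\<^sup>+x. f x \<partial>\<mu> k)" if "f \<in> borel_measurable borel" for f k
    using transition[of "\<lambda>z. f (snd z)" for f]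
    by (intro chain_marginals[where X="\<lambda>k \<omega>. \<omega> k", OF \<mu> \<kappa> step initial _ that]) simp_all
  show ?thesis
  proof (rule that[OF _ coord])
    show "prob_space \<Omega>" unfolding \<Omega>_def by (rule IT.prob_space_lim)
    show "distr \<Omega> borel (\<lambda>\<omega>. \<omega> k) = \<mu> k" for k
    proof (rule measure_eqI)
      interpret borel_distribution "\<mu> k" by (rule \<mu>)
      show "sets (distr \<Omega> borel (\<lambda>\<omega>. \<omega> k)) = sets (\<mu> k)" by simp
      fix A assume "A \<in> sets (distr \<Omega> borel (\<lambda>\<omega>. \<omega> k))"
      then have [measurable]: "A \<in> sets borel" by simp
      show "emeasure (distr \<Omega> borel (\<lambda>\<omega>. \<omega> k)) A = emeasure (\<mu> k) A"
        using marginal[of "indicator A" k] nn_integral_distr[OF coord, of "indicator A" k] by simp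
    qed
    show "(\<integral>\<^sup>+\<omega>. F (\<omega> k, \<omega> (Suc k)) \<partial>\<Omega>) = (\<integral>\<^sup>+z. F z \<partial>kernel_joint (\<mu> k) (\<lambda>x. x) (\<kappa> k))"
      if F: "F \<in> borel_measurable (borel \<Otimes>\<^sub>M borel)" for F k
    proof -
      interpret borel_distribution "\<mu> k" by (rule \<mu>)
      have \<kappa>\<mu>: "\<kappa> k \<in> \<mu> k \<rightarrow>\<^sub>M prob_algebra borel" using \<kappa> by (simp cong: measurable_cong_sets)
      have "(\<integral>\<^sup>+\<omega>. \<integral>\<^sup>+y. F (\<omega> k, y) \<partial>\<kappa> k (\<omega> k) \<partial>\<Omega>) = (\<integral>\<^sup>+x. \<integral>\<^sup>+y. F (x, y) \<partial>\<kappa> k x \<partial>\<mu> k)"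
        by (rule marginal)
           (rule nn_integral_measurable_subprob_algebra2[OF _ measurable_prob_algebraD[OF \<kappa>]], use F in simp)
      also have "\<dots> = (\<integral>\<^sup>+z. F z \<partial>kernel_joint (\<mu> k) (\<lambda>x. x) (\<kappa> k))"
        by (rule nn_integral_kernel_joint[OF prob_space_axioms _ \<kappa>\<mu> F, symmetric]) (simp add: measurable_ident_sets)
      finally show ?thesis using transition[OF F] by simp
    qed
  qed
qed

lemma summable_trunc_dist_imp_Cauchy:
  assumes "summable (\<lambda>i. trunc_dist (z i) (z (Suc i)))"
  shows "Cauchy z"
proof (rule metric_CauchyI)
  have chain: "trunc_dist (z m) (z (m + n)) \<le> (\<Sum>i\<in>{m..<m+n}. trunc_dist (z i) (z (Suc i)))" for m n
  proof (induction n)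
    case (Suc n)
    then show ?case using trunc_dist_triangle[of "z m" "z (m + Suc n)" "z (m + n)"] by simp
  qed simp
  fix e :: real assume "e > 0"
  then have "min e 1 > 0" by simp
  then obtain N where N: "\<And>m n. m \<ge> N \<Longrightarrow> norm (\<Sum>i\<in>{m..<n}. trunc_dist (z i) (z (Suc i))) < min e 1"
    using assms unfolding summable_Cauchy by blast
  have "dist (z m) (z (m + n)) < e" if "m \<ge> N" for m n
    using chain[of m n] N[OF that, of "m + n"] by (auto simp: trunc_dist_def)
  then have "dist (z m) (z n) < e" if "m \<ge> N" "n \<ge> N" for m n
    using that by (metis dist_commute le_add_diff_inverse linear)
  then show "\<exists>N. \<forall>m\<ge>N. \<forall>n\<ge>N. dist (z m) (z n) < e" by blast
qed

lemma summable_trunc_dist_imp_AE_Cauchy: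
  fixes X :: "nat \<Rightarrow> 'w \<Rightarrow> 'a::{second_countable_topology, metric_space}"
  assumes X [measurable]: "\<And>k. X k \<in> M \<rightarrow>\<^sub>M borel"
    and a: "\<And>k. 0 \<le> a k" "summable a"
    and cost: "\<And>k. (\<integral>\<^sup>+\<omega>. ennreal (trunc_dist (X k \<omega>) (X (Suc k) \<omega>)) \<partial>M) \<le> ennreal (a k)"
  shows "AE \<omega> in M. Cauchy (\<lambda>k. X k \<omega>)"
proof -
  have "(\<integral>\<^sup>+\<omega>. (\<Sum>k. ennreal (trunc_dist (X k \<omega>) (X (Suc k) \<omega>))) \<partial>M)
      = (\<Sum>k. \<integral>\<^sup>+\<omega>. ennreal (trunc_dist (X k \<omega>) (X (Suc k) \<omega>)) \<partial>M)"
    by (rule nn_integral_suminf) measurable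
  also have "\<dots> \<le> (\<Sum>k. ennreal (a k))"
    by (intro suminf_le cost) auto
  also have "\<dots> < \<infinity>"
    using ennreal_suminf_neq_top[OF a(2,1)] by (simp add: less_top)
  finally have "(\<integral>\<^sup>+\<omega>. (\<Sum>k. ennreal (trunc_dist (X k \<omega>) (X (Suc k) \<omega>))) \<partial>M) \<noteq> \<infinity>" by simp
  then have "AE \<omega> in M. (\<Sum>k. ennreal (trunc_dist (X k \<omega>) (X (Suc k) \<omega>))) \<noteq> \<infinity>"
    by (intro nn_integral_PInf_AE) measurable
  then show ?thesis
    by eventually_elim (auto intro!: summable_trunc_dist_imp_Cauchy summable_suminf_not_top)
qed

lemma AE_Cauchy_imp_AE_tendsto:
  fixes X :: "nat \<Rightarrow> 'w \<Rightarrow> 'a::polish_space"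
  assumes X [measurable]: "\<And>k. X k \<in> M \<rightarrow>\<^sub>M borel" and "AE \<omega> in M. Cauchy (\<lambda>k. X k \<omega>)"
  obtains Z where "Z \<in> M \<rightarrow>\<^sub>M borel" "AE \<omega> in M. (\<lambda>k. X k \<omega>) \<longlonglongrightarrow> Z \<omega>"
proof -
  define Y where "Y k \<omega> = (if Cauchy (\<lambda>k. X k \<omega>) then X k \<omega> else undefined)" for k \<omega>
  define Z where "Z \<omega> = lim (\<lambda>k. Y k \<omega>)" for \<omega>
  have Cauchy_Y: "Cauchy (\<lambda>k. Y k \<omega>)" for \<omega>
    by (cases "Cauchy (\<lambda>k. X k \<omega>)") (auto simp: Y_def intro: LIMSEQ_imp_Cauchy[OF tendsto_const])
  have lim: "(\<lambda>k. Y k \<omega>) \<longlonglongrightarrow> Z \<omega>" for \<omega>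
    unfolding Z_def using Cauchy_convergent[OF Cauchy_Y[of \<omega>]] by (simp add: convergent_LIMSEQ_iff)
  have "(\<lambda>\<omega>. Y k \<omega>) \<in> M \<rightarrow>\<^sub>M borel" for k
    unfolding Y_def by measurable
  then have "Z \<in> M \<rightarrow>\<^sub>M borel"
    by (rule borel_measurable_LIMSEQ_metric) (rule lim)
  moreover have "AE \<omega> in M. (\<lambda>k. X k \<omega>) \<longlonglongrightarrow> Z \<omega>"
    using assms(2)
  proof eventually_elim
    case (elim \<omega>)
    then show ?case using lim[of \<omega>] by (simp add: Y_def)
  qed
  ultimately show ?thesis by (rule that)
qed

definition weakly_converges :: "(nat \<Rightarrow> 'a::topological_space measure) \<Rightarrow> 'a measure \<Rightarrow> bool" where
  "weakly_converges \<mu> \<pi> \<longleftrightarrow> (\<forall>g::'a \<Rightarrow> real. continuous_on UNIV g \<longrightarrow> bounded (range g) \<longrightarrow>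
     (\<lambda>k. \<integral>x. g x \<partial>\<mu> k) \<longlonglongrightarrow> (\<integral>x. g x \<partial>\<pi>))"

lemma AE_tendsto_imp_weakly_converges:
  fixes X :: "nat \<Rightarrow> 'w \<Rightarrow> 'a::topological_space"
  assumes "prob_space M" and X [measurable]: "\<And>k. X k \<in> M \<rightarrow>\<^sub>M borel" and Z [measurable]: "Z \<in> M \<rightarrow>\<^sub>M borel"
    and lim: "AE \<omega> in M. (\<lambda>k. X k \<omega>) \<longlonglongrightarrow> Z \<omega>"
  shows "weakly_converges (\<lambda>k. distr M borel (X k)) (distr M borel Z)"
  unfolding weakly_converges_def
proof (intro allI impI)
  interpret prob_space M by fact
  fix g :: "'a \<Rightarrow> real" assume g: "continuous_on UNIV g" "bounded (range g)"
  have [measurable]: "g \<in> borel_measurable borel" using g(1) by (rule borel_measurable_continuous_onI)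
  obtain B where B: "\<And>x. \<bar>g x\<bar> \<le> B" using g(2) by (auto simp: bounded_iff)
  have "(\<lambda>k. \<integral>\<omega>. g (X k \<omega>) \<partial>M) \<longlonglongrightarrow> (\<integral>\<omega>. g (Z \<omega>) \<partial>M)"
  proof (rule integral_dominated_convergence[where w="\<lambda>_. B"])
    show "AE \<omega> in M. (\<lambda>k. g (X k \<omega>)) \<longlonglongrightarrow> g (Z \<omega>)"
      using lim by eventually_elim (rule continuous_on_tendsto_compose[OF g(1)], auto)
  qed (auto simp: B)
  then show "(\<lambda>k. \<integral>x. g x \<partial>distr M borel (X k)) \<longlonglongrightarrow> (\<integral>x. g x \<partial>distr M borel Z)"
    by (simp add: integral_distr)
qed

lemma kantorovich_summable_imp_weakly_converges:
  fixes \<mu> :: "nat \<Rightarrow> 'a::polish_space measure"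
  assumes \<mu>: "\<And>k. borel_distribution (\<mu> k)" and summable: "summable (\<lambda>k. kantorovich_dist (\<mu> k) (\<mu> (Suc k)))"
  obtains \<pi> where "borel_distribution \<pi>" "weakly_converges \<mu> \<pi>"
proof -
  define a where "a k = kantorovich_dist (\<mu> k) (\<mu> (Suc k)) + (1/2) ^ k" for k
  have a: "0 \<le> a k" "summable a" for k
    unfolding a_def using kantorovich_dist_nonneg[OF \<mu> \<mu>] summable
    by (auto intro!: summable_add summable_geometric)
  have "\<exists>\<kappa>. \<kappa> \<in> borel \<rightarrow>\<^sub>M prob_algebra borel \<and> \<mu> k \<bind> \<kappa> = \<mu> (Suc k) \<and>
    (\<integral>\<^sup>+z. ennreal (trunc_dist (fst z) (snd z)) \<partial>kernel_joint (\<mu> k) (\<lambda>x. x) \<kappa>) \<le> ennreal (a k)" for k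
    unfolding a_def by (rule transport_kernel[OF \<mu>[of k] \<mu>[of "Suc k"], of "(1/2) ^ k"]) auto
  from choice[OF allI[OF this]] obtain \<kappa>
    where kernels: "\<forall>k. \<kappa> k \<in> borel \<rightarrow>\<^sub>M prob_algebra borel \<and> \<mu> k \<bind> \<kappa> k = \<mu> (Suc k) \<and>
      (\<integral>\<^sup>+z. ennreal (trunc_dist (fst z) (snd z)) \<partial>kernel_joint (\<mu> k) (\<lambda>x. x) (\<kappa> k)) \<le> ennreal (a k)" ..
  then have \<kappa>: "\<And>k. \<kappa> k \<in> borel \<rightarrow>\<^sub>M prob_algebra borel" "\<And>k. \<mu> k \<bind> \<kappa> k = \<mu> (Suc k)" by blast+
  obtain \<Omega> :: "(nat \<Rightarrow> 'a) measure" where \<Omega>: "prob_space \<Omega>" and coord: "\<And>k. (\<lambda>\<omega>. \<omega> k) \<in> \<Omega> \<rightarrow>\<^sub>M borel"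
    and law: "\<And>k. distr \<Omega> borel (\<lambda>\<omega>. \<omega> k) = \<mu> k"
    and joint: "\<And>k F. F \<in> borel_measurable (borel \<Otimes>\<^sub>M borel) \<Longrightarrow>
      (\<integral>\<^sup>+\<omega>. F (\<omega> k, \<omega> (Suc k)) \<partial>\<Omega>) = (\<integral>\<^sup>+z. F z \<partial>kernel_joint (\<mu> k) (\<lambda>x. x) (\<kappa> k))"
    using glue_kernels[of \<mu> \<kappa>, OF \<mu> \<kappa>] by blast
  have "(\<integral>\<^sup>+\<omega>. ennreal (trunc_dist (\<omega> k) (\<omega> (Suc k))) \<partial>\<Omega>) \<le> ennreal (a k)" for k
    using joint[of "\<lambda>z. ennreal (trunc_dist (fst z) (snd z))" k] kernels by simp
  then have "AE \<omega> in \<Omega>. Cauchy (\<lambda>k. \<omega> k)"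
    using a by (intro summable_trunc_dist_imp_AE_Cauchy[OF coord])
  then obtain Z where Z: "Z \<in> \<Omega> \<rightarrow>\<^sub>M borel" "AE \<omega> in \<Omega>. (\<lambda>k. \<omega> k) \<longlonglongrightarrow> Z \<omega>"
    by (rule AE_Cauchy_imp_AE_tendsto[OF coord])
  show ?thesis
  proof (rule that)
    show "borel_distribution (distr \<Omega> borel Z)" by (rule borel_distribution_distr[OF \<Omega> Z(1)])
    show "weakly_converges \<mu> (distr \<Omega> borel Z)"
      using AE_tendsto_imp_weakly_converges[OF \<Omega> coord Z] by (simp add: law)
  qed
qed

lemma kantorovich_Cauchy_imp_weakly_convergent_subseq:
  fixes \<mu> :: "nat \<Rightarrow> 'a::polish_space measure"
  assumes \<mu>: "\<And>k. borel_distribution (\<mu> k)"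
    and Cauchy: "\<And>\<epsilon>. \<epsilon> > 0 \<Longrightarrow> \<exists>N. \<forall>m\<ge>N. \<forall>n\<ge>N. kantorovich_dist (\<mu> m) (\<mu> n) \<le> \<epsilon>"
  obtains \<pi> r where "strict_mono r" "borel_distribution \<pi>" "weakly_converges (\<lambda>k. \<mu> (r k)) \<pi>"
proof -
  have "\<forall>k. \<exists>N. \<forall>m\<ge>N. \<forall>n\<ge>N. kantorovich_dist (\<mu> m) (\<mu> n) \<le> (1/2) ^ k"
    by (intro allI Cauchy) simp
  then obtain N where N: "\<And>k m n. N k \<le> m \<Longrightarrow> N k \<le> n \<Longrightarrow> kantorovich_dist (\<mu> m) (\<mu> n) \<le> (1/2) ^ k"
    by metis
  define r where "r k = (\<Sum>i\<le>k. N i) + k" for k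
  have r: "strict_mono r" by (simp add: strict_mono_Suc_iff r_def)
  have "N k \<le> r k" "N k \<le> r (Suc k)" for k
    using member_le_sum[of k "{..k}" N] by (auto simp: r_def)
  then have "kantorovich_dist (\<mu> (r k)) (\<mu> (r (Suc k))) \<le> (1/2) ^ k" for k by (intro N)
  then have "summable (\<lambda>k. kantorovich_dist (\<mu> (r k)) (\<mu> (r (Suc k))))"
    using kantorovich_dist_nonneg[OF \<mu> \<mu>] by (intro summable_comparison_test'[OF summable_geometric[of "1/2"]]) auto
  then show ?thesis
    using kantorovich_summable_imp_weakly_converges[of "\<lambda>k. \<mu> (r k)"] \<mu> that[OF r] by blast
qed

theorem kantorovich_dist_complete:
  fixes \<mu> :: "nat \<Rightarrow> 'a::polish_space measure"
  assumes \<mu>: "\<And>k. borel_distribution (\<mu> k)"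
    and Cauchy: "\<And>\<epsilon>. \<epsilon> > 0 \<Longrightarrow> \<exists>N. \<forall>m\<ge>N. \<forall>n\<ge>N. kantorovich_dist (\<mu> m) (\<mu> n) \<le> \<epsilon>"
  obtains \<pi> r where "strict_mono r" "borel_distribution \<pi>" "weakly_converges (\<lambda>k. \<mu> (r k)) \<pi>"
    "(\<lambda>k. kantorovich_dist (\<mu> k) \<pi>) \<longlonglongrightarrow> 0"
proof -
  obtain \<pi> r where r: "strict_mono r" and \<pi>: "borel_distribution \<pi>" and weak: "weakly_converges (\<lambda>k. \<mu> (r k)) \<pi>"
    by (rule kantorovich_Cauchy_imp_weakly_convergent_subseq[OF \<mu> Cauchy])
  have dist_le: "kantorovich_dist (\<mu> n) \<pi> \<le> \<epsilon>" if N: "\<forall>m\<ge>N. \<forall>n\<ge>N. kantorovich_dist (\<mu> m) (\<mu> n) \<le> \<epsilon>"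
    and n: "N \<le> n" for N n \<epsilon>
  proof (rule kantorovich_dist_leI)
    fix f :: "'a \<Rightarrow> real" assume f: "trunc_Lipschitz f"
    have lim: "(\<lambda>k. (\<integral>x. f x \<partial>\<mu> n) - (\<integral>x. f x \<partial>\<mu> (r k))) \<longlonglongrightarrow> (\<integral>x. f x \<partial>\<mu> n) - (\<integral>x. f x \<partial>\<pi>)"
      using weak trunc_Lipschitz_continuous[OF f] trunc_Lipschitz_bounded[OF f]
      by (intro tendsto_diff tendsto_const) (simp add: weakly_converges_def)
    have "(\<integral>x. f x \<partial>\<mu> n) - (\<integral>x. f x \<partial>\<mu> (r k)) \<le> \<epsilon>" if "N \<le> k" for k
      using integral_diff_le_kantorovich_dist[OF \<mu> \<mu> f, of n "r k"] N n that seq_suble[OF r, of k]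
      by (meson order_trans)
    then show "(\<integral>x. f x \<partial>\<mu> n) - (\<integral>x. f x \<partial>\<pi>) \<le> \<epsilon>" by (intro LIMSEQ_le_const2[OF lim]) blast
  qed
  have "(\<lambda>k. kantorovich_dist (\<mu> k) \<pi>) \<longlonglongrightarrow> 0"
  proof (rule LIMSEQ_I)
    fix e :: real assume "0 < e"
    then obtain N where "\<forall>m\<ge>N. \<forall>n\<ge>N. kantorovich_dist (\<mu> m) (\<mu> n) \<le> e / 2" using Cauchy[of "e / 2"] by auto
    then have "kantorovich_dist (\<mu> n) \<pi> \<le> e / 2" if "N \<le> n" for n by (rule dist_le[OF _ that])
    then show "\<exists>N. \<forall>n\<ge>N. norm (kantorovich_dist (\<mu> n) \<pi> - 0) < e"
      using \<open>0 < e\<close> kantorovich_dist_nonneg[OF \<mu> \<pi>] by (intro exI[of _ N]) force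
  qed
  then show ?thesis by (rule that[OF r \<pi> weak])
qed

section \<open>Concave rate functions\<close>

lemma antimono_deriv_imp_below_tangent:
  fixes f f' :: "real \<Rightarrow> real"
  assumes "continuous_on {a..b} f" and deriv: "\<And>x. a < x \<Longrightarrow> x < b \<Longrightarrow> (f has_real_derivative f' x) (at x)"
    and antimono: "\<And>x y. a \<le> x \<Longrightarrow> x \<le> y \<Longrightarrow> y \<le> b \<Longrightarrow> f' y \<le> f' x"
    and "u \<in> {a..b}" "z \<in> {a..b}"
  shows "f z \<le> f u + f' u * (z - u)"
proof -
  have gap_deriv: "((\<lambda>x. f u + f' u * (x - u) - f x) has_real_derivative f' u - f' x) (at x)" if "a < x" "x < b" for x
    using deriv[OF that] by (auto intro!: derivative_eq_intros)
  have gap_cont: "continuous_on {c..d} (\<lambda>x. f u + f' u * (x - u) - f x)" if "a \<le> c" "d \<le> b" for c d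
    using that by (intro continuous_intros continuous_on_subset[OF assms(1)]) auto
  have "f u + f' u * (u - u) - f u \<le> f u + f' u * (z - u) - f z"
  proof (cases "u \<le> z")
    case True
    then show ?thesis
    proof (rule DERIV_nonneg_imp_increasing_open)
      fix x assume "u < x" "x < z"
      then show "\<exists>y. ((\<lambda>x. f u + f' u * (x - u) - f x) has_real_derivative y) (at x) \<and> 0 \<le> y"
        using assms(4,5) antimono[of u x] by (intro exI[of _ "f' u - f' x"] conjI gap_deriv) auto
    qed (use assms in \<open>auto intro!: gap_cont\<close>)
  next
    case False
    then have "z \<le> u" by simp
    then show ?thesis
    proof (rule DERIV_nonpos_imp_decreasing_open)
      fix x assume "z < x" "x < u"
      then show "\<exists>y. ((\<lambda>x. f u + f' u * (x - u) - f x) has_real_derivative y) (at x) \<and> y \<le> 0"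
        using assms(4,5) antimono[of x u] by (intro exI[of _ "f' u - f' x"] conjI gap_deriv) auto
    qed (use assms in \<open>auto intro!: gap_cont\<close>)
  qed
  then show ?thesis by simp
qed

locale concave_rate =
  fixes \<phi> :: "real \<Rightarrow> real"
  assumes concave: "concave_on {0..} \<phi>"
    and differentiable: "\<And>s. s > 0 \<Longrightarrow> \<phi> differentiable at s"
    and mono_on: "mono_on {0..} \<phi>"
    and at_top: "filterlim \<phi> at_top at_top"
    and zero: "\<phi> 0 = 0"
begin

lemma phi_mono: "0 \<le> x \<Longrightarrow> x \<le> y \<Longrightarrow> \<phi> x \<le> \<phi> y"
  using mono_onD[OF mono_on, of x y] by auto

lemma phi_nonneg: "0 \<le> x \<Longrightarrow> 0 \<le> \<phi> x"
  using phi_mono[of 0 x] by (simp add: zero)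

lemma phi_exceeds: "\<exists>z>x. \<phi> z > y"
proof -
  have "eventually (\<lambda>z. z > x \<and> \<phi> z > y) at_top"
    using at_top by (intro eventually_conj eventually_gt_at_top) (simp add: filterlim_at_top_dense)
  then show ?thesis by (auto dest: eventually_happens)
qed

lemma phi_star_shaped:
  assumes "0 \<le> x" "x \<le> y"
  shows "x * \<phi> y \<le> y * \<phi> x"
proof (cases "y = 0")
  case False
  with assms have "y > 0" by simp
  have "\<phi> ((1 - x / y) *\<^sub>R 0 + (x / y) *\<^sub>R y) \<ge> (1 - x / y) * \<phi> 0 + (x / y) * \<phi> y"
    using assms \<open>y > 0\<close> by (intro concave_onD[OF concave]) auto
  then have "x / y * \<phi> y \<le> \<phi> x" using \<open>y > 0\<close> by (simp add: zero)
  then show ?thesis using \<open>y > 0\<close> by (simp add: field_simps)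
qed (use assms in simp)

lemma phi_pos:
  assumes "x > 0"
  shows "\<phi> x > 0"
proof -
  obtain z where "z > x" "\<phi> z > 0" using phi_exceeds by blast
  then have "0 < x * \<phi> z" "x * \<phi> z \<le> z * \<phi> x" using assms by (auto intro: phi_star_shaped)
  then have "0 < z * \<phi> x" by linarith
  then show ?thesis using assms \<open>z > x\<close> by (simp add: zero_less_mult_iff)
qed

lemma phi_subadditive:
  assumes "0 \<le> a" "0 \<le> b"
  shows "\<phi> (a + b) \<le> \<phi> a + \<phi> b"
proof (cases "a + b = 0")
  case False
  then have "a + b > 0" using assms by simp
  have "a * \<phi> (a + b) \<le> (a + b) * \<phi> a" "b * \<phi> (a + b) \<le> (a + b) * \<phi> b"
    using assms by (auto intro: phi_star_shaped)
  then have "(a + b) * \<phi> (a + b) \<le> (a + b) * (\<phi> a + \<phi> b)" by (simp add: algebra_simps)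
  then show ?thesis using \<open>a + b > 0\<close> by simp
qed (use assms in \<open>auto simp: zero add_nonneg_eq_0_iff\<close>)

lemma phi_linear_growth:
  assumes "0 \<le> z"
  shows "\<phi> z \<le> \<phi> 1 * (1 + z)"
proof (cases "z \<le> 1")
  case True
  then have "\<phi> z \<le> \<phi> 1" "0 \<le> \<phi> 1 * z" using phi_mono[of z 1] phi_nonneg[of 1] assms by auto
  then show ?thesis by (simp add: distrib_left)
next
  case False
  then show ?thesis using phi_star_shaped[of 1 z] phi_nonneg[of 1] by (simp add: algebra_simps)
qed

lemma phi_has_deriv: "u > 0 \<Longrightarrow> (\<phi> has_real_derivative deriv \<phi> u) (at u)"
  using differentiable[of u] by (simp add: DERIV_deriv_iff_real_differentiable)

lemma phi_below_tangent:
  assumes "0 \<le> z" "0 < u"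
  shows "\<phi> z \<le> \<phi> u + deriv \<phi> u * (z - u)"
proof -
  have "- \<phi> z - - \<phi> u \<ge> - deriv \<phi> u * (z - u)"
  proof (rule convex_on_imp_above_tangent)
    show "convex_on {0..} (\<lambda>x. - \<phi> x)" using concave by (simp add: concave_on_def)
    show "((\<lambda>x. - \<phi> x) has_field_derivative - deriv \<phi> u) (at u within {0..})"
      by (rule has_field_derivative_at_within) (intro DERIV_minus phi_has_deriv assms)
  qed (use assms in auto)
  then show ?thesis by (simp add: algebra_simps)
qed

lemma deriv_phi_antimono:
  assumes "0 < u" "u \<le> v"
  shows "deriv \<phi> v \<le> deriv \<phi> u"
proof (cases "u = v")
  case False
  have "\<phi> v \<le> \<phi> u + deriv \<phi> u * (v - u)" "\<phi> u \<le> \<phi> v + deriv \<phi> v * (u - v)"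
    using assms by (auto intro: phi_below_tangent)
  then have "0 \<le> (deriv \<phi> u - deriv \<phi> v) * (v - u)" by (simp add: algebra_simps)
  then show ?thesis using assms False by (simp add: zero_le_mult_iff)
qed simp

lemma deriv_phi_pos:
  assumes "0 < u"
  shows "0 < deriv \<phi> u"
proof -
  obtain z where z: "z > u" "\<phi> z > \<phi> u" using phi_exceeds by blast
  then have "0 < deriv \<phi> u * (z - u)" using phi_below_tangent[of z u] assms by simp
  then show ?thesis using z by (simp add: zero_less_mult_iff)
qed

lemma continuous_on_phi: "0 < a \<Longrightarrow> continuous_on {a..b} \<phi>"
  by (rule DERIV_continuous_on, rule has_field_derivative_at_within, rule phi_has_deriv) auto

lemma phi_comp_measurable [measurable]:
  assumes "f \<in> borel_measurable M" "\<And>x. 0 \<le> f x"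
  shows "(\<lambda>x. \<phi> (f x)) \<in> borel_measurable M"
proof -
  define g where "g u = \<phi> (max 0 u)" for u
  have "mono g" unfolding g_def by (intro monoI phi_mono) auto
  then have "g \<in> borel_measurable borel" by (rule borel_measurable_mono)
  then have "(\<lambda>x. g (f x)) \<in> borel_measurable M" using assms(1) by measurable
  then show ?thesis using assms(2) by (simp add: g_def max_def)
qed

lemma phi_geometric_mean:
  assumes "0 < u" "u \<le> R" "0 \<le> q" "q \<le> 1"
  obtains s where "u \<le> s" "s \<le> R" "\<phi> u / \<phi> s = (\<phi> u / \<phi> R) powr q" "(1 - q) * ln (\<phi> s / \<phi> u) = q * ln (\<phi> R / \<phi> s)"
proof -
  define m where "m = ln (\<phi> u) + q * (ln (\<phi> R) - ln (\<phi> u))"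
  have pos: "0 < \<phi> u" "0 < \<phi> R" using assms by (auto intro: phi_pos)
  then have ln_le: "ln (\<phi> u) \<le> ln (\<phi> R)" using phi_mono[of u R] assms by simp
  have "ln (\<phi> u) \<le> m" "m \<le> ln (\<phi> R)"
    using ln_le assms mult_right_mono[of q 1 "ln (\<phi> R) - ln (\<phi> u)"] by (auto simp: m_def)
  then have "\<phi> u \<le> exp m" "exp m \<le> \<phi> R" using pos by (metis exp_le_cancel_iff exp_ln)+
  then obtain s where s: "u \<le> s" "s \<le> R" "\<phi> s = exp m"
    using IVT'[of \<phi> u "exp m" R] assms continuous_on_phi[of u R] by auto
  show ?thesis
  proof (rule that[OF s(1,2)])
    have "ln (\<phi> u / \<phi> s) = q * ln (\<phi> u / \<phi> R)" using pos by (simp add: ln_div s(3) m_def algebra_simps)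
    then have "exp (ln (\<phi> u / \<phi> s)) = exp (q * ln (\<phi> u / \<phi> R))" by simp
    then show "\<phi> u / \<phi> s = (\<phi> u / \<phi> R) powr q" using pos by (simp add: s(3) powr_def)
    show "(1 - q) * ln (\<phi> s / \<phi> u) = q * ln (\<phi> R / \<phi> s)" using pos by (simp add: ln_div s(3) m_def algebra_simps)
  qed
qed

abbreviation H :: "real \<Rightarrow> real" where "H \<equiv> H_phi \<phi>"

lemma continuous_on_inverse_phi: "0 < a \<Longrightarrow> continuous_on {a..b} (\<lambda>u. 1 / \<phi> u)"
  using phi_pos by (intro continuous_intros continuous_on_phi) (auto simp: less_le)

lemma H_1 [simp]: "H 1 = 0"
  by (simp add: H_phi_def)

lemma continuous_on_H: "1 \<le> a \<Longrightarrow> continuous_on {a..b} H"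
proof (rule continuous_on_subset)
  show "continuous_on {1..b} H"
    unfolding H_phi_def[abs_def]
    by (intro indefinite_integral_continuous_1 integrable_continuous_real continuous_on_inverse_phi) auto
qed auto

lemma H_has_deriv:
  assumes "1 < u"
  shows "(H has_real_derivative 1 / \<phi> u) (at u)"
proof -
  have "((\<lambda>u. integral {1..u} (\<lambda>u. 1 / \<phi> u)) has_real_derivative 1 / \<phi> u) (at u within {1..u+1})"
    using assms by (intro integral_has_real_derivative continuous_on_inverse_phi) auto
  moreover have "at u within {1..u+1} = at u" using assms by (intro at_within_interior) auto
  ultimately show ?thesis by (simp add: H_phi_def[abs_def])
qed

lemma H_strict_mono:
  assumes "1 \<le> x" "x < y"
  shows "H x < H y"
proof (rule DERIV_pos_imp_increasing_open[OF assms(2)])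
  show "\<exists>l. (H has_real_derivative l) (at u) \<and> 0 < l" if "x < u" "u < y" for u
    using that assms phi_pos[of u] by (intro exI[of _ "1 / \<phi> u"] conjI H_has_deriv) auto
qed (rule continuous_on_H[OF assms(1)])

lemma H_le_iff: "1 \<le> x \<Longrightarrow> 1 \<le> y \<Longrightarrow> H x \<le> H y \<longleftrightarrow> x \<le> y"
  using H_strict_mono[of x y] H_strict_mono[of y x] by (cases x y rule: linorder_cases) auto

lemma H_nonneg: "1 \<le> x \<Longrightarrow> 0 \<le> H x"
  using H_le_iff[of 1 x] by simp

lemma ln_le_H:
  assumes "1 \<le> x"
  shows "ln x \<le> \<phi> 1 * H x"
proof -
  have "\<phi> 1 * H 1 - ln 1 \<le> \<phi> 1 * H x - ln x"
  proof (rule DERIV_nonneg_imp_increasing_open[OF assms])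
    fix u :: real assume u: "1 < u" "u < x"
    have "((\<lambda>u. \<phi> 1 * H u - ln u) has_real_derivative \<phi> 1 * (1 / \<phi> u) - 1 / u) (at u)"
      using u by (auto intro!: derivative_eq_intros H_has_deriv)
    moreover have "1 / u \<le> \<phi> 1 * (1 / \<phi> u)"
      using u phi_star_shaped[of 1 u] phi_pos[of u] by (simp add: field_simps)
    ultimately show "\<exists>y. ((\<lambda>u. \<phi> 1 * H u - ln u) has_real_derivative y) (at u) \<and> 0 \<le> y" by force
  qed (auto intro!: continuous_intros continuous_on_H)
  then show ?thesis by simp
qed

lemma H_phi_inv:
  assumes "0 \<le> s"
  shows "H_phi_inv \<phi> s \<ge> 1" "H (H_phi_inv \<phi> s) = s"
proof -
  have "1 \<le> exp (\<phi> 1 * s)" using assms phi_nonneg[of 1] by simp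
  then have "s \<le> H (exp (\<phi> 1 * s))"
    using ln_le_H[of "exp (\<phi> 1 * s)"] phi_pos[of 1] by simp
  then obtain y where y: "1 \<le> y" "H y = s"
    using IVT'[of H 1 s "exp (\<phi> 1 * s)"] \<open>1 \<le> exp (\<phi> 1 * s)\<close> assms continuous_on_H[of 1] by auto
  have "H_phi_inv \<phi> s = y"
    unfolding H_phi_inv_def
  proof (rule the_equality)
    fix z assume "1 \<le> z \<and> H z = s"
    then show "z = y" using H_le_iff[of z y] H_le_iff[of y z] y by simp
  qed (use y in simp)
  then show "H_phi_inv \<phi> s \<ge> 1" "H (H_phi_inv \<phi> s) = s" using y by auto
qed

definition rate :: "real \<Rightarrow> real" where "rate t = \<phi> (H_phi_inv \<phi> t)"

lemma rate_pos: "0 \<le> t \<Longrightarrow> 0 < rate t"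
  unfolding rate_def using H_phi_inv(1)[of t] by (intro phi_pos) simp

lemma rate_mono:
  assumes "0 \<le> s" "s \<le> t"
  shows "rate s \<le> rate t"
proof -
  have "H_phi_inv \<phi> s \<le> H_phi_inv \<phi> t"
    using assms H_phi_inv[of s] H_phi_inv[of t] by (subst H_le_iff[symmetric]) auto
  then show ?thesis unfolding rate_def using H_phi_inv(1)[of s] assms by (intro phi_mono) auto
qed

lemma rate_at_top: "filterlim rate at_top at_top"
  unfolding filterlim_at_top
proof
  fix Z
  obtain z where z: "z > 1" "\<phi> z > Z" using phi_exceeds by blast
  show "eventually (\<lambda>s. Z \<le> rate s) at_top"
    using eventually_ge_at_top[of "H z"]
  proof eventually_elim
    case (elim s)
    then have "0 \<le> s" using H_nonneg[of z] z by simp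
    then have "z \<le> H_phi_inv \<phi> s" using H_phi_inv[of s] H_le_iff[of z "H_phi_inv \<phi> s"] z elim by simp
    then show ?case using phi_mono[of z "H_phi_inv \<phi> s"] z by (simp add: rate_def)
  qed
qed

lemma ln_phi_ratio_mean_value:
  assumes "1 \<le> u" "u < v"
  obtains \<xi> where "u < \<xi>" "\<xi> < v" "ln (\<phi> v / \<phi> u) = deriv \<phi> \<xi> * (H v - H u)"
proof -
  have pos: "0 < \<phi> x" if "u \<le> x" for x using that assms by (intro phi_pos) auto
  define a b where "a = ln (\<phi> v) - ln (\<phi> u)" and "b = H v - H u"
  define F where "F x = a * H x - b * ln (\<phi> x)" for x
  have F_deriv: "(F has_real_derivative a * (1 / \<phi> x) - b * (deriv \<phi> x / \<phi> x)) (at x)" if "u < x" for x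
    unfolding F_def using that assms pos[of x]
    by (auto intro!: derivative_eq_intros phi_has_deriv H_has_deriv)
  have "continuous_on {u..v} F"
    unfolding F_def using assms pos
    by (intro continuous_intros continuous_on_H continuous_on_phi) (auto simp: less_le)
  then obtain l \<xi> where \<xi>: "u < \<xi>" "\<xi> < v" "(F has_real_derivative l) (at \<xi>)" "F v - F u = (v - u) * l"
    using MVT[of u v F] F_deriv assms by (auto simp: real_differentiable_def)
  have "F v - F u = 0" by (simp add: F_def a_def b_def algebra_simps)
  then have "a * (1 / \<phi> \<xi>) - b * (deriv \<phi> \<xi> / \<phi> \<xi>) = 0"
    using \<xi> assms DERIV_unique[OF \<xi>(3) F_deriv[OF \<xi>(1)]] by simp
  then have "a = deriv \<phi> \<xi> * b" using pos[of \<xi>] \<xi>(1) by (simp add: field_simps)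
  then show ?thesis
    using that \<xi>(1,2) pos[of u] pos[of v] assms by (simp add: a_def b_def ln_div)
qed

lemma ln_phi_ratio_le:
  assumes "1 \<le> u" "u \<le> v"
  shows "ln (\<phi> v / \<phi> u) \<le> deriv \<phi> u * (H v - H u)"
proof (cases "u = v")
  case False
  then obtain \<xi> where "u < \<xi>" "ln (\<phi> v / \<phi> u) = deriv \<phi> \<xi> * (H v - H u)"
    using ln_phi_ratio_mean_value[of u v] assms by auto
  then show ?thesis
    using assms deriv_phi_antimono[of u \<xi>] by (simp add: H_le_iff mult_right_mono)
qed (use assms phi_pos[of v] in simp)

lemma ln_phi_ratio_ge:
  assumes "1 \<le> u" "u \<le> v"
  shows "deriv \<phi> v * (H v - H u) \<le> ln (\<phi> v / \<phi> u)"
proof (cases "u = v")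
  case False
  then obtain \<xi> where "u < \<xi>" "\<xi> < v" "ln (\<phi> v / \<phi> u) = deriv \<phi> \<xi> * (H v - H u)"
    using ln_phi_ratio_mean_value[of u v] assms by auto
  then show ?thesis
    using assms deriv_phi_antimono[of \<xi> v] by (simp add: H_le_iff mult_right_mono)
qed (use assms phi_pos[of v] in simp)

definition exp_weight :: "real \<Rightarrow> real \<Rightarrow> real \<Rightarrow> real" where
  "exp_weight l s u = exp (l * H (min u s))"

context
  fixes l s :: real
  assumes l: "0 \<le> l" and s: "1 \<le> s"
begin

lemma exp_weight_mono: "1 \<le> u \<Longrightarrow> u \<le> v \<Longrightarrow> exp_weight l s u \<le> exp_weight l s v"
  unfolding exp_weight_def using l s by (auto intro!: mult_left_mono simp: H_le_iff)

lemma exp_weight_le_truncated: "1 \<le> z \<Longrightarrow> s \<le> u \<Longrightarrow> exp_weight l s z \<le> exp_weight l s u"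
  unfolding exp_weight_def using l s by (auto intro!: mult_left_mono simp: H_le_iff)

lemma exp_weight_ge_1: "1 \<le> u \<Longrightarrow> 1 \<le> exp_weight l s u"
  unfolding exp_weight_def using l s by (simp add: H_nonneg)

lemma exp_weight_below_tangent:
  assumes "l \<le> deriv \<phi> s" "1 \<le> u" "u \<le> s" "1 \<le> z"
  shows "exp_weight l s z \<le> exp_weight l s u + l * exp_weight l s u / \<phi> u * (z - u)"
proof -
  have antimono: "l * (exp (l * H y) / \<phi> y) \<le> l * (exp (l * H x) / \<phi> x)" if "1 \<le> x" "x \<le> y" "y \<le> s" for x y
  proof -
    have "l * (H y - H x) \<le> deriv \<phi> y * (H y - H x)"
      using that assms(1) deriv_phi_antimono[of y s] by (intro mult_right_mono) (auto simp: H_le_iff)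
    also have "\<dots> \<le> ln (\<phi> y / \<phi> x)" using that by (intro ln_phi_ratio_ge) auto
    finally have "exp (l * H y - ln (\<phi> y)) \<le> exp (l * H x - ln (\<phi> x))"
      using that phi_pos[of x] phi_pos[of y] by (simp add: ln_div algebra_simps)
    then show ?thesis
      using that l phi_pos[of x] phi_pos[of y] by (intro mult_left_mono) (simp_all add: exp_diff)
  qed
  have "exp (l * H (min z s)) \<le> exp (l * H u) + l * (exp (l * H u) / \<phi> u) * (min z s - u)"
  proof (rule antimono_deriv_imp_below_tangent[of 1 s "\<lambda>x. exp (l * H x)" "\<lambda>x. l * (exp (l * H x) / \<phi> x)"])
    show "((\<lambda>x. exp (l * H x)) has_real_derivative l * (exp (l * H x) / \<phi> x)) (at x)" if "1 < x" for x
      using that by (auto intro!: derivative_eq_intros H_has_deriv)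
  qed (use assms antimono in \<open>auto intro!: continuous_intros continuous_on_H\<close>)
  then have "exp_weight l s z \<le> exp_weight l s u + l * exp_weight l s u / \<phi> u * (min z s - u)"
    using assms by (simp add: exp_weight_def)
  also have "\<dots> \<le> exp_weight l s u + l * exp_weight l s u / \<phi> u * (z - u)"
    using assms l phi_pos[of u] by (intro add_left_mono mult_left_mono) (auto simp: exp_weight_def)
  finally show ?thesis .
qed

lemma exp_weight_comp_measurable:
  assumes [measurable]: "f \<in> borel_measurable M" and "\<And>x. 1 \<le> f x"
  shows "(\<lambda>x. exp_weight l s (f x)) \<in> borel_measurable M"
proof -
  define g where "g u = exp_weight l s (max 1 u)" for u
  have "mono g" unfolding g_def by (intro monoI exp_weight_mono) auto
  then have "g \<in> borel_measurable borel" by (rule borel_measurable_mono)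
  then have "(\<lambda>x. g (f x)) \<in> borel_measurable M" by measurable
  then show ?thesis using assms(2) by (simp add: g_def max_def)
qed

end

end

section \<open>Oscillation bounds\<close>

lemma powr_mult_powr_le_linear:
  fixes x y A B q :: real
  assumes "0 \<le> x" "0 \<le> y" "0 < A" "0 < B" "0 < q" "q < 1"
  shows "x powr (1 - q) * y powr q \<le> A powr (1 - q) * B powr q * ((1 - q) * (x / A) + q * (y / B))"
proof (cases "x = 0 \<or> y = 0")
  case True
  then show ?thesis using assms by (auto intro!: add_nonneg_nonneg mult_nonneg_nonneg)
next
  case False
  then have "(x / A) powr (1 - q) * (y / B) powr q \<le> (1 - q) * (x / A) + q * (y / B)"
    using assms by (intro Youngs_inequality_0) auto
  then have "A powr (1 - q) * B powr q * ((x / A) powr (1 - q) * (y / B) powr q)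
      \<le> A powr (1 - q) * B powr q * ((1 - q) * (x / A) + q * (y / B))"
    by (intro mult_left_mono) auto
  then show ?thesis using assms by (simp add: powr_divide)
qed

lemma integral_powr_mult_powr_le:
  fixes d W :: "'a \<Rightarrow> real"
  assumes d: "integrable M d" "\<And>x. 0 \<le> d x" "(\<integral>x. d x \<partial>M) \<le> A" "0 < A"
    and W: "integrable M W" "\<And>x. 0 \<le> W x" "(\<integral>x. W x \<partial>M) \<le> B" "0 < B"
    and q: "0 < q" "q < 1"
  shows "integrable M (\<lambda>x. d x powr (1 - q) * W x powr q)"
    and "(\<integral>x. d x powr (1 - q) * W x powr q \<partial>M) \<le> A powr (1 - q) * B powr q"
proof -
  define C where "C = A powr (1 - q) * B powr q"
  have [measurable]: "d \<in> borel_measurable M" "W \<in> borel_measurable M" using d W by auto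
  have young: "d x powr (1 - q) * W x powr q \<le> C * ((1 - q) * (d x / A) + q * (W x / B))" for x
    unfolding C_def using assms by (intro powr_mult_powr_le_linear) auto
  have linear: "integrable M (\<lambda>x. C * ((1 - q) * (d x / A) + q * (W x / B)))"
    using d(1) W(1) by (intro integrable_mult_right Bochner_Integration.integrable_add integrable_divide) auto
  show int: "integrable M (\<lambda>x. d x powr (1 - q) * W x powr q)"
    by (rule Bochner_Integration.integrable_bound[OF linear]) (use young abs_ge_self order_trans in \<open>auto, blast\<close>)
  have "(\<integral>x. d x powr (1 - q) * W x powr q \<partial>M) \<le> (\<integral>x. C * ((1 - q) * (d x / A) + q * (W x / B)) \<partial>M)"
    by (rule integral_mono[OF int linear young])
  also have "\<dots> = C * ((1 - q) * ((\<integral>x. d x \<partial>M) / A) + q * ((\<integral>x. W x \<partial>M) / B))"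
    using d(1) W(1) by simp
  also have "\<dots> \<le> C * ((1 - q) * 1 + q * 1)"
    using d(3,4) W(3,4) q by (intro mult_left_mono add_mono) (auto simp: C_def)
  finally show "(\<integral>x. d x powr (1 - q) * W x powr q \<partial>M) \<le> A powr (1 - q) * B powr q"
    by (simp add: C_def)
qed

lemma (in prob_space) integral_powr_le:
  fixes W :: "'a \<Rightarrow> real"
  assumes "integrable M W" "\<And>x. 0 \<le> W x" "(\<integral>x. W x \<partial>M) \<le> B" "0 < B" "0 < q" "q < 1"
  shows "integrable M (\<lambda>x. W x powr q)" "(\<integral>x. W x powr q \<partial>M) \<le> B powr q"
  using integral_powr_mult_powr_le[of M "\<lambda>_. 1" 1 W B q] assms by (auto simp: prob_space)

definition osc_bound :: "('a::topological_space \<Rightarrow> 'a \<Rightarrow> real) \<Rightarrow> real \<Rightarrow> ('a \<Rightarrow> real) \<Rightarrow> ('a \<Rightarrow> real) \<Rightarrow> bool" where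
  "osc_bound d q J g \<longleftrightarrow> g \<in> borel_measurable borel \<and> bounded (range g) \<and>
     (\<forall>x y. \<bar>g x - g y\<bar> \<le> d x y powr (1 - q) * (J x + J y) powr q)"

lemma osc_bound_wasserstein:
  fixes g J :: "'a::topological_space \<Rightarrow> real"
  assumes \<mu>: "borel_distribution \<mu>" and \<nu>: "borel_distribution \<nu>"
    and d [measurable]: "(\<lambda>z. d (fst z) (snd z)) \<in> borel_measurable (borel \<Otimes>\<^sub>M borel)"
    and d01: "\<And>x y. 0 \<le> d x y" "\<And>x y. d x y \<le> 1" and cost: "wasserstein d \<mu> \<nu> \<le> ennreal A" "0 \<le> A"
    and J: "integrable \<mu> J" "integrable \<nu> J" "\<And>x. 0 \<le> J x" "0 < (\<integral>x. J x \<partial>\<mu>) + (\<integral>x. J x \<partial>\<nu>)"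
    and g: "osc_bound d q J g" and q: "0 < q" "q < 1"
  shows "\<bar>(\<integral>x. g x \<partial>\<mu>) - (\<integral>x. g x \<partial>\<nu>)\<bar> \<le> A powr (1 - q) * ((\<integral>x. J x \<partial>\<mu>) + (\<integral>x. J x \<partial>\<nu>)) powr q"
proof -
  interpret \<mu>: borel_distribution \<mu> by fact
  interpret \<nu>: borel_distribution \<nu> by fact
  have J_meas: "J \<in> borel_measurable borel" using borel_measurable_integrable[OF J(1)] by simp
  have g_meas: "g \<in> borel_measurable borel" using g by (simp add: osc_bound_def)
  obtain B where B: "\<And>x. \<bar>g x\<bar> \<le> B" using g by (auto simp: osc_bound_def bounded_iff)
  have g_int: "integrable \<mu> g" "integrable \<nu> g"
    using B g_meas by (auto intro!: \<mu>.integrable_const_bound[where B=B] \<nu>.integrable_const_bound[where B=B])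
  define S where "S = (\<integral>x. J x \<partial>\<mu>) + (\<integral>x. J x \<partial>\<nu>)"
  have approx: "\<bar>(\<integral>x. g x \<partial>\<mu>) - (\<integral>x. g x \<partial>\<nu>)\<bar> \<le> (A + \<epsilon>) powr (1 - q) * S powr q" if \<epsilon>: "\<epsilon> > 0" for \<epsilon>
  proof -
    obtain c where c: "c \<in> couplings \<mu> \<nu>" and c_cost: "(\<integral>\<^sup>+z. ennreal (d (fst z) (snd z)) \<partial>c) \<le> ennreal (A + \<epsilon>)"
      using wasserstein_coupling[OF cost(1) \<epsilon> cost(2)] by blast
    interpret prob_space c by (rule couplingsD(1)[OF c])
    note [measurable_cong] = couplingsD(2)[OF c]
    have d_int: "integrable c (\<lambda>z. d (fst z) (snd z))"
      using d01 by (intro integrable_const_bound[where B=1]) auto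
    have "(\<integral>z. d (fst z) (snd z) \<partial>c) \<le> A + \<epsilon>"
      using c_cost nn_integral_eq_integral[OF d_int] d01 cost(2) \<epsilon> by (simp add: ennreal_le_iff del: ennreal_plus)
    moreover have "integrable c (\<lambda>z. J (fst z) + J (snd z))" "(\<integral>z. J (fst z) + J (snd z) \<partial>c) \<le> S"
      using coupling_integrable(1)[OF c J(1)] coupling_integrable(2)[OF c J(2)]
      by (simp_all add: coupling_integral[OF c J_meas] S_def)
    ultimately have "integrable c (\<lambda>z. d (fst z) (snd z) powr (1 - q) * (J (fst z) + J (snd z)) powr q)"
      and "(\<integral>z. d (fst z) (snd z) powr (1 - q) * (J (fst z) + J (snd z)) powr q \<partial>c) \<le> (A + \<epsilon>) powr (1 - q) * S powr q"
      using integral_powr_mult_powr_le[OF d_int, of "A + \<epsilon>" "\<lambda>z. J (fst z) + J (snd z)" S q] d01 J(3,4) cost(2) \<epsilon> q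
      by (auto simp: S_def)
    then show ?thesis
      using coupling_integral_diff_le[OF c g_int g_meas,
        of "\<lambda>z. d (fst z) (snd z) powr (1 - q) * (J (fst z) + J (snd z)) powr q"] g
      by (force simp: osc_bound_def)
  qed
  have "(\<lambda>n. (A + inverse (real (Suc n))) powr (1 - q) * S powr q) \<longlonglongrightarrow> (A + 0) powr (1 - q) * S powr q"
    using q cost(2) by (intro tendsto_mult tendsto_powr' tendsto_add tendsto_const LIMSEQ_inverse_real_of_nat)
      (auto intro!: always_eventually add_nonneg_nonneg)
  then have "\<bar>(\<integral>x. g x \<partial>\<mu>) - (\<integral>x. g x \<partial>\<nu>)\<bar> \<le> (A + 0) powr (1 - q) * S powr q"
    by (rule LIMSEQ_le_const) (auto intro!: approx)
  then show ?thesis by (simp add: S_def)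
qed

section \<open>Markov semigroups\<close>

locale markov_semigroup =
  fixes P :: "real \<Rightarrow> 'a::polish_space \<Rightarrow> 'a measure"
  assumes markov: "markov_tf P"
begin

lemma borel_distribution_P: "0 \<le> t \<Longrightarrow> borel_distribution (P t x)"
  using markov by (simp add: markov_tf_def borel_distribution_def borel_distribution_axioms_def)

lemma kernel_P: "0 \<le> t \<Longrightarrow> P t \<in> borel \<rightarrow>\<^sub>M prob_algebra borel"
  using markov by (intro measurable_prob_algebraI measurable_subprob_algebra)
    (auto simp: markov_tf_def prob_space_imp_subprob_space)

lemma kernel_P_distribution: "0 \<le> t \<Longrightarrow> borel_distribution \<mu> \<Longrightarrow> P t \<in> \<mu> \<rightarrow>\<^sub>M prob_algebra borel"
  using kernel_P[of t] borel_distribution.sets_eq_borel[of \<mu>] by (simp cong: measurable_cong_sets)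

lemma borel_distribution_bind_P: "0 \<le> t \<Longrightarrow> borel_distribution \<mu> \<Longrightarrow> borel_distribution (\<mu> \<bind> P t)"
  by (rule borel_distribution_bind[OF _ kernel_P_distribution]) (auto simp: borel_distribution_def)

lemma emeasure_bind_P:
  assumes "0 \<le> t" "borel_distribution \<mu>" "A \<in> sets borel"
  shows "emeasure (\<mu> \<bind> P t) A = (\<integral>\<^sup>+x. emeasure (P t x) A \<partial>\<mu>)"
  using assms kernel_P by (intro emeasure_bind_prob_algebra[where N=borel]) (auto simp: in_prob_algebra_borel_iff)

lemma P_0: "P 0 x = return borel x"
  using markov by (auto simp: markov_tf_def)

lemma P_add:
  assumes "0 \<le> s" "0 \<le> t"
  shows "P (s + t) x = P s x \<bind> P t"
proof (rule measure_eqI)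
  interpret bind: borel_distribution "P s x \<bind> P t"
    by (intro borel_distribution_bind_P borel_distribution_P assms)
  interpret add: borel_distribution "P (s + t) x" using assms by (intro borel_distribution_P) simp
  show "sets (P (s + t) x) = sets (P s x \<bind> P t)" by simp
  fix A assume "A \<in> sets (P (s + t) x)"
  then show "emeasure (P (s + t) x) A = emeasure (P s x \<bind> P t) A"
    using markov assms by (simp add: emeasure_bind_P borel_distribution_P markov_tf_def)
qed

lemma bind_P_bind_P:
  assumes "borel_distribution \<mu>" "0 \<le> s" "0 \<le> t"
  shows "(\<mu> \<bind> P s) \<bind> P t = \<mu> \<bind> P (s + t)"
proof -
  have "(\<mu> \<bind> P s) \<bind> P t = \<mu> \<bind> (\<lambda>x. P s x \<bind> P t)"
    using assms by (intro bind_assoc[of _ _ borel _ borel] measurable_prob_algebraD kernel_P kernel_P_distribution)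
  also have "(\<lambda>x. P s x \<bind> P t) = P (s + t)" using assms by (simp add: P_add fun_eq_iff)
  finally show ?thesis .
qed

abbreviation expect :: "real \<Rightarrow> ('a \<Rightarrow> real) \<Rightarrow> 'a \<Rightarrow> real" where
  "expect t f x \<equiv> \<integral>y. f y \<partial>P t x"

lemma expect_0: "f \<in> borel_measurable borel \<Longrightarrow> expect 0 f x = f x"
  by (simp add: P_0 integral_return)

lemma expect_measurable: "0 \<le> t \<Longrightarrow> f \<in> borel_measurable borel \<Longrightarrow> expect t f \<in> borel_measurable borel"
  by (rule measurable_compose[OF measurable_prob_algebraD[OF kernel_P] integral_measurable_subprob_algebra])

lemma integral_bind_P:
  fixes f :: "'a \<Rightarrow> real"
  assumes "0 \<le> t" "borel_distribution \<mu>" "f \<in> borel_measurable borel" "\<And>y. \<bar>f y\<bar> \<le> B"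
  shows "(\<integral>y. f y \<partial>(\<mu> \<bind> P t)) = (\<integral>x. expect t f x \<partial>\<mu>)"
  by (rule integral_bind_kernel[OF _ kernel_P_distribution]) (use assms in \<open>auto simp: borel_distribution_def\<close>)

lemma expect_add_bounded:
  assumes "0 \<le> s" "0 \<le> t" "f \<in> borel_measurable borel" "\<And>y. \<bar>f y\<bar> \<le> B"
  shows "expect (s + t) f x = expect s (expect t f) x"
  unfolding P_add[OF assms(1,2)] by (rule integral_bind_P) (use assms borel_distribution_P in auto)

definition semigroup_integrable :: "('a \<Rightarrow> real) \<Rightarrow> bool" where
  "semigroup_integrable f \<longleftrightarrow> f \<in> borel_measurable borel \<and> (\<forall>t\<ge>0. \<forall>x. integrable (P t x) f)"

lemma semigroup_integrableD:
  "semigroup_integrable f \<Longrightarrow> f \<in> borel_measurable borel" "semigroup_integrable f \<Longrightarrow> 0 \<le> t \<Longrightarrow> integrable (P t x) f"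
  by (auto simp: semigroup_integrable_def)

lemma semigroup_integrable_bounded:
  assumes "f \<in> borel_measurable borel" "\<And>y. \<bar>f y\<bar> \<le> B"
  shows "semigroup_integrable f"
  unfolding semigroup_integrable_def
proof (intro conjI allI impI)
  fix t x assume "0 \<le> (t::real)"
  then interpret borel_distribution "P t x" by (rule borel_distribution_P)
  show "integrable (P t x) f" using assms by (intro integrable_const_bound[where B=B]) auto
qed (rule assms)

lemma abs_expect_le:
  assumes "0 \<le> t" "f \<in> borel_measurable borel" "\<And>y. \<bar>f y\<bar> \<le> B"
  shows "\<bar>expect t f x\<bar> \<le> B"
proof -
  interpret borel_distribution "P t x" by (rule borel_distribution_P[OF assms(1)])
  have "integrable (P t x) f"
    by (rule semigroup_integrableD(2)[OF semigroup_integrable_bounded[OF assms(2,3)] assms(1)])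
  then have "expect t (\<lambda>y. \<bar>f y\<bar>) x \<le> B" using assms(3) by (intro integral_le_const) auto
  then show ?thesis by (rule order_trans[OF integral_abs_bound])
qed

lemma semigroup_integrable_affine_bound:
  assumes v: "semigroup_integrable v" and f: "f \<in> borel_measurable borel" "\<And>y. 0 \<le> f y" "\<And>y. f y \<le> a + b * v y"
  shows "semigroup_integrable f"
  unfolding semigroup_integrable_def
proof (intro conjI allI impI)
  fix t x assume t: "0 \<le> (t::real)"
  then interpret borel_distribution "P t x" by (rule borel_distribution_P)
  have "integrable (P t x) (\<lambda>y. a + b * v y)" using semigroup_integrableD(2)[OF v t] by simp
  then show "integrable (P t x) f"
    by (rule Bochner_Integration.integrable_bound) (use f abs_ge_self order_trans in \<open>auto, blast\<close>)
qed (rule f)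

lemma expect_affine_le:
  assumes v: "semigroup_integrable v" and f: "semigroup_integrable f" "\<And>y. f y \<le> a + b * v y" and t: "0 \<le> t"
  shows "expect t f x \<le> a + b * expect t v x"
proof -
  interpret borel_distribution "P t x" by (rule borel_distribution_P[OF t])
  note int = semigroup_integrableD(2)[OF v t] semigroup_integrableD(2)[OF f(1) t]
  have "expect t f x \<le> expect t (\<lambda>y. a + b * v y) x" using int f(2) by (intro integral_mono) auto
  also have "\<dots> = a + b * expect t v x" using int by simp
  finally show ?thesis .
qed

lemma expect_ge_const:
  assumes "semigroup_integrable f" "0 \<le> t" "\<And>y. a \<le> f y"
  shows "a \<le> expect t f x"
proof -
  interpret borel_distribution "P t x" by (rule borel_distribution_P[OF assms(2)])
  show ?thesis using semigroup_integrableD(2)[OF assms(1,2)] assms(3) by (intro integral_ge_const) auto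
qed

lemma
  assumes f: "semigroup_integrable f" "\<And>y. 0 \<le> f y" and t: "0 \<le> t"
  shows semigroup_integrable_expect: "semigroup_integrable (expect t f)"
    and expect_add_nonneg: "0 \<le> s \<Longrightarrow> expect (s + t) f x = expect s (expect t f) x"
proof -
  note f_meas = semigroup_integrableD(1)[OF f(1)]
  have expect_meas: "expect t f \<in> borel_measurable borel" by (rule expect_measurable[OF t f_meas])
  have expect_nonneg: "0 \<le> expect t f x" for x using expect_ge_const[OF f(1) t f(2)] .
  have nn_eq: "(\<integral>\<^sup>+y. ennreal (f y) \<partial>P u x) = ennreal (expect u f x)" if "0 \<le> u" for u x
    using semigroup_integrableD(2)[OF f(1) that] f(2) by (intro nn_integral_eq_integral) auto
  have nn: "(\<integral>\<^sup>+z. ennreal (expect t f z) \<partial>P s x) = ennreal (expect (s + t) f x)" if "0 \<le> s" for s x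
  proof -
    interpret borel_distribution "P s x" by (rule borel_distribution_P[OF that])
    have "ennreal (expect (s + t) f x) = (\<integral>\<^sup>+y. ennreal (f y) \<partial>(P s x \<bind> P t))"
      using nn_eq[of "s + t" x] that t by (simp add: P_add)
    also have "\<dots> = (\<integral>\<^sup>+z. \<integral>\<^sup>+y. ennreal (f y) \<partial>P t z \<partial>P s x)"
      by (rule nn_integral_bind_kernel[OF prob_space_axioms kernel_P_distribution[OF t borel_distribution_axioms]])
         (use f_meas in measurable)
    finally show ?thesis by (simp add: nn_eq[OF t])
  qed
  have int: "integrable (P s x) (expect t f)" if "0 \<le> s" for s x
  proof -
    interpret borel_distribution "P s x" by (rule borel_distribution_P[OF that])
    show ?thesis using expect_nonneg nn[OF that, of x] expect_meas by (intro integrableI_nonneg) auto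
  qed
  show "semigroup_integrable (expect t f)" using expect_meas int by (simp add: semigroup_integrable_def)
  show "expect (s + t) f x = expect s (expect t f) x" if "0 \<le> s"
    using nn[OF that, of x] nn_integral_eq_integral[OF int[OF that]] expect_nonneg
      expect_ge_const[OF f(1) _ f(2), of "s + t" x]
      expect_ge_const[OF \<open>semigroup_integrable (expect t f)\<close> that expect_nonneg] that t
    by simp
qed

definition weight :: "('a \<Rightarrow> real) \<Rightarrow> bool" where
  "weight J \<longleftrightarrow> semigroup_integrable J \<and> (\<exists>j>0. \<forall>x. j \<le> J x)"

lemma weight_pos: "weight J \<Longrightarrow> 0 < J x"
  unfolding weight_def by (meson less_le_trans)

lemma weight_expect:
  assumes "weight J" "0 \<le> t"
  shows "weight (expect t J)"
proof -
  obtain j where "j > 0" "\<And>x. j \<le> J x" using assms(1) by (auto simp: weight_def)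
  moreover have J: "semigroup_integrable J" using assms(1) by (simp add: weight_def)
  ultimately show ?thesis
    using semigroup_integrable_expect[OF J _ assms(2)] expect_ge_const[OF J assms(2)] weight_pos[OF assms(1)]
      less_imp_le
    unfolding weight_def by blast
qed

lemma osc_bound_expect_wasserstein:
  assumes d: "(\<lambda>z. d (fst z) (snd z)) \<in> borel_measurable (borel \<Otimes>\<^sub>M borel)" "\<And>x y. 0 \<le> d x y" "\<And>x y. d x y \<le> 1"
    and t: "0 \<le> t" and cost: "wasserstein d (P t x) (P t y) \<le> ennreal A" "0 \<le> A"
    and J: "weight J" and g: "osc_bound d q J g" and q: "0 < q" "q < 1"
  shows "\<bar>expect t g x - expect t g y\<bar> \<le> A powr (1 - q) * (expect t J x + expect t J y) powr q"
proof (rule osc_bound_wasserstein[OF borel_distribution_P[OF t] borel_distribution_P[OF t] d cost _ _ _ _ g q])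
  show "integrable (P t x) J" "integrable (P t y) J"
    using J t by (auto simp: weight_def semigroup_integrable_def)
  show "0 < expect t J x + expect t J y" using weight_pos[OF weight_expect[OF J t]] by (intro add_pos_pos)
qed (rule less_imp_le[OF weight_pos[OF J]])

definition osc_contracting :: "real \<Rightarrow> ('a \<Rightarrow> 'a \<Rightarrow> real) \<Rightarrow> real \<Rightarrow> 'a \<Rightarrow> 'a \<Rightarrow> bool" where
  "osc_contracting t d A x y \<longleftrightarrow> (\<forall>q J g. 0 < q \<longrightarrow> q < 1 \<longrightarrow> weight J \<longrightarrow> osc_bound d q J g \<longrightarrow>
     \<bar>expect t g x - expect t g y\<bar> \<le> A powr (1 - q) * (expect t J x + expect t J y) powr q)"

lemma osc_contracting_add:
  assumes d: "(\<lambda>z. d (fst z) (snd z)) \<in> borel_measurable (borel \<Otimes>\<^sub>M borel)" "\<And>x y. 0 \<le> d x y" "\<And>x y. d x y \<le> 1"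
    and d': "(\<lambda>z. d' (fst z) (snd z)) \<in> borel_measurable (borel \<Otimes>\<^sub>M borel)" "\<And>x y. 0 \<le> d' x y" "\<And>x y. d' x y \<le> 1"
    and T: "0 \<le> T" "\<And>u v. wasserstein d (P T u) (P T v) \<le> ennreal (d' u v)"
    and t: "0 \<le> t" "wasserstein d' (P t x) (P t y) \<le> ennreal A" "0 \<le> A"
  shows "osc_contracting (t + T) d A x y"
  unfolding osc_contracting_def
proof (intro allI impI)
  fix q J g assume q: "0 < q" "q < 1" and J: "weight J" and g: "osc_bound d q J g"
  obtain B where B: "\<And>y. \<bar>g y\<bar> \<le> B" using g by (auto simp: osc_bound_def bounded_iff)
  have g_meas: "g \<in> borel_measurable borel" using g by (simp add: osc_bound_def)
  have "osc_bound d' q (expect T J) (expect T g)"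
    unfolding osc_bound_def
  proof (intro conjI allI)
    show "bounded (range (expect T g))"
      using abs_expect_le[OF T(1) g_meas B] by (auto simp: bounded_iff)
  qed (use expect_measurable[OF T(1) g_meas] osc_bound_expect_wasserstein[OF d T d'(2) J g q] in auto)
  then have "\<bar>expect t (expect T g) x - expect t (expect T g) y\<bar>
      \<le> A powr (1 - q) * (expect t (expect T J) x + expect t (expect T J) y) powr q"
    using osc_bound_expect_wasserstein[OF d' t weight_expect[OF J T(1)] _ q] by blast
  then show "\<bar>expect (t + T) g x - expect (t + T) g y\<bar>
      \<le> A powr (1 - q) * (expect (t + T) J x + expect (t + T) J y) powr q"
    using expect_add_bounded[OF t(1) T(1) g_meas B]
      expect_add_nonneg[OF _ less_imp_le[OF weight_pos[OF J]] T(1) t(1)] J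
    by (simp add: weight_def)
qed

end

section \<open>Generalised couplings and small sets\<close>

definition trunc_scale :: "real \<Rightarrow> ('a \<Rightarrow> 'a \<Rightarrow> real) \<Rightarrow> 'a \<Rightarrow> 'a \<Rightarrow> real" where
  "trunc_scale N \<theta> x y = min 1 (N * \<theta> x y)"

lemma trunc_scale_le_1: "trunc_scale N \<theta> x y \<le> 1"
  by (simp add: trunc_scale_def)

context
  fixes \<theta> :: "'a::second_countable_topology \<Rightarrow> 'a \<Rightarrow> real"
  assumes \<theta>: "premetric \<theta>"
begin

lemma premetric_nonneg: "0 \<le> \<theta> x y"
  using \<theta> by (simp add: premetric_def)

lemma premetric_measurable: "(\<lambda>z. \<theta> (fst z) (snd z)) \<in> borel_measurable (borel \<Otimes>\<^sub>M borel)"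
proof -
  have "{z. a < \<theta> (fst z) (snd z)} \<in> sets borel" for a
    using \<theta> by (intro borel_open) (simp add: premetric_def)
  then show ?thesis unfolding borel_prod by (intro borel_measurableI_greater) simp
qed

lemma trunc_scale_nonneg: "0 \<le> N \<Longrightarrow> 0 \<le> trunc_scale N \<theta> x y"
  by (simp add: trunc_scale_def premetric_nonneg)

lemma trunc_scale_mono: "N \<le> N' \<Longrightarrow> trunc_scale N \<theta> x y \<le> trunc_scale N' \<theta> x y"
  unfolding trunc_scale_def by (intro min.mono mult_right_mono premetric_nonneg) auto

lemma trunc_scale_measurable: "(\<lambda>z. trunc_scale N \<theta> (fst z) (snd z)) \<in> borel_measurable (borel \<Otimes>\<^sub>M borel)"
  unfolding trunc_scale_def using premetric_measurable by measurable

end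

lemma has_markov_law_distr:
  assumes "has_markov_law P x M X" "0 \<le> t" "sets (P t x) = sets borel"
  shows "distr M borel (X t) = P t x"
proof (rule measure_eqI)
  have X: "X t \<in> M \<rightarrow>\<^sub>M borel" using assms by (auto simp: has_markov_law_def)
  fix A assume "A \<in> sets (distr M borel (X t))"
  then have A: "A \<in> sets borel" by simp
  have "emeasure M {\<omega>\<in>space M. \<forall>i<length [(t, A)]. X (\<Sum>j\<le>i. fst ([(t, A)] ! j)) \<omega> \<in> snd ([(t, A)] ! i)}
      = mkv_fdd P x [(t, A)]"
    using assms(1)[unfolded has_markov_law_def, THEN conjunct2, THEN conjunct2, rule_format, of "[(t, A)]"] A assms(2)
    by auto
  then have "emeasure M {\<omega>\<in>space M. X t \<omega> \<in> A} = (\<integral>\<^sup>+y. indicator A y \<partial>P t x)" by simp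
  moreover have "X t -` A \<inter> space M = {\<omega>\<in>space M. X t \<omega> \<in> A}" by auto
  ultimately show "emeasure (distr M borel (X t)) A = emeasure (P t x) A"
    using A assms(3) by (simp add: emeasure_distr[OF X A])
qed (simp add: assms)

lemma wasserstein_le_product_set:
  fixes d :: "'a::second_countable_topology \<Rightarrow> 'a \<Rightarrow> real"
  assumes \<mu>: "borel_distribution \<mu>" and \<nu>: "borel_distribution \<nu>" and D [measurable]: "D \<in> sets borel"
    and d_le: "\<And>x y. d x y \<le> 1" "\<And>x y. x \<in> D \<Longrightarrow> y \<in> D \<Longrightarrow> d x y \<le> 1 / 2"
  shows "wasserstein d \<mu> \<nu> \<le> ennreal (1 - measure \<mu> D * measure \<nu> D / 2)"
proof -
  interpret \<mu>: borel_distribution \<mu> by (rule \<mu>)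
  interpret \<nu>: borel_distribution \<nu> by (rule \<nu>)
  interpret pair_prob_space \<mu> \<nu> ..
  have DD: "D \<times> D \<in> sets (\<mu> \<Otimes>\<^sub>M \<nu>)" by (intro pair_measureI) auto
  have "wasserstein d \<mu> \<nu> \<le> (\<integral>\<^sup>+z. ennreal (d (fst z) (snd z)) \<partial>(\<mu> \<Otimes>\<^sub>M \<nu>))"
    unfolding wasserstein_def by (rule INF_lower[OF product_coupling[OF \<mu> \<nu>]])
  also have "\<dots> \<le> (\<integral>\<^sup>+z. ennreal (1 - indicator (D \<times> D) z / 2) \<partial>(\<mu> \<Otimes>\<^sub>M \<nu>))"
    using d_le by (intro nn_integral_mono ennreal_leI) (auto split: split_indicator)
  also have "\<dots> = ennreal (\<integral>z. 1 - indicator (D \<times> D) z / 2 \<partial>(\<mu> \<Otimes>\<^sub>M \<nu>))"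
    using DD by (intro nn_integral_eq_integral integrable_const_bound[where B=1]) (auto split: split_indicator)
  also have "(\<integral>z. 1 - indicator (D \<times> D) z / 2 \<partial>(\<mu> \<Otimes>\<^sub>M \<nu>)) = 1 - prob (D \<times> D) / 2"
    using DD by (subst Bochner_Integration.integral_diff)
      (auto simp: prob_space intro!: integrable_const_bound[where B=1] split: split_indicator)
  also have "prob (D \<times> D) = measure \<mu> D * measure \<nu> D"
    by (simp add: measure_def \<nu>.emeasure_pair_measure_Times enn2real_mult)
  finally show ?thesis .
qed

context markov_semigroup
begin

lemma wasserstein_generalised_coupling:
  assumes A: "assumption_A TYPE('w) P \<theta> r L" and \<theta>: "premetric \<theta>" and t: "0 \<le> t" and N: "0 \<le> N"
  shows "wasserstein (trunc_scale N \<theta>) (P t x) (P t y) \<le> ennreal (trunc_scale (N * r t + L t) \<theta> x y)"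
proof -
  note \<theta>_nonneg = premetric_nonneg[OF \<theta>] and [measurable] = trunc_scale_measurable[OF \<theta>]
  have rL: "0 \<le> r t" "0 \<le> L t" using A t by (auto simp: assumption_A_def)
  from A have "\<exists>(M::'w measure) X Y. has_markov_law P x M X \<and> (\<forall>t\<ge>0. Y t \<in> measurable M borel) \<and>
      (\<forall>t\<ge>0. dTV (distr M borel (Y t)) (P t y) \<le> L t * \<theta> x y) \<and>
      (\<forall>t\<ge>0. (\<integral>\<^sup>+ \<omega>. ennreal (\<theta> (X t \<omega>) (Y t \<omega>)) \<partial>M) \<le> ennreal (r t * \<theta> x y))"
    unfolding assumption_A_def by blast
  then obtain M :: "'w measure" and X Y where X: "has_markov_law P x M X" and Y [measurable]: "Y t \<in> M \<rightarrow>\<^sub>M borel"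
    and TV: "dTV (distr M borel (Y t)) (P t y) \<le> L t * \<theta> x y"
    and XY: "(\<integral>\<^sup>+ \<omega>. ennreal (\<theta> (X t \<omega>) (Y t \<omega>)) \<partial>M) \<le> ennreal (r t * \<theta> x y)"
    using t by blast
  have M: "prob_space M" and X_meas [measurable]: "X t \<in> M \<rightarrow>\<^sub>M borel" using X t by (auto simp: has_markov_law_def)
  have X_law: "distr M borel (X t) = P t x"
    using has_markov_law_distr[OF X t] borel_distribution.sets_eq_borel[OF borel_distribution_P[OF t]] by simp
  have \<theta>XY: "(\<lambda>\<omega>. \<theta> (X t \<omega>) (Y t \<omega>)) \<in> borel_measurable M"
    using measurable_compose[OF measurable_Pair[OF X_meas Y] premetric_measurable[OF \<theta>]] by simp
  obtain c where c: "c \<in> couplings (distr M borel (X t)) (P t y)"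
    and c_le: "\<And>g. g \<in> borel_measurable (borel \<Otimes>\<^sub>M borel) \<Longrightarrow> (\<And>z. g z \<le> 1) \<Longrightarrow>
      (\<integral>\<^sup>+z. g z \<partial>c) \<le> (\<integral>\<^sup>+\<omega>. g (X t \<omega>, Y t \<omega>) \<partial>M) + ennreal (dTV (distr M borel (Y t)) (P t y))"
    using total_variation_coupling[OF M X_meas Y borel_distribution_P[OF t]] by blast
  have "wasserstein (trunc_scale N \<theta>) (P t x) (P t y) \<le> (\<integral>\<^sup>+z. ennreal (trunc_scale N \<theta> (fst z) (snd z)) \<partial>c)"
    unfolding wasserstein_def using c X_law by (intro INF_lower) simp
  also have "\<dots> \<le> (\<integral>\<^sup>+\<omega>. ennreal (trunc_scale N \<theta> (X t \<omega>) (Y t \<omega>)) \<partial>M) + ennreal (dTV (distr M borel (Y t)) (P t y))"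
    using c_le[of "\<lambda>z. ennreal (trunc_scale N \<theta> (fst z) (snd z))"] trunc_scale_le_1[of N \<theta>] by simp
  also have "\<dots> \<le> ennreal N * (\<integral>\<^sup>+\<omega>. ennreal (\<theta> (X t \<omega>) (Y t \<omega>)) \<partial>M) + ennreal (L t * \<theta> x y)"
    using N \<theta>_nonneg \<theta>XY TV
    by (subst nn_integral_cmult[symmetric])
       (auto intro!: add_mono nn_integral_mono ennreal_leI simp: trunc_scale_def simp flip: ennreal_mult)
  also have "\<dots> \<le> ennreal N * ennreal (r t * \<theta> x y) + ennreal (L t * \<theta> x y)"
    by (intro add_right_mono mult_left_mono XY) auto
  also have "\<dots> = ennreal ((N * r t + L t) * \<theta> x y)"
    using rL N \<theta>_nonneg[of x y] by (simp add: algebra_simps flip: ennreal_mult ennreal_plus)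
  finally show ?thesis
    using wasserstein_le_1[OF borel_distribution_P[OF t] borel_distribution_P[OF t], of "trunc_scale N \<theta>" x y]
      trunc_scale_le_1[of N \<theta>]
    by (simp add: trunc_scale_def[of "N * r t + L t"] min_def)
qed

lemma wasserstein_small_set:
  assumes B1: "assumption_B1 P \<theta> S t" and t: "0 \<le> t" and N: "0 < N"
  obtains \<kappa> where "0 < \<kappa>" "\<kappa> < 1"
    "\<And>x y. x \<in> S \<Longrightarrow> y \<in> S \<Longrightarrow> wasserstein (trunc_scale N \<theta>) (P t x) (P t y) \<le> ennreal (1 - \<kappa>)"
proof -
  obtain D m where D: "D \<in> sets borel" and m: "m > 0" "\<And>x. x \<in> S \<Longrightarrow> measure (P t x) D \<ge> m"
    and small: "\<And>x y. x \<in> D \<Longrightarrow> y \<in> D \<Longrightarrow> \<theta> x y \<le> 1 / (2 * N)"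
    using B1[unfolded assumption_B1_def, rule_format, of "1 / (2 * N)"] N by auto
  define \<kappa> where "\<kappa> = (min m 1)\<^sup>2 / 2"
  have \<kappa>: "0 < \<kappa>" "\<kappa> < 1" using m power_le_one[of "min m 1" 2] by (auto simp: \<kappa>_def)
  have "trunc_scale N \<theta> u v \<le> 1 / 2" if "u \<in> D" "v \<in> D" for u v
    using small[OF that] N by (simp add: trunc_scale_def field_simps)
  then have half: "wasserstein (trunc_scale N \<theta>) (P t x) (P t y)
      \<le> ennreal (1 - measure (P t x) D * measure (P t y) D / 2)" for x y
    by (intro wasserstein_le_product_set borel_distribution_P t D trunc_scale_le_1)
  have "wasserstein (trunc_scale N \<theta>) (P t x) (P t y) \<le> ennreal (1 - \<kappa>)" if xy: "x \<in> S" "y \<in> S" for x y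
  proof -
    have "min m 1 * min m 1 \<le> measure (P t x) D * measure (P t y) D"
      using m(1) m(2)[OF xy(1)] m(2)[OF xy(2)] by (intro mult_mono) auto
    then show ?thesis
      by (intro order_trans[OF half] ennreal_leI) (simp add: \<kappa>_def power2_eq_square)
  qed
  with \<kappa> show ?thesis by (rule that)
qed

lemma contraction_scale_exists:
  assumes A: "assumption_A TYPE('w) P \<theta> r L" and t: "0 \<le> t"
  obtains N T where "1 \<le> N" "0 \<le> T" "(N * r T + L T + 1) * r t + L t \<le> N / 2"
proof -
  have r: "\<And>s. s \<ge> 0 \<Longrightarrow> r s \<ge> 0" "(r \<longlongrightarrow> 0) at_top" and L: "\<And>s. s \<ge> 0 \<Longrightarrow> L s \<ge> 0"
    using A by (auto simp: assumption_A_def)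
  have "((\<lambda>T. r T * r t) \<longlongrightarrow> 0) at_top" using tendsto_mult_left_zero[OF r(2)] .
  then have "eventually (\<lambda>T. r T * r t < 1 / 4 \<and> 0 \<le> T) at_top"
    by (intro eventually_conj order_tendstoD(2) eventually_ge_at_top) auto
  then obtain T where T: "r T * r t < 1 / 4" "0 \<le> T" by (auto dest: eventually_happens)
  define N where "N = 1 + 4 * ((L T + 1) * r t + L t)"
  have N: "1 \<le> N" using L[OF T(2)] L[OF t] r(1)[OF t] by (simp add: N_def)
  have "N * (r T * r t) \<le> N * (1 / 4)" using T(1) N by (intro mult_left_mono) auto
  then have "(N * r T + L T + 1) * r t + L t \<le> N / 2"
    by (simp add: algebra_simps) (simp add: N_def algebra_simps)
  then show ?thesis by (rule that[OF N T(2)])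
qed

text \<open>The two-step skeleton \<open>t0 + T\<close> is needed since Assumption A contracts \<open>trunc_scale N \<theta>\<close> only
  up to the error \<open>L\<close>, which a large \<open>N\<close> absorbs once \<open>r T\<close> is small.\<close>
lemma osc_contracting_skeleton:
  fixes V :: "'a \<Rightarrow> real"
  assumes A: "assumption_A TYPE('w) P \<theta> r L" and \<theta>: "premetric \<theta>" and t0: "0 \<le> t0"
    and B1: "\<And>M. M > 0 \<Longrightarrow> assumption_B1 P \<theta> {x. V x \<le> M} t0"
  obtains N T where "1 \<le> N" "0 \<le> T"
    "\<And>x y. osc_contracting (t0 + T) (trunc_scale N \<theta>) (trunc_scale (N / 2) \<theta> x y) x y"
    "\<And>M. 0 < M \<Longrightarrow> \<exists>\<kappa>. 0 < \<kappa> \<and> \<kappa> < 1 \<and>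
      (\<forall>x y. V x \<le> M \<longrightarrow> V y \<le> M \<longrightarrow> osc_contracting (t0 + T) (trunc_scale N \<theta>) (1 - \<kappa>) x y)"
proof -
  obtain N T where N: "1 \<le> N" and T: "0 \<le> T" and "(N * r T + L T + 1) * r t0 + L t0 \<le> N / 2"
    by (rule contraction_scale_exists[OF A t0])
  define N' where "N' = N * r T + L T + 1"
  have contraction: "N' * r t0 + L t0 \<le> N / 2" unfolding N'_def by fact
  have N': "0 < N'" using N T A by (simp add: N'_def assumption_A_def add_nonneg_pos)
  have scale: "(\<lambda>z. trunc_scale n \<theta> (fst z) (snd z)) \<in> borel_measurable (borel \<Otimes>\<^sub>M borel)"
    "0 \<le> trunc_scale n \<theta> x y" "trunc_scale n \<theta> x y \<le> 1" if "0 \<le> n" for n x y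
    using that by (auto intro: trunc_scale_measurable[OF \<theta>] trunc_scale_nonneg[OF \<theta>] trunc_scale_le_1)
  have first: "wasserstein (trunc_scale N \<theta>) (P T u) (P T v) \<le> ennreal (trunc_scale N' \<theta> u v)" for u v
    using wasserstein_generalised_coupling[OF A \<theta> T, of N u v] N trunc_scale_mono[OF \<theta>, of "N * r T + L T" N' u v]
    by (auto simp: N'_def intro: order_trans ennreal_leI)
  note two_steps = osc_contracting_add[OF scale[of N] scale[of N'] T first t0]
  show ?thesis
  proof (rule that[OF N T])
    fix x y
    show "osc_contracting (t0 + T) (trunc_scale N \<theta>) (trunc_scale (N / 2) \<theta> x y) x y"
    proof (rule two_steps)
      show "wasserstein (trunc_scale N' \<theta>) (P t0 x) (P t0 y) \<le> ennreal (trunc_scale (N / 2) \<theta> x y)"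
        using wasserstein_generalised_coupling[OF A \<theta> t0, of N' x y] N' trunc_scale_mono[OF \<theta> contraction, of x y]
        by (auto intro: order_trans ennreal_leI)
    qed (use N N' trunc_scale_nonneg[OF \<theta>] in auto)
  next
    fix M :: real assume "0 < M"
    obtain \<kappa> where \<kappa>: "0 < \<kappa>" "\<kappa> < 1" and small: "\<And>x y. x \<in> {x. V x \<le> M} \<Longrightarrow> y \<in> {x. V x \<le> M} \<Longrightarrow>
        wasserstein (trunc_scale N' \<theta>) (P t0 x) (P t0 y) \<le> ennreal (1 - \<kappa>)"
      using wasserstein_small_set[OF B1[OF \<open>0 < M\<close>] t0 N'] by blast
    then have "osc_contracting (t0 + T) (trunc_scale N \<theta>) (1 - \<kappa>) x y" if "V x \<le> M" "V y \<le> M" for x y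
      using that N N' \<kappa> by (intro two_steps) auto
    with \<kappa> show "\<exists>\<kappa>. 0 < \<kappa> \<and> \<kappa> < 1 \<and>
      (\<forall>x y. V x \<le> M \<longrightarrow> V y \<le> M \<longrightarrow> osc_contracting (t0 + T) (trunc_scale N \<theta>) (1 - \<kappa>) x y)" by blast
  qed
qed

end

section \<open>Lyapunov drift of the skeleton chain\<close>

locale rated_semigroup = markov_semigroup P + concave_rate \<phi>
  for P :: "real \<Rightarrow> 'a::polish_space \<Rightarrow> 'a measure" and \<phi> :: "real \<Rightarrow> real"
begin

lemma phi_comp_integrable:
  assumes v: "semigroup_integrable v" and v_nonneg: "\<And>x. 0 \<le> v x"
  shows "semigroup_integrable (\<lambda>y. \<phi> (v y))"
proof (rule semigroup_integrable_affine_bound[OF v])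
  show "(\<lambda>y. \<phi> (v y)) \<in> borel_measurable borel"
    by (rule phi_comp_measurable[OF semigroup_integrableD(1)[OF v] v_nonneg])
  show "\<phi> (v y) \<le> \<phi> 1 + \<phi> 1 * v y" for y
    using phi_linear_growth[OF v_nonneg, of y] by (simp add: distrib_left)
qed (rule phi_nonneg[OF v_nonneg])

end

locale drift_chain = rated_semigroup P \<phi>
  for P :: "real \<Rightarrow> 'a::polish_space \<Rightarrow> 'a measure" and \<phi> :: "real \<Rightarrow> real" +
  fixes h A M K\<^sub>1 \<eta> :: real and v :: "'a \<Rightarrow> real"
  assumes h_pos: "0 < h" and A_ge_1: "1 \<le> A" and M_pos: "0 < M" and K\<^sub>1_pos: "0 < K\<^sub>1" and \<eta>_pos: "0 < \<eta>"
    and K\<^sub>1_le: "K\<^sub>1 \<le> \<eta> / 4 * \<phi> A"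
    and v_integrable: "semigroup_integrable v" and v_ge_A: "\<And>x. A \<le> v x"
    and drift: "\<And>x. expect h v x \<le> v x + K\<^sub>1"
    and drift_above: "\<And>x. M \<le> v x \<Longrightarrow> expect h v x \<le> v x - \<eta> * \<phi> (v x)"

locale lyapunov_semigroup = rated_semigroup P \<phi>
  for P :: "real \<Rightarrow> 'a::polish_space \<Rightarrow> 'a measure" and \<phi> :: "real \<Rightarrow> real" +
  fixes V :: "'a \<Rightarrow> real" and K :: real
  assumes V_measurable: "V \<in> borel_measurable borel" and V_nonneg: "\<And>x. 0 \<le> V x" and K_pos: "0 < K"
    and lyapunov: "\<And>t x. 0 \<le> t \<Longrightarrow>
        (\<integral>\<^sup>+ y. ennreal (V y) \<partial>P t x)
          + (\<integral>\<^sup>+ s\<in>{0..t}. (\<integral>\<^sup>+ y. ennreal (\<phi> (V y)) \<partial>P s x) \<partial>lborel)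
        \<le> ennreal (V x + K * t)"
begin

lemma phi_V_nonneg: "0 \<le> \<phi> (V x)"
  by (rule phi_nonneg[OF V_nonneg])

lemma V_integrable: "semigroup_integrable V"
  unfolding semigroup_integrable_def
proof (intro conjI allI impI)
  fix t x assume t: "0 \<le> (t::real)"
  interpret borel_distribution "P t x" by (rule borel_distribution_P[OF t])
  have "(\<integral>\<^sup>+ y. ennreal (V y) \<partial>P t x) \<le> ennreal (V x + K * t)"
    by (rule order_trans[OF _ lyapunov[OF t]]) simp
  then show "integrable (P t x) V"
    using V_measurable V_nonneg by (intro integrableI_nonneg) (auto intro: le_less_trans)
qed (rule V_measurable)

lemma phi_V_integrable: "semigroup_integrable (\<lambda>y. \<phi> (V y))"
  by (rule phi_comp_integrable[OF V_integrable V_nonneg])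

lemma nn_integral_V: "0 \<le> t \<Longrightarrow> (\<integral>\<^sup>+ y. ennreal (V y) \<partial>P t x) = ennreal (expect t V x)"
  and nn_integral_phi_V: "0 \<le> t \<Longrightarrow> (\<integral>\<^sup>+ y. ennreal (\<phi> (V y)) \<partial>P t x) = ennreal (expect t (\<lambda>y. \<phi> (V y)) x)"
  using semigroup_integrableD(2)[OF V_integrable] semigroup_integrableD(2)[OF phi_V_integrable] V_nonneg phi_V_nonneg
  by (auto intro!: nn_integral_eq_integral)

lemma expect_V_nonneg: "0 \<le> t \<Longrightarrow> 0 \<le> expect t V x"
  and expect_phi_V_nonneg: "0 \<le> t \<Longrightarrow> 0 \<le> expect t (\<lambda>y. \<phi> (V y)) x"
  using expect_ge_const[OF V_integrable] expect_ge_const[OF phi_V_integrable] V_nonneg phi_V_nonneg by auto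

lemma expect_V_le:
  assumes "0 \<le> t"
  shows "expect t V x \<le> V x + K * t"
proof -
  have "ennreal (expect t V x) \<le> ennreal (V x + K * t)"
    unfolding nn_integral_V[OF assms, symmetric] by (rule order_trans[OF _ lyapunov[OF assms]]) simp
  then show ?thesis using V_nonneg[of x] K_pos assms by (subst (asm) ennreal_le_iff) auto
qed

lemma expect_phi_V_le:
  assumes "0 \<le> t"
  shows "expect t (\<lambda>y. \<phi> (V y)) x \<le> \<phi> (V x) + \<phi> (K * t)"
proof (cases "t = 0")
  case True
  then show ?thesis
    using semigroup_integrableD(1)[OF phi_V_integrable] by (simp add: expect_0 zero)
next
  case False
  define u where "u = V x + K * t"
  have u: "0 < u" using False assms K_pos V_nonneg[of x] by (simp add: u_def add_nonneg_pos)
  have "expect t (\<lambda>y. \<phi> (V y)) x \<le> (\<phi> u - deriv \<phi> u * u) + deriv \<phi> u * expect t V x"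
  proof (rule expect_affine_le[OF V_integrable phi_V_integrable _ assms])
    show "\<phi> (V y) \<le> (\<phi> u - deriv \<phi> u * u) + deriv \<phi> u * V y" for y
      using phi_below_tangent[OF V_nonneg u, of y] by (simp add: algebra_simps)
  qed
  also have "\<dots> \<le> (\<phi> u - deriv \<phi> u * u) + deriv \<phi> u * u"
    unfolding u_def[symmetric] using expect_V_le[OF assms, of x] deriv_phi_pos[OF u]
    by (intro add_left_mono mult_left_mono) (auto simp: u_def)
  also have "\<dots> \<le> \<phi> (V x) + \<phi> (K * t)"
    using phi_subadditive[OF V_nonneg, of "K * t" x] assms K_pos by (simp add: u_def)
  finally show ?thesis .
qed

lemma expect_phi_V_quasi_mono:
  assumes "0 \<le> s" "s \<le> t"
  shows "expect t (\<lambda>y. \<phi> (V y)) x \<le> expect s (\<lambda>y. \<phi> (V y)) x + \<phi> (K * t)"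
proof -
  have "expect t (\<lambda>y. \<phi> (V y)) x = expect s (expect (t - s) (\<lambda>y. \<phi> (V y))) x"
    using expect_add_nonneg[OF phi_V_integrable phi_V_nonneg, of "t - s" s x] assms by simp
  also have "\<dots> \<le> \<phi> (K * t) + 1 * expect s (\<lambda>y. \<phi> (V y)) x"
  proof (rule expect_affine_le[OF phi_V_integrable _ _ assms(1)])
    show "semigroup_integrable (expect (t - s) (\<lambda>y. \<phi> (V y)))"
      using assms by (intro semigroup_integrable_expect phi_V_integrable phi_V_nonneg) simp
    show "expect (t - s) (\<lambda>y. \<phi> (V y)) z \<le> \<phi> (K * t) + 1 * \<phi> (V z)" for z
      using expect_phi_V_le[of "t - s" z] phi_mono[of "K * (t - s)" "K * t"] assms K_pos by simp
  qed
  finally show ?thesis by simp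
qed

text \<open>The integrand of the Lyapunov inequality need not be measurable in time, but
  quasi-monotonicity bounds its upper integral from below.\<close>
lemma discrete_drift:
  assumes h: "0 < h"
  shows "expect h V x + h * expect h (\<lambda>y. \<phi> (V y)) x \<le> V x + (K * h + h * \<phi> (K * h))"
proof -
  define G where "G = max 0 (expect h (\<lambda>y. \<phi> (V y)) x - \<phi> (K * h))"
  have "ennreal (G * h) = (\<integral>\<^sup>+ s. ennreal G * indicator {0..h} s \<partial>lborel)"
    using h by (simp add: nn_integral_cmult_indicator ennreal_mult G_def)
  also have "\<dots> \<le> (\<integral>\<^sup>+ s\<in>{0..h}. (\<integral>\<^sup>+ y. ennreal (\<phi> (V y)) \<partial>P s x) \<partial>lborel)"
  proof (rule nn_integral_mono)
    fix s
    have "G \<le> expect s (\<lambda>y. \<phi> (V y)) x" if "0 \<le> s" "s \<le> h"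
      using expect_phi_V_quasi_mono[OF that, of x] expect_phi_V_nonneg[OF that(1), of x]
        phi_mono[of "K * s" "K * h"] that K_pos
      by (simp add: G_def)
    then show "ennreal G * indicator {0..h} s \<le> (\<integral>\<^sup>+ y. ennreal (\<phi> (V y)) \<partial>P s x) * indicator {0..h} s"
      by (auto simp: nn_integral_phi_V ennreal_leI split: split_indicator)
  qed
  finally have "ennreal (expect h V x) + ennreal (G * h) \<le> ennreal (V x + K * h)"
    using lyapunov[of h x] h by (simp add: nn_integral_V) (meson add_left_mono order_trans)
  then have "expect h V x + G * h \<le> V x + K * h"
    using expect_V_nonneg[of h x] h V_nonneg[of x] K_pos by (simp add: ennreal_le_iff G_def flip: ennreal_plus)
  moreover have "(expect h (\<lambda>y. \<phi> (V y)) x - \<phi> (K * h)) * h \<le> G * h"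
    using h by (intro mult_right_mono) (auto simp: G_def)
  ultimately show ?thesis by (simp add: algebra_simps)
qed

definition skeleton_V :: "real \<Rightarrow> real \<Rightarrow> 'a \<Rightarrow> real" where
  "skeleton_V A h x = A + (V x + h * \<phi> (V x))"

context
  fixes h A :: real
  assumes h: "0 < h" and A: "0 \<le> A"
begin

lemma skeleton_V_ge: "A \<le> skeleton_V A h x" "V x \<le> skeleton_V A h x"
  using h A V_nonneg[of x] phi_V_nonneg[of x] by (auto simp: skeleton_V_def)

lemma phi_skeleton_V_le:
  "\<phi> (skeleton_V A h x) \<le> (\<phi> A + \<phi> 1) + (1 + h * \<phi> 1) * \<phi> (V x)"
proof -
  have "\<phi> (skeleton_V A h x) \<le> \<phi> A + (\<phi> (V x) + \<phi> (h * \<phi> (V x)))"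
    unfolding skeleton_V_def using h A V_nonneg[of x] phi_V_nonneg[of x]
    by (intro order_trans[OF phi_subadditive] add_left_mono phi_subadditive) auto
  also have "\<dots> \<le> \<phi> A + (\<phi> (V x) + \<phi> 1 * (1 + h * \<phi> (V x)))"
    using h phi_V_nonneg[of x] by (intro add_left_mono phi_linear_growth) auto
  finally show ?thesis by (simp add: algebra_simps)
qed

lemma skeleton_V_integrable: "semigroup_integrable (skeleton_V A h)"
proof (rule semigroup_integrable_affine_bound[OF V_integrable])
  show "skeleton_V A h y \<le> (A + h * \<phi> 1) + (1 + h * \<phi> 1) * V y" for y
    using mult_left_mono[OF phi_linear_growth[OF V_nonneg], of h y] h by (simp add: skeleton_V_def algebra_simps)
  show "0 \<le> skeleton_V A h y" for y using skeleton_V_ge(1)[of y] A by simp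
  show "skeleton_V A h \<in> borel_measurable borel"
    unfolding skeleton_V_def[abs_def] using semigroup_integrableD(1) V_integrable phi_V_integrable by measurable
qed

lemma expect_skeleton_V_le: "expect h (skeleton_V A h) x \<le> A + (V x + (K * h + h * \<phi> (K * h)))"
proof -
  interpret borel_distribution "P h x" using h by (intro borel_distribution_P) simp
  have "integrable (P h x) V" "integrable (P h x) (\<lambda>y. \<phi> (V y))"
    using h semigroup_integrableD(2)[OF V_integrable] semigroup_integrableD(2)[OF phi_V_integrable] by auto
  then have "expect h (skeleton_V A h) x = A + (expect h V x + h * expect h (\<lambda>y. \<phi> (V y)) x)"
    by (simp add: skeleton_V_def)
  then show ?thesis using discrete_drift[OF h, of x] by simp
qed

lemma expect_phi_skeleton_V_le:
  obtains a where "0 < a" "\<And>s x. 0 \<le> s \<Longrightarrow> s \<le> h \<Longrightarrow> expect s (\<lambda>y. \<phi> (skeleton_V A h y)) x \<le> a * (1 + \<phi> (V x))"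
proof -
  define b where "b = 1 + h * \<phi> 1"
  define a where "a = \<phi> A + \<phi> 1 + b * (1 + \<phi> (K * h))"
  have b: "1 \<le> b" using h phi_nonneg[of 1] by (simp add: b_def)
  have "0 \<le> \<phi> A" "0 \<le> \<phi> 1" "0 \<le> \<phi> (K * h)" using A h K_pos by (auto intro: phi_nonneg)
  then have a: "b \<le> a" "\<phi> A + \<phi> 1 + b * \<phi> (K * h) \<le> a" using b by (auto simp: a_def distrib_left)
  show ?thesis
  proof (rule that)
    show "0 < a" using a(1) b by simp
    fix s x assume s: "0 \<le> s" "s \<le> h"
    have phi_integrable: "semigroup_integrable (\<lambda>y. \<phi> (skeleton_V A h y))"
      using A skeleton_V_ge(1) by (intro phi_comp_integrable[OF skeleton_V_integrable]) (rule order_trans)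
    have "expect s (\<lambda>y. \<phi> (skeleton_V A h y)) x \<le> (\<phi> A + \<phi> 1) + b * expect s (\<lambda>y. \<phi> (V y)) x"
      using phi_skeleton_V_le by (intro expect_affine_le phi_V_integrable phi_integrable s) (simp add: b_def)
    also have "\<dots> \<le> (\<phi> A + \<phi> 1) + b * (\<phi> (V x) + \<phi> (K * h))"
      using expect_phi_V_le[OF s(1), of x] phi_mono[of "K * s" "K * h"] s K_pos b
      by (intro add_left_mono mult_left_mono) (auto intro: order_trans)
    also have "\<dots> \<le> a * (1 + \<phi> (V x))"
      using a mult_right_mono[OF a(1) phi_V_nonneg[of x]] by (simp add: distrib_left)
    finally show "expect s (\<lambda>y. \<phi> (skeleton_V A h y)) x \<le> a * (1 + \<phi> (V x))" .
  qed
qed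

end

lemma skeleton_V_large:
  fixes \<eta> :: real
  assumes h: "0 < h" and A: "0 \<le> A" and \<eta>: "0 \<le> \<eta>" "\<eta> * (1 + h * \<phi> 1) = h / 2"
  obtains M where "A < M" "\<And>x. M \<le> skeleton_V A h x \<Longrightarrow> b + \<eta> * \<phi> (skeleton_V A h x) \<le> h * \<phi> (V x)"
proof -
  obtain z where z: "z > 0" "\<phi> z > 2 * (b + \<eta> * (\<phi> A + \<phi> 1)) / h" using phi_exceeds by blast
  show ?thesis
  proof (rule that)
    show "A < A + (z + h * \<phi> z)" using z h phi_nonneg[of z] by (simp add: add_pos_nonneg)
    fix x assume large: "A + (z + h * \<phi> z) \<le> skeleton_V A h x"
    have "z \<le> V x"
    proof (rule ccontr)
      assume "\<not> z \<le> V x"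
      then have "V x < z" "h * \<phi> (V x) \<le> h * \<phi> z"
        using V_nonneg[of x] h by (auto intro!: phi_mono)
      with large show False by (simp add: skeleton_V_def)
    qed
    then have "\<phi> z \<le> \<phi> (V x)" using z by (intro phi_mono) auto
    then have "2 * (b + \<eta> * (\<phi> A + \<phi> 1)) / h \<le> \<phi> (V x)" using z(2) by linarith
    then have "b + \<eta> * (\<phi> A + \<phi> 1) \<le> h * \<phi> (V x) / 2" using h by (simp add: field_simps)
    moreover have "\<eta> * \<phi> (skeleton_V A h x) \<le> \<eta> * ((\<phi> A + \<phi> 1) + (1 + h * \<phi> 1) * \<phi> (V x))"
      using phi_skeleton_V_le[OF h A, of x] \<eta>(1) by (intro mult_left_mono)
    moreover have "\<eta> * ((1 + h * \<phi> 1) * \<phi> (V x)) = h * \<phi> (V x) / 2" unfolding mult.assoc[symmetric] \<eta>(2) by simp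
    ultimately show "b + \<eta> * \<phi> (skeleton_V A h x) \<le> h * \<phi> (V x)"
      unfolding distrib_left[of \<eta> "\<phi> A + \<phi> 1"] by linarith
  qed
qed

lemma drift_chain_exists:
  assumes h: "0 < h"
  obtains A M K\<^sub>1 \<eta> where "drift_chain P \<phi> h A M K\<^sub>1 \<eta> (skeleton_V A h)"
proof -
  define K\<^sub>1 where "K\<^sub>1 = K * h + h * \<phi> (K * h)"
  define b where "b = 1 + h * \<phi> 1"
  define \<eta> where "\<eta> = h / (2 * b)"
  have K\<^sub>1: "0 < K\<^sub>1" using h K_pos phi_nonneg[of "K * h"] by (simp add: K\<^sub>1_def add_pos_nonneg)
  have "0 < b" using h phi_nonneg[of 1] by (simp add: b_def add_pos_nonneg)
  then have \<eta>: "0 < \<eta>" "\<eta> * b = h / 2" using h by (simp_all add: \<eta>_def)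
  obtain A where A: "A > 1" "\<phi> A > 4 * K\<^sub>1 / \<eta>" using phi_exceeds by blast
  obtain M where M: "A < M" and V_large: "\<And>x. M \<le> skeleton_V A h x \<Longrightarrow> K\<^sub>1 + \<eta> * \<phi> (skeleton_V A h x) \<le> h * \<phi> (V x)"
    using skeleton_V_large[OF h _ _ \<eta>(2)[unfolded b_def], of A K\<^sub>1] A(1) \<eta>(1) by auto
  have "drift_chain P \<phi> h A M K\<^sub>1 \<eta> (skeleton_V A h)"
  proof unfold_locales
    show "0 < M" using A M by simp
    show "K\<^sub>1 \<le> \<eta> / 4 * \<phi> A" using A \<eta>(1) by (simp add: field_simps)
    have expect_skeleton: "expect h (skeleton_V A h) x \<le> A + (V x + K\<^sub>1)" for x
      using expect_skeleton_V_le[OF h, of A x] A by (simp add: K\<^sub>1_def)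
    have skeleton: "skeleton_V A h x = A + (V x + h * \<phi> (V x))" "0 \<le> h * \<phi> (V x)" for x
      using h phi_V_nonneg by (auto simp: skeleton_V_def)
    show "expect h (skeleton_V A h) x \<le> skeleton_V A h x + K\<^sub>1" for x
      using expect_skeleton[of x] skeleton[of x] by linarith
    show "expect h (skeleton_V A h) x \<le> skeleton_V A h x - \<eta> * \<phi> (skeleton_V A h x)" if "M \<le> skeleton_V A h x" for x
      using expect_skeleton[of x] skeleton(1)[of x] V_large[OF that] by linarith
  qed (use h A K\<^sub>1 \<eta> skeleton_V_ge skeleton_V_integrable in auto)
  then show ?thesis by (rule that)
qed

end

section \<open>Weighted contraction of the skeleton chain\<close>

context drift_chain
begin

abbreviation skeleton :: "nat \<Rightarrow> 'a \<Rightarrow> 'a measure" where "skeleton n \<equiv> P (real n * h)"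

lemma v_ge_1: "1 \<le> v x"
  using v_ge_A[of x] A_ge_1 by simp

lemma v_nonneg: "0 \<le> v x"
  using v_ge_1[of x] by simp

lemma phi_v_pos: "0 < \<phi> (v x)"
  using v_ge_1[of x] by (intro phi_pos) simp

lemma v_measurable [measurable]: "v \<in> borel_measurable borel"
  using semigroup_integrableD(1)[OF v_integrable] .

lemma K\<^sub>1_le_phi_v: "K\<^sub>1 \<le> \<eta> / 4 * \<phi> (v x)"
proof -
  have "\<eta> / 4 * \<phi> A \<le> \<eta> / 4 * \<phi> (v x)"
    using \<eta>_pos A_ge_1 v_ge_A by (intro mult_left_mono phi_mono) auto
  then show ?thesis using K\<^sub>1_le by linarith
qed

definition lyap_weight :: "real \<Rightarrow> real \<Rightarrow> real \<Rightarrow> nat \<Rightarrow> 'a \<Rightarrow> real" where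
  "lyap_weight \<gamma> l s n x = (1 - \<eta> / 4 * l) ^ n * exp_weight l s (v x) + (\<gamma> + v x) / s"

context
  fixes \<gamma> l s :: real
  assumes \<gamma>: "0 < \<gamma>" and l: "0 < l" "l \<le> deriv \<phi> s" "\<eta> / 4 * l < 1" and s: "1 \<le> s"
begin

lemma decay_factor_nonneg: "0 \<le> (1 - \<eta> / 4 * l) ^ n"
  using l(3) by simp

lemma exp_weight_v_ge_1: "1 \<le> exp_weight l s (v x)"
  using l s v_ge_1 by (intro exp_weight_ge_1) auto

lemma lyap_weight_ge: "(\<gamma> + v x) / s \<le> lyap_weight \<gamma> l s n x"
  unfolding lyap_weight_def using decay_factor_nonneg[of n] exp_weight_v_ge_1[of x] by simp

lemma lyap_weight_below_tangent:
  fixes u :: real and n :: nat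
  assumes "1 \<le> u" "u \<le> s"
  defines "w \<equiv> (1 - \<eta> / 4 * l) ^ n * (l * exp_weight l s u / \<phi> u)"
  shows "lyap_weight \<gamma> l s n y \<le> ((1 - \<eta> / 4 * l) ^ n * exp_weight l s u - w * u + \<gamma> / s) + (w + 1 / s) * v y"
proof -
  have "(1 - \<eta> / 4 * l) ^ n * exp_weight l s (v y)
      \<le> (1 - \<eta> / 4 * l) ^ n * (exp_weight l s u + l * exp_weight l s u / \<phi> u * (v y - u))"
    using l s assms v_ge_1 decay_factor_nonneg by (intro mult_left_mono exp_weight_below_tangent) auto
  then show ?thesis by (simp add: lyap_weight_def w_def algebra_simps add_divide_distrib diff_divide_distrib)
qed

lemma lyap_weight_weight: "weight (lyap_weight \<gamma> l s n)"
proof -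
  have lower: "1 / s \<le> lyap_weight \<gamma> l s n x" for x
    using \<gamma> s v_ge_1[of x] by (intro order_trans[OF _ lyap_weight_ge] divide_right_mono) auto
  have "semigroup_integrable (lyap_weight \<gamma> l s n)"
  proof (rule semigroup_integrable_affine_bound[OF v_integrable])
    have [measurable]: "(\<lambda>x. exp_weight l s (v x)) \<in> borel_measurable borel"
      using l s by (intro exp_weight_comp_measurable v_ge_1) auto
    show "lyap_weight \<gamma> l s n \<in> borel_measurable borel" unfolding lyap_weight_def by measurable
    show "0 \<le> lyap_weight \<gamma> l s n y" for y using s by (intro order_trans[OF _ lower]) auto
  qed (rule lyap_weight_below_tangent[OF s order_refl])
  moreover have "0 < 1 / s" using s by simp
  ultimately show ?thesis using lower unfolding weight_def by blast
qed

lemma expect_lyap_weight_le: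
  assumes "1 \<le> u" "u \<le> s"
  shows "expect h (lyap_weight \<gamma> l s n) x
    \<le> (1 - \<eta> / 4 * l) ^ n * (exp_weight l s u + l * exp_weight l s u / \<phi> u * (expect h v x - u)) +
        (\<gamma> + expect h v x) / s"
proof -
  define w where "w = (1 - \<eta> / 4 * l) ^ n * (l * exp_weight l s u / \<phi> u)"
  have "expect h (lyap_weight \<gamma> l s n) x
      \<le> ((1 - \<eta> / 4 * l) ^ n * exp_weight l s u - w * u + \<gamma> / s) + (w + 1 / s) * expect h v x"
    using h_pos lyap_weight_weight lyap_weight_below_tangent[OF assms]
    by (intro expect_affine_le v_integrable) (auto simp: weight_def w_def)
  also have "\<dots> = (1 - \<eta> / 4 * l) ^ n * (exp_weight l s u + l * exp_weight l s u / \<phi> u * (expect h v x - u))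
      + (\<gamma> + expect h v x) / s"
    by (simp add: w_def algebra_simps add_divide_distrib diff_divide_distrib)
  finally show ?thesis .
qed

lemma expect_lyap_weight_growth:
  "expect h (lyap_weight \<gamma> l s n) x
    \<le> (1 - \<eta> / 4 * l) ^ n * ((1 + \<eta> / 4 * l) * exp_weight l s (v x)) + (\<gamma> + (v x + K\<^sub>1)) / s"
proof (cases "v x \<le> s")
  case True
  have "l * exp_weight l s (v x) / \<phi> (v x) * (expect h v x - v x)
      \<le> l * exp_weight l s (v x) / \<phi> (v x) * (\<eta> / 4 * \<phi> (v x))"
    using l phi_v_pos[of x] exp_weight_v_ge_1[of x] drift[of x] K\<^sub>1_le_phi_v[of x]
    by (intro mult_left_mono) auto
  then have "exp_weight l s (v x) + l * exp_weight l s (v x) / \<phi> (v x) * (expect h v x - v x)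
      \<le> (1 + \<eta> / 4 * l) * exp_weight l s (v x)"
    using phi_v_pos[of x] by (simp add: algebra_simps)
  then show ?thesis
    using s drift[of x] decay_factor_nonneg[of n]
    by (intro order_trans[OF expect_lyap_weight_le[OF v_ge_1 True]] add_mono mult_left_mono divide_right_mono) auto
next
  case False
  have "lyap_weight \<gamma> l s n y \<le> ((1 - \<eta> / 4 * l) ^ n * exp_weight l s (v x) + \<gamma> / s) + 1 / s * v y" for y
    using l s False v_ge_1 decay_factor_nonneg[of n] exp_weight_le_truncated[of l s "v y" "v x"]
    by (simp add: lyap_weight_def add_divide_distrib mult_left_mono)
  then have "expect h (lyap_weight \<gamma> l s n) x
      \<le> ((1 - \<eta> / 4 * l) ^ n * exp_weight l s (v x) + \<gamma> / s) + 1 / s * expect h v x"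
    using h_pos lyap_weight_weight by (intro expect_affine_le v_integrable) (auto simp: weight_def)
  also have "\<dots> = (1 - \<eta> / 4 * l) ^ n * exp_weight l s (v x) + (\<gamma> + expect h v x) / s"
    by (simp add: add_divide_distrib)
  also have "\<dots> \<le> (1 - \<eta> / 4 * l) ^ n * ((1 + \<eta> / 4 * l) * exp_weight l s (v x)) + (\<gamma> + (v x + K\<^sub>1)) / s"
    using l \<eta>_pos s drift[of x] exp_weight_v_ge_1[of x] decay_factor_nonneg[of n]
    by (intro add_mono mult_left_mono divide_right_mono) auto
  finally show ?thesis .
qed

lemma expect_lyap_weight_decay:
  assumes "M \<le> v x" "v x \<le> s"
  shows "expect h (lyap_weight \<gamma> l s n) x
    \<le> (1 - \<eta> / 4 * l) ^ n * ((1 - \<eta> * l) * exp_weight l s (v x)) + (\<gamma> + (v x - \<eta> * \<phi> (v x))) / s"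
proof -
  have "l * exp_weight l s (v x) / \<phi> (v x) * (expect h v x - v x)
      \<le> l * exp_weight l s (v x) / \<phi> (v x) * (- \<eta> * \<phi> (v x))"
    using l phi_v_pos[of x] exp_weight_v_ge_1[of x] drift_above[OF assms(1)] by (intro mult_left_mono) auto
  then have "exp_weight l s (v x) + l * exp_weight l s (v x) / \<phi> (v x) * (expect h v x - v x)
      \<le> (1 - \<eta> * l) * exp_weight l s (v x)"
    using phi_v_pos[of x] by (simp add: algebra_simps)
  then show ?thesis
    using s drift_above[OF assms(1)] decay_factor_nonneg[of n]
    by (intro order_trans[OF expect_lyap_weight_le[OF v_ge_1 assms(2)]] add_mono mult_left_mono divide_right_mono) auto
qed

lemma expect_lyap_weight_growth_factor:
  assumes \<Lambda>: "K\<^sub>1 \<le> (\<Lambda> - 1) * \<gamma>" "1 + \<eta> / 4 * l \<le> \<Lambda> * (1 - \<eta> / 4 * l)"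
  shows "expect h (lyap_weight \<gamma> l s n) x \<le> \<Lambda> * lyap_weight \<gamma> l s (Suc n) x"
proof -
  have "0 < (\<Lambda> - 1) * \<gamma>" using \<Lambda>(1) K\<^sub>1_pos by simp
  then have "1 < \<Lambda>" using \<gamma> by (simp add: zero_less_mult_iff)
  then have "(\<Lambda> - 1) * \<gamma> \<le> (\<Lambda> - 1) * (\<gamma> + v x)" using v_ge_1[of x] by (intro mult_left_mono) auto
  then have "\<gamma> + (v x + K\<^sub>1) \<le> \<Lambda> * (\<gamma> + v x)" using \<Lambda>(1) by (simp add: algebra_simps)
  then have "(\<gamma> + (v x + K\<^sub>1)) / s \<le> \<Lambda> * (\<gamma> + v x) / s" using s by (intro divide_right_mono) auto
  moreover have "(1 - \<eta> / 4 * l) ^ n * ((1 + \<eta> / 4 * l) * exp_weight l s (v x))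
      \<le> (1 - \<eta> / 4 * l) ^ n * (\<Lambda> * (1 - \<eta> / 4 * l) * exp_weight l s (v x))"
    using \<Lambda>(2) exp_weight_v_ge_1[of x] decay_factor_nonneg[of n] by (intro mult_left_mono mult_right_mono) auto
  ultimately show ?thesis
    using expect_lyap_weight_growth[where n=n and x=x] by (simp add: lyap_weight_def distrib_left mult_ac)
qed

text \<open>The drift at the higher of two points pays for the possible growth at the lower one.\<close>
lemma expect_lyap_weight_pair_decay:
  assumes "M \<le> v x" "v x \<le> s" "v y \<le> v x"
  shows "expect h (lyap_weight \<gamma> l s n) x + expect h (lyap_weight \<gamma> l s n) y
    \<le> lyap_weight \<gamma> l s (Suc n) x + lyap_weight \<gamma> l s (Suc n) y"
proof -
  define b where "b = (1 - \<eta> / 4 * l) ^ n"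
  define X where "X = exp_weight l s (v x)"
  define Y where "Y = exp_weight l s (v y)"
  have "Y \<le> X" "0 \<le> X"
    using assms l s v_ge_1 exp_weight_v_ge_1[of x] by (auto simp: X_def Y_def intro!: exp_weight_mono)
  then have "\<eta> * l * Y \<le> \<eta> * l * X" "0 \<le> \<eta> * l * X" using l \<eta>_pos by (auto intro!: mult_left_mono)
  then have "(1 - \<eta> * l) * X + (1 + \<eta> / 4 * l) * Y \<le> (1 - \<eta> / 4 * l) * (X + Y)"
    by (simp add: algebra_simps add_divide_distrib)
  then have exp_part: "b * ((1 - \<eta> * l) * X + (1 + \<eta> / 4 * l) * Y) \<le> b * ((1 - \<eta> / 4 * l) * (X + Y))"
    using decay_factor_nonneg by (intro mult_left_mono) (auto simp: b_def)
  have "0 < \<eta> * \<phi> (v x)" using phi_v_pos[of x] \<eta>_pos by simp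
  then have "K\<^sub>1 \<le> \<eta> * \<phi> (v x)" using K\<^sub>1_le_phi_v[of x] by linarith
  then have "(\<gamma> + (v x - \<eta> * \<phi> (v x))) / s + (\<gamma> + (v y + K\<^sub>1)) / s \<le> (\<gamma> + v x) / s + (\<gamma> + v y) / s"
    using s by (simp add: add_divide_distrib[symmetric] divide_right_mono)
  moreover have "expect h (lyap_weight \<gamma> l s n) x \<le> b * ((1 - \<eta> * l) * X) + (\<gamma> + (v x - \<eta> * \<phi> (v x))) / s"
    unfolding b_def X_def by (rule expect_lyap_weight_decay[OF assms(1,2)])
  moreover have "expect h (lyap_weight \<gamma> l s n) y \<le> b * ((1 + \<eta> / 4 * l) * Y) + (\<gamma> + (v y + K\<^sub>1)) / s"
    unfolding b_def Y_def by (rule expect_lyap_weight_growth)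
  moreover have "lyap_weight \<gamma> l s (Suc n) x + lyap_weight \<gamma> l s (Suc n) y
      = b * ((1 - \<eta> / 4 * l) * (X + Y)) + ((\<gamma> + v x) / s + (\<gamma> + v y) / s)"
    by (simp add: lyap_weight_def b_def X_def Y_def distrib_left mult_ac)
  ultimately show ?thesis using exp_part unfolding distrib_left[of b "(1 - \<eta> * l) * X"] by linarith
qed

end

end

locale harris_chain = drift_chain P \<phi> h A M K\<^sub>1 \<eta> v
  for P :: "real \<Rightarrow> 'a::polish_space \<Rightarrow> 'a measure" and \<phi> h A M K\<^sub>1 \<eta> v +
  fixes \<theta> :: "'a \<Rightarrow> 'a \<Rightarrow> real" and N \<kappa> :: real
  assumes \<theta>_premetric: "premetric \<theta>" and trunc_dist_le_\<theta>: "\<And>x y. trunc_dist x y \<le> \<theta> x y"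
    and N_ge_1: "1 \<le> N" and \<kappa>: "0 < \<kappa>" "\<kappa> < 1"
    and local_contraction: "\<And>x y. osc_contracting h (trunc_scale N \<theta>) (trunc_scale (N / 2) \<theta> x y) x y"
    and small_set: "\<And>x y. v x \<le> M \<Longrightarrow> v y \<le> M \<Longrightarrow> osc_contracting h (trunc_scale N \<theta>) (1 - \<kappa>) x y"
begin

lemma trunc_scale_powr_le_1:
  assumes "0 \<le> n" "0 \<le> p"
  shows "trunc_scale n \<theta> x y powr p \<le> 1"
  using assms trunc_scale_nonneg[OF \<theta>_premetric] by (intro powr_le1) (auto simp: trunc_scale_le_1)

context
  fixes q \<gamma> l s \<Lambda> :: real
  assumes q: "0 < q" "q < 1" and \<gamma>: "0 < \<gamma>"
    and l: "0 < l" "l \<le> deriv \<phi> s" "\<eta> / 4 * l < 1" and s: "1 \<le> s"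
    and \<Lambda>: "K\<^sub>1 \<le> (\<Lambda> - 1) * \<gamma>" "1 + \<eta> / 4 * l \<le> \<Lambda> * (1 - \<eta> / 4 * l)"
      "\<Lambda> powr q \<le> 2 powr (1 - q)" "(1 - \<kappa>) powr (1 - q) * \<Lambda> powr q \<le> 1"
begin

lemma lyap_weight_pos: "0 < lyap_weight \<gamma> l s n x"
  by (rule weight_pos[OF lyap_weight_weight[OF \<gamma> l s]])

lemma osc_bound_lyap_weight_0:
  assumes f: "trunc_Lipschitz f"
  shows "osc_bound (trunc_scale N \<theta>) q (lyap_weight \<gamma> l s 0) f"
  unfolding osc_bound_def
proof (intro conjI allI trunc_Lipschitz_measurable trunc_Lipschitz_bounded f)
  fix x y
  define d where "d = trunc_scale N \<theta> x y"
  have d: "0 \<le> d" "d \<le> 1"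
    using N_ge_1 trunc_scale_nonneg[OF \<theta>_premetric] by (auto simp: d_def trunc_scale_le_1)
  have "\<theta> x y \<le> N * \<theta> x y" using mult_right_mono[OF N_ge_1 premetric_nonneg[OF \<theta>_premetric]] by simp
  then have "\<bar>f x - f y\<bar> \<le> d"
    using trunc_Lipschitz_abs_diff[OF f, of x y] trunc_dist_le_\<theta>[of x y] trunc_Lipschitz_abs_diff_le_1[OF f, of x y]
    by (auto simp: d_def trunc_scale_def)
  also have "d \<le> d powr (1 - q)"
  proof (cases "d = 0")
    case False
    then show ?thesis using powr_mono'[of "1 - q" 1 d] d q by simp
  qed simp
  also have "\<dots> \<le> d powr (1 - q) * (lyap_weight \<gamma> l s 0 x + lyap_weight \<gamma> l s 0 y) powr q"
  proof -
    have "0 \<le> (\<gamma> + v x) / s" using \<gamma> s v_ge_1[of x] by simp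
    then have "1 \<le> lyap_weight \<gamma> l s 0 x + lyap_weight \<gamma> l s 0 y"
      using exp_weight_v_ge_1[OF \<gamma> l s, of x] lyap_weight_pos[of 0 y] by (simp add: lyap_weight_def)
    then have "1 \<le> (lyap_weight \<gamma> l s 0 x + lyap_weight \<gamma> l s 0 y) powr q" using q by (intro ge_one_powr_ge_zero) auto
    then show ?thesis by (simp add: mult_le_cancel_left1)
  qed
  finally show "\<bar>f x - f y\<bar>
      \<le> trunc_scale N \<theta> x y powr (1 - q) * (lyap_weight \<gamma> l s 0 x + lyap_weight \<gamma> l s 0 y) powr q"
    by (simp add: d_def)
qed

context
  fixes n :: nat and g :: "'a \<Rightarrow> real"
  assumes g: "osc_bound (trunc_scale N \<theta>) q (lyap_weight \<gamma> l s n) g"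
begin

lemma osc_step_growth:
  assumes "osc_contracting h (trunc_scale N \<theta>) a x y" "0 \<le> a"
  shows "\<bar>expect h g x - expect h g y\<bar>
    \<le> a powr (1 - q) * \<Lambda> powr q * (lyap_weight \<gamma> l s (Suc n) x + lyap_weight \<gamma> l s (Suc n) y) powr q"
proof -
  define S where "S = lyap_weight \<gamma> l s (Suc n) x + lyap_weight \<gamma> l s (Suc n) y"
  note weight = lyap_weight_weight[OF \<gamma> l s, of n]
  have S: "0 < S" using lyap_weight_pos by (simp add: S_def add_pos_pos)
  have sum: "0 < expect h (lyap_weight \<gamma> l s n) x + expect h (lyap_weight \<gamma> l s n) y"
    using weight_pos[OF weight_expect[OF weight]] h_pos by (simp add: add_pos_pos)
  have growth: "expect h (lyap_weight \<gamma> l s n) x + expect h (lyap_weight \<gamma> l s n) y \<le> \<Lambda> * S"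
    unfolding S_def distrib_left by (intro add_mono expect_lyap_weight_growth_factor[OF \<gamma> l s \<Lambda>(1,2)])
  then have \<Lambda>_pos: "0 < \<Lambda>" using S sum by (smt (verit) zero_less_mult_pos2)
  have "\<bar>expect h g x - expect h g y\<bar>
      \<le> a powr (1 - q) * (expect h (lyap_weight \<gamma> l s n) x + expect h (lyap_weight \<gamma> l s n) y) powr q"
    using assms(1) weight g q by (auto simp: osc_contracting_def)
  also have "\<dots> \<le> a powr (1 - q) * (\<Lambda> * S) powr q"
    using q sum growth by (intro mult_left_mono powr_mono2) auto
  finally show ?thesis using S \<Lambda>_pos by (simp add: powr_mult S_def mult.assoc)
qed

lemma osc_step_near:
  assumes "N * \<theta> x y < 1"
  shows "\<bar>expect h g x - expect h g y\<bar>
    \<le> trunc_scale N \<theta> x y powr (1 - q) * (lyap_weight \<gamma> l s (Suc n) x + lyap_weight \<gamma> l s (Suc n) y) powr q"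
proof -
  have scale: "trunc_scale (N / 2) \<theta> x y = trunc_scale N \<theta> x y / 2" "0 \<le> trunc_scale N \<theta> x y"
    using assms N_ge_1 premetric_nonneg[OF \<theta>_premetric, of x y] by (auto simp: trunc_scale_def)
  have "(trunc_scale N \<theta> x y / 2) powr (1 - q) * \<Lambda> powr q
      = trunc_scale N \<theta> x y powr (1 - q) * (\<Lambda> powr q / 2 powr (1 - q))"
    using scale(2) by (simp add: powr_divide)
  also have "\<dots> \<le> trunc_scale N \<theta> x y powr (1 - q) * 1"
    using \<Lambda>(3) by (intro mult_left_mono) (auto simp: divide_le_eq)
  finally have halved: "(trunc_scale N \<theta> x y / 2) powr (1 - q) * \<Lambda> powr q \<le> trunc_scale N \<theta> x y powr (1 - q)" by simp
  have "\<bar>expect h g x - expect h g y\<bar>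
    \<le> (trunc_scale N \<theta> x y / 2) powr (1 - q) * \<Lambda> powr q *
        (lyap_weight \<gamma> l s (Suc n) x + lyap_weight \<gamma> l s (Suc n) y) powr q"
    using osc_step_growth[OF local_contraction[of x y]] scale by simp
  also have "\<dots> \<le> trunc_scale N \<theta> x y powr (1 - q) * (lyap_weight \<gamma> l s (Suc n) x
      + lyap_weight \<gamma> l s (Suc n) y) powr q"
    using halved by (rule mult_right_mono) simp
  finally show ?thesis .
qed

lemma osc_step_low:
  assumes "v x \<le> M" "v y \<le> M"
  shows "\<bar>expect h g x - expect h g y\<bar> \<le> (lyap_weight \<gamma> l s (Suc n) x + lyap_weight \<gamma> l s (Suc n) y) powr q"
proof -
  have "(1 - \<kappa>) powr (1 - q) * \<Lambda> powr q * (lyap_weight \<gamma> l s (Suc n) x + lyap_weight \<gamma> l s (Suc n) y) powr q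
      \<le> 1 * (lyap_weight \<gamma> l s (Suc n) x + lyap_weight \<gamma> l s (Suc n) y) powr q"
    using \<Lambda>(4) by (intro mult_right_mono) auto
  then show ?thesis using osc_step_growth[OF small_set[OF assms]] \<kappa> by simp
qed

lemma osc_step_middle:
  assumes "M \<le> v x" "v x \<le> s" "v y \<le> v x"
  shows "\<bar>expect h g x - expect h g y\<bar> \<le> (lyap_weight \<gamma> l s (Suc n) x + lyap_weight \<gamma> l s (Suc n) y) powr q"
proof -
  note weight = lyap_weight_weight[OF \<gamma> l s, of n]
  have "\<bar>expect h g x - expect h g y\<bar>
      \<le> trunc_scale (N / 2) \<theta> x y powr (1 - q) *
          (expect h (lyap_weight \<gamma> l s n) x + expect h (lyap_weight \<gamma> l s n) y) powr q"
    using local_contraction weight g q by (auto simp: osc_contracting_def)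
  also have "\<dots> \<le> 1 * (lyap_weight \<gamma> l s (Suc n) x + lyap_weight \<gamma> l s (Suc n) y) powr q"
    using q N_ge_1 h_pos weight_pos[OF weight_expect[OF weight], of h]
    by (intro mult_mono trunc_scale_powr_le_1 powr_mono2 expect_lyap_weight_pair_decay[OF \<gamma> l s assms])
       (auto intro: add_nonneg_nonneg less_imp_le)
  finally show ?thesis by simp
qed

lemma osc_bound_lyap_weight_Suc:
  assumes osc_le_1: "\<And>x y. \<bar>expect h g x - expect h g y\<bar> \<le> 1"
  shows "osc_bound (trunc_scale N \<theta>) q (lyap_weight \<gamma> l s (Suc n)) (expect h g)"
  unfolding osc_bound_def
proof (intro conjI allI)
  have "g \<in> borel_measurable borel" "bounded (range g)" using g by (auto simp: osc_bound_def)
  then show "expect h g \<in> borel_measurable borel" "bounded (range (expect h g))"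
    using h_pos abs_expect_le[of h g] by (auto simp: bounded_iff intro!: expect_measurable)
  fix x y
  define S where "S = lyap_weight \<gamma> l s (Suc n) x + lyap_weight \<gamma> l s (Suc n) y"
  show "\<bar>expect h g x - expect h g y\<bar>
    \<le> trunc_scale N \<theta> x y powr (1 - q) * (lyap_weight \<gamma> l s (Suc n) x + lyap_weight \<gamma> l s (Suc n) y) powr q"
  proof (cases "N * \<theta> x y < 1")
    case False
    consider "v x \<le> M" "v y \<le> M" | "s < max (v x) (v y)"
      | "M \<le> v x" "v x \<le> s" "v y \<le> v x" | "M \<le> v y" "v y \<le> s" "v x \<le> v y"
      by linarith
    then have "\<bar>expect h g x - expect h g y\<bar> \<le> S powr q"
    proof cases
      case 2
      have "s \<le> v x + v y" using 2 v_ge_1[of x] v_ge_1[of y] by linarith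
      then have "1 \<le> (\<gamma> + v x) / s + (\<gamma> + v y) / s" using s \<gamma> by (simp add: add_divide_distrib[symmetric])
      then have "1 \<le> S" using lyap_weight_ge[OF \<gamma> l s, of _ "Suc n"] unfolding S_def by (meson add_mono order_trans)
      then have "1 \<le> S powr q" using q by (intro ge_one_powr_ge_zero) auto
      then show ?thesis using osc_le_1[of x y] by linarith
    qed (use osc_step_low[of x y] osc_step_middle[of x y] osc_step_middle[of y x] in
        \<open>simp_all add: S_def add.commute abs_minus_commute\<close>)
    then show ?thesis using False by (simp add: trunc_scale_def S_def)
  qed (rule osc_step_near)
qed

end

lemma osc_bound_lyap_weight:
  assumes f: "trunc_Lipschitz f"
  shows "osc_bound (trunc_scale N \<theta>) q (lyap_weight \<gamma> l s n) (expect (real n * h) f)"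
proof (induction n)
  case 0
  have "expect 0 f = f" using trunc_Lipschitz_measurable[OF f] by (simp add: expect_0 fun_eq_iff)
  then show ?case using osc_bound_lyap_weight_0[OF f] by simp
next
  case (Suc n)
  have time: "h + real n * h = real (Suc n) * h" by (simp add: algebra_simps)
  have add: "expect (real (Suc n) * h) f x = expect h (expect (real n * h) f) x" for x
    unfolding time[symmetric]
    using h_pos trunc_Lipschitz_measurable[OF f] trunc_Lipschitz_abs_le[OF f, of _ undefined]
    by (intro expect_add_bounded) auto
  have "\<bar>expect (real (Suc n) * h) f x - expect (real (Suc n) * h) f y\<bar> \<le> 1" for x y
    using h_pos f by (intro trunc_Lipschitz_integral_diff_le_1 borel_distribution_P) auto
  then show ?case using osc_bound_lyap_weight_Suc[OF Suc] unfolding add by blast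
qed

lemma kantorovich_dist_le_lyap_weight:
  "kantorovich_dist (skeleton n x) (skeleton n y) \<le> (lyap_weight \<gamma> l s n x + lyap_weight \<gamma> l s n y) powr q"
proof (rule kantorovich_dist_leI)
  fix f :: "'a \<Rightarrow> real" assume "trunc_Lipschitz f"
  then have "expect (real n * h) f x - expect (real n * h) f y
      \<le> trunc_scale N \<theta> x y powr (1 - q) * (lyap_weight \<gamma> l s n x + lyap_weight \<gamma> l s n y) powr q"
    using osc_bound_lyap_weight[of f n] by (auto simp: osc_bound_def dest: abs_le_D1)
  also have "\<dots> \<le> 1 * (lyap_weight \<gamma> l s n x + lyap_weight \<gamma> l s n y) powr q"
    using q N_ge_1 by (intro mult_right_mono trunc_scale_powr_le_1) auto
  finally show "expect (real n * h) f x - expect (real n * h) f y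
      \<le> (lyap_weight \<gamma> l s n x + lyap_weight \<gamma> l s n y) powr q"
    by simp
qed

end

lemma growth_factor_exists:
  assumes q: "0 < q" "q < 1"
  obtains \<Lambda> where "1 < \<Lambda>" "\<Lambda> powr q \<le> 2 powr (1 - q)" "(1 - \<kappa>) powr (1 - q) * \<Lambda> powr q \<le> 1"
proof
  define m where "m = min 2 (1 / (1 - \<kappa>))"
  define \<Lambda> where "\<Lambda> = m powr ((1 - q) / q)"
  have m: "1 < m" "m \<le> 2" "m \<le> 1 / (1 - \<kappa>)" using \<kappa> by (auto simp: m_def)
  then show "1 < \<Lambda>" unfolding \<Lambda>_def using q by (intro gr_one_powr) auto
  have \<Lambda>_powr: "\<Lambda> powr q = m powr (1 - q)" using q by (simp add: \<Lambda>_def powr_powr)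
  show "\<Lambda> powr q \<le> 2 powr (1 - q)" unfolding \<Lambda>_powr using m q by (intro powr_mono2) auto
  have "(1 - \<kappa>) * m \<le> 1" using m(3) \<kappa> by (simp add: field_simps)
  then have "((1 - \<kappa>) * m) powr (1 - q) \<le> 1" using m \<kappa> q by (intro powr_le1) auto
  then show "(1 - \<kappa>) powr (1 - q) * \<Lambda> powr q \<le> 1" unfolding \<Lambda>_powr using m \<kappa> by (simp add: powr_mult)
qed

lemma weighted_contraction:
  assumes q: "0 < q" "q < 1"
  obtains \<gamma> \<epsilon> where "0 < \<gamma>" "0 < \<epsilon>" "\<And>s. 1 \<le> s \<Longrightarrow> \<eta> / 4 * (\<epsilon> * deriv \<phi> s) < 1"
    "\<And>s n x y. 1 \<le> s \<Longrightarrow> kantorovich_dist (skeleton n x) (skeleton n y)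
      \<le> (lyap_weight \<gamma> (\<epsilon> * deriv \<phi> s) s n x + lyap_weight \<gamma> (\<epsilon> * deriv \<phi> s) s n y) powr q"
proof -
  obtain \<Lambda> where \<Lambda>: "1 < \<Lambda>" "\<Lambda> powr q \<le> 2 powr (1 - q)" "(1 - \<kappa>) powr (1 - q) * \<Lambda> powr q \<le> 1"
    using growth_factor_exists[OF q] .
  define \<gamma> where "\<gamma> = K\<^sub>1 / (\<Lambda> - 1)"
  define e where "e = (\<Lambda> - 1) / (\<eta> / 4 * (1 + \<Lambda>) * deriv \<phi> 1)"
  define \<epsilon> where "\<epsilon> = min 1 e"
  have \<gamma>: "0 < \<gamma>" "K\<^sub>1 \<le> (\<Lambda> - 1) * \<gamma>" using \<Lambda>(1) K\<^sub>1_pos by (auto simp: \<gamma>_def)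
  have e: "0 < e" unfolding e_def using \<Lambda> \<eta>_pos deriv_phi_pos[of 1] by (intro divide_pos_pos mult_pos_pos) auto
  then have \<epsilon>: "0 < \<epsilon>" "\<epsilon> \<le> 1" "\<epsilon> \<le> e" by (auto simp: \<epsilon>_def)
  have rate: "\<eta> / 4 * (\<epsilon> * deriv \<phi> s) * (1 + \<Lambda>) \<le> \<Lambda> - 1" if "1 \<le> s" for s
  proof -
    have "\<eta> / 4 * (1 + \<Lambda>) * (\<epsilon> * deriv \<phi> s) \<le> \<eta> / 4 * (1 + \<Lambda>) * (e * deriv \<phi> 1)"
      using \<epsilon> e \<eta>_pos \<Lambda> that deriv_phi_pos[of s] deriv_phi_antimono[of 1 s] by (intro mult_left_mono mult_mono) auto
    also have "\<dots> = \<Lambda> - 1" using \<eta>_pos \<Lambda> deriv_phi_pos[of 1] by (simp add: e_def)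
    finally show ?thesis by (simp add: mult_ac)
  qed
  show ?thesis
  proof (rule that[OF \<gamma>(1) \<epsilon>(1)])
    fix s :: real assume s: "1 \<le> s"
    show small: "\<eta> / 4 * (\<epsilon> * deriv \<phi> s) < 1"
    proof (rule ccontr)
      assume "\<not> \<eta> / 4 * (\<epsilon> * deriv \<phi> s) < 1"
      then have "1 * (1 + \<Lambda>) \<le> \<eta> / 4 * (\<epsilon> * deriv \<phi> s) * (1 + \<Lambda>)" using \<Lambda> by (intro mult_right_mono) auto
      then show False using rate[OF s] by simp
    qed
    have l: "0 < \<epsilon> * deriv \<phi> s" "\<epsilon> * deriv \<phi> s \<le> deriv \<phi> s"
      using \<epsilon> s deriv_phi_pos[of s] by (auto simp: mult_left_le_one_le)
    have "1 + \<eta> / 4 * (\<epsilon> * deriv \<phi> s) \<le> \<Lambda> * (1 - \<eta> / 4 * (\<epsilon> * deriv \<phi> s))"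
      using rate[OF s] by (simp add: algebra_simps add_divide_distrib)
    then show "kantorovich_dist (skeleton n x) (skeleton n y)
      \<le> (lyap_weight \<gamma> (\<epsilon> * deriv \<phi> s) s n x + lyap_weight \<gamma> (\<epsilon> * deriv \<phi> s) s n y) powr q" for n x y
      by (rule kantorovich_dist_le_lyap_weight[OF q \<gamma>(1) l small s \<gamma>(2) _ \<Lambda>(2,3)])
  qed
qed

lemma exp_part_le_phi_ratio:
  fixes n :: nat
  assumes \<epsilon>: "0 < \<epsilon>" "\<eta> / 4 * (\<epsilon> * deriv \<phi> s) < 1" and s: "1 \<le> s" "s \<le> R" and u: "0 < u" "0 \<le> p"
    and R: "(1 + p / \<epsilon>) * H R \<le> \<eta> / 4 * real n" "ln (\<phi> s / \<phi> u) = p * ln (\<phi> R / \<phi> s)"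
  shows "(1 - \<eta> / 4 * (\<epsilon> * deriv \<phi> s)) ^ n * exp_weight (\<epsilon> * deriv \<phi> s) s (v x) \<le> \<phi> u / \<phi> s"
proof -
  define l where "l = \<epsilon> * deriv \<phi> s"
  have l: "0 < l" using \<epsilon> s deriv_phi_pos[of s] by (simp add: l_def)
  have pos: "0 < \<phi> u" "0 < \<phi> s" using u s by (auto intro: phi_pos)
  have "(1 - \<eta> / 4 * l) ^ n \<le> exp (- (\<eta> / 4 * l)) ^ n"
    using \<epsilon>(2) exp_ge_add_one_self[of "- (\<eta> / 4 * l)"] by (intro power_mono) (auto simp: l_def)
  also have "\<dots> = exp (- (l * (\<eta> / 4 * real n)))" by (simp add: exp_of_nat_mult[symmetric] mult_ac)
  also have "\<dots> \<le> exp (- (l * ((1 + p / \<epsilon>) * H R)))" using R(1) l by simp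
  finally have decay: "(1 - \<eta> / 4 * l) ^ n \<le> exp (- (l * ((1 + p / \<epsilon>) * H R)))" .
  have growth: "exp_weight l s (v x) \<le> exp (l * H R)"
    unfolding exp_weight_def using l s v_ge_1[of x] by (auto intro!: mult_left_mono simp: H_le_iff)
  have "ln (\<phi> R / \<phi> s) \<le> deriv \<phi> s * (H R - H s)" by (rule ln_phi_ratio_le[OF s])
  also have "\<dots> \<le> deriv \<phi> s * H R" using s H_nonneg[OF s(1)] deriv_phi_pos[of s] by (intro mult_left_mono) auto
  finally have "p * ln (\<phi> R / \<phi> s) \<le> p * (deriv \<phi> s * H R)" using u(2) by (rule mult_left_mono)
  also have "\<dots> = p / \<epsilon> * (l * H R)" using \<epsilon> by (simp add: l_def)
  finally have exponent: "ln (\<phi> s / \<phi> u) \<le> p / \<epsilon> * (l * H R)" using R(2) by linarith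
  have "(1 - \<eta> / 4 * l) ^ n * exp_weight l s (v x) \<le> exp (- (l * ((1 + p / \<epsilon>) * H R))) * exp (l * H R)"
    using decay growth by (intro mult_mono) (auto simp: exp_weight_def)
  also have "\<dots> = exp (- (p / \<epsilon> * (l * H R)))" by (simp add: exp_add[symmetric] algebra_simps)
  also have "\<dots> \<le> exp (- ln (\<phi> s / \<phi> u))" using exponent by simp
  also have "\<dots> = \<phi> u / \<phi> s" using pos by (simp add: exp_minus)
  finally show ?thesis by (simp add: l_def)
qed

lemma affine_part_le_phi_ratio:
  assumes "0 \<le> \<gamma>" "v x \<le> u" "u \<le> s"
  shows "(\<gamma> + v x) / s \<le> (\<gamma> + 1) * (\<phi> u / \<phi> s)"
proof -
  have u: "1 \<le> u" "0 < \<phi> s" using assms v_ge_1[of x] by (auto intro: phi_pos)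
  have "\<gamma> * 1 \<le> \<gamma> * u" using assms u by (intro mult_left_mono) auto
  then have "(\<gamma> + v x) / s \<le> (\<gamma> + 1) * (u / s)"
    using assms u by (simp add: distrib_right divide_right_mono add_divide_distrib[symmetric])
  also have "u / s \<le> \<phi> u / \<phi> s" using phi_star_shaped[of u s] u assms(3) by (simp add: field_simps)
  finally show ?thesis using assms(1) by (simp add: mult_left_mono)
qed

lemma lyap_weight_le_phi_ratio:
  fixes n :: nat
  assumes "0 \<le> \<gamma>" "0 < \<epsilon>" "\<eta> / 4 * (\<epsilon> * deriv \<phi> s) < 1" and "v x \<le> u" "u \<le> s" "s \<le> R" "0 \<le> p"
    and "(1 + p / \<epsilon>) * H R \<le> \<eta> / 4 * real n" "ln (\<phi> s / \<phi> u) = p * ln (\<phi> R / \<phi> s)"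
  shows "0 \<le> lyap_weight \<gamma> (\<epsilon> * deriv \<phi> s) s n x"
    and "lyap_weight \<gamma> (\<epsilon> * deriv \<phi> s) s n x \<le> (\<gamma> + 2) * (\<phi> u / \<phi> s)"
proof -
  show "0 \<le> lyap_weight \<gamma> (\<epsilon> * deriv \<phi> s) s n x"
    using assms v_ge_1[of x] by (simp add: lyap_weight_def exp_weight_def)
  have "(1 - \<eta> / 4 * (\<epsilon> * deriv \<phi> s)) ^ n * exp_weight (\<epsilon> * deriv \<phi> s) s (v x) \<le> \<phi> u / \<phi> s"
    using assms v_ge_1[of x] by (intro exp_part_le_phi_ratio[of _ _ R _ p]) auto
  then show "lyap_weight \<gamma> (\<epsilon> * deriv \<phi> s) s n x \<le> (\<gamma> + 2) * (\<phi> u / \<phi> s)"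
    using affine_part_le_phi_ratio[OF assms(1,4,5)] by (simp only: lyap_weight_def distrib_right)
qed

lemma subgeometric_contraction_below:
  fixes q :: real
  assumes q: "0 < q" "q < 1"
  obtains C \<beta> where "1 \<le> C" "0 < \<beta>"
    "\<And>n x y R. max (v x) (v y) \<le> R \<Longrightarrow> H R \<le> \<beta> * real n \<Longrightarrow>
      kantorovich_dist (skeleton n x) (skeleton n y) \<le> C * (\<phi> (max (v x) (v y)) / \<phi> R) powr (q * q)"
proof -
  obtain \<gamma> \<epsilon> where \<gamma>: "0 < \<gamma>" and \<epsilon>: "0 < \<epsilon>" "\<And>s. 1 \<le> s \<Longrightarrow> \<eta> / 4 * (\<epsilon> * deriv \<phi> s) < 1"
    and contraction: "\<And>s n x y. 1 \<le> s \<Longrightarrow> kantorovich_dist (skeleton n x) (skeleton n y)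
      \<le> (lyap_weight \<gamma> (\<epsilon> * deriv \<phi> s) s n x + lyap_weight \<gamma> (\<epsilon> * deriv \<phi> s) s n y) powr q"
    using weighted_contraction[OF q] by blast
  define p where "p = q / (1 - q)"
  define k where "k = 1 + p / \<epsilon>"
  define C where "C = 2 * (\<gamma> + 2)"
  have p: "0 < p" using q by (simp add: p_def)
  then have k: "0 < k" using \<epsilon> by (simp add: k_def add_pos_pos)
  have C: "1 \<le> C" using \<gamma> by (simp add: C_def)
  show ?thesis
  proof (rule that)
    show "1 \<le> C powr q" using C q by (intro ge_one_powr_ge_zero) auto
    show "0 < \<eta> / 4 / k" using \<eta>_pos k by simp
    fix n :: nat and x y R
    define u where "u = max (v x) (v y)"
    assume R: "max (v x) (v y) \<le> R" "H R \<le> \<eta> / 4 / k * real n"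
    have u: "1 \<le> u" "u \<le> R" using v_ge_1[of x] R(1) by (auto simp: u_def)
    then obtain s where s: "u \<le> s" "s \<le> R" and ratio: "\<phi> u / \<phi> s = (\<phi> u / \<phi> R) powr q"
      and exponents: "(1 - q) * ln (\<phi> s / \<phi> u) = q * ln (\<phi> R / \<phi> s)"
      using phi_geometric_mean[of u R q] q by auto
    have time: "k * H R \<le> \<eta> / 4 * real n" using R(2) k by (simp add: field_simps)
    have weight_le: "0 \<le> lyap_weight \<gamma> (\<epsilon> * deriv \<phi> s) s n z"
      "lyap_weight \<gamma> (\<epsilon> * deriv \<phi> s) s n z \<le> (\<gamma> + 2) * (\<phi> u / \<phi> s)" if "v z \<le> u" for z
      using lyap_weight_le_phi_ratio[OF _ \<epsilon>(1) \<epsilon>(2) that s, of \<gamma> p n] \<gamma> p q u s time exponents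
      by (auto simp: k_def p_def field_simps)
    have "lyap_weight \<gamma> (\<epsilon> * deriv \<phi> s) s n x + lyap_weight \<gamma> (\<epsilon> * deriv \<phi> s) s n y \<le> C * (\<phi> u / \<phi> s)"
      unfolding C_def mult_2 distrib_right[of "\<gamma> + 2"] by (intro add_mono weight_le(2)) (auto simp: u_def)
    then have "(lyap_weight \<gamma> (\<epsilon> * deriv \<phi> s) s n x + lyap_weight \<gamma> (\<epsilon> * deriv \<phi> s) s n y) powr q
        \<le> (C * (\<phi> u / \<phi> s)) powr q"
      using weight_le(1)[of x] weight_le(1)[of y] q by (intro powr_mono2) (auto simp: u_def)
    then have "kantorovich_dist (skeleton n x) (skeleton n y) \<le> (C * (\<phi> u / \<phi> s)) powr q"
      using contraction[of s n x y] s u by linarith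
    also note ratio
    also have "(C * (\<phi> u / \<phi> R) powr q) powr q = C powr q * (\<phi> u / \<phi> R) powr (q * q)"
      using C by (simp add: powr_mult powr_powr)
    finally show "kantorovich_dist (skeleton n x) (skeleton n y)
        \<le> C powr q * (\<phi> (max (v x) (v y)) / \<phi> R) powr (q * q)"
      by (simp add: u_def)
  qed
qed

lemma subgeometric_contraction:
  assumes \<delta>: "0 < \<delta>" "\<delta> < 1"
  obtains C \<beta> where "1 \<le> C" "0 < \<beta>"
    "\<And>n x y. kantorovich_dist (skeleton n x) (skeleton n y)
      \<le> C * ((\<phi> (v x) + \<phi> (v y)) / rate (\<beta> * real n)) powr \<delta>"
proof -
  have q: "0 < sqrt \<delta>" "sqrt \<delta> < 1" "sqrt \<delta> * sqrt \<delta> = \<delta>" using \<delta> by auto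
  obtain C \<beta> where C: "1 \<le> C" "0 < \<beta>" and below: "\<And>n x y R. max (v x) (v y) \<le> R \<Longrightarrow> H R \<le> \<beta> * real n \<Longrightarrow>
      kantorovich_dist (skeleton n x) (skeleton n y) \<le> C * (\<phi> (max (v x) (v y)) / \<phi> R) powr \<delta>"
    using subgeometric_contraction_below[OF q(1,2)] unfolding q(3) by blast
  show ?thesis
  proof (rule that[OF C])
    fix n :: nat and x y
    define u where "u = max (v x) (v y)"
    define R where "R = H_phi_inv \<phi> (\<beta> * real n)"
    have R: "1 \<le> R" "H R \<le> \<beta> * real n" using H_phi_inv[of "\<beta> * real n"] C(2) by (auto simp: R_def)
    have pos: "0 < \<phi> u" "0 < \<phi> R" "0 < \<phi> (v x)" "0 < \<phi> (v y)"
      using R(1) v_ge_1[of x] phi_v_pos by (auto simp: u_def intro: phi_pos)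
    have "kantorovich_dist (skeleton n x) (skeleton n y) \<le> C * (\<phi> u / \<phi> R) powr \<delta>"
    proof (cases "u \<le> R")
      case False
      then have "1 \<le> (\<phi> u / \<phi> R) powr \<delta>"
        using \<delta> R(1) pos by (intro ge_one_powr_ge_zero) (auto intro: phi_mono)
      then have "1 * 1 \<le> C * (\<phi> u / \<phi> R) powr \<delta>" using C(1) by (intro mult_mono) auto
      moreover have "kantorovich_dist (skeleton n x) (skeleton n y) \<le> 1"
        using h_pos by (intro kantorovich_dist_le_1 borel_distribution_P) auto
      ultimately show ?thesis by linarith
    qed (use below R in \<open>simp add: u_def\<close>)
    also have "\<dots> \<le> C * ((\<phi> (v x) + \<phi> (v y)) / \<phi> R) powr \<delta>"
      using \<delta> C(1) pos by (intro mult_left_mono powr_mono2 divide_right_mono) (auto simp: u_def max_def)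
    finally show "kantorovich_dist (skeleton n x) (skeleton n y)
        \<le> C * ((\<phi> (v x) + \<phi> (v y)) / rate (\<beta> * real n)) powr \<delta>"
      by (simp add: R_def rate_def)
  qed
qed

end

section \<open>Ergodicity of the skeleton chain\<close>

lemma powr_add_le:
  fixes x y \<delta> :: real
  assumes "0 \<le> x" "0 \<le> y" "\<delta> \<le> 1"
  shows "(x + y) powr \<delta> \<le> x powr \<delta> + y powr \<delta>"
proof (cases "x + y = 0")
  case False
  then have "0 < x + y" using assms by simp
  have fraction_le: "z / (x + y) \<le> z powr \<delta> / (x + y) powr \<delta>" if "0 \<le> z" "z \<le> x + y" for z
  proof (cases "z = 0")
    case False
    then have "(z / (x + y)) powr 1 \<le> (z / (x + y)) powr \<delta>"
      using that assms \<open>0 < x + y\<close> by (intro powr_mono') auto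
    then show ?thesis using that \<open>0 < x + y\<close> by (simp add: powr_divide)
  qed simp
  have "1 = x / (x + y) + y / (x + y)" using False by (simp add: add_divide_distrib[symmetric])
  also have "\<dots> \<le> (x powr \<delta> + y powr \<delta>) / (x + y) powr \<delta>"
    unfolding add_divide_distrib using assms by (intro add_mono fraction_le) auto
  finally show ?thesis using False by (simp add: le_divide_eq)
qed (use assms in \<open>simp add: add_nonneg_eq_0_iff\<close>)

context
  fixes a :: "nat \<Rightarrow> real" and b c :: real
  assumes a_nonneg: "\<And>k. 0 \<le> a k" and b: "0 < b" and sum_le: "\<And>n. (\<Sum>k<n. a k) \<le> c + real n * b"
begin

lemma sum_shift_le: "(\<Sum>k<n. a (k + m)) \<le> c + real (n + m) * b"
proof -
  have "(\<Sum>k<n. a (k + m)) = (\<Sum>k=m..<n + m. a k)"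
    using sum.shift_bounds_nat_ivl[of a 0 m n] by (simp add: atLeast0LessThan)
  also have "\<dots> \<le> (\<Sum>k<n + m. a k)" using a_nonneg by (intro sum_mono2) auto
  finally show ?thesis using sum_le[of "n + m"] by linarith
qed

lemma linear_sum_bound_imp_small_pair:
  obtains k where "a k + a (k + m) \<le> 2 * c + 3 * b"
proof (rule ccontr)
  assume "\<not> thesis"
  with that have large: "2 * c + 3 * b < a k + a (k + m)" for k by (meson not_le)
  have "(\<Sum>k<Suc m. 2 * c + 3 * b) < (\<Sum>k<Suc m. a k + a (k + m))" using large by (intro sum_strict_mono) auto
  also have "\<dots> \<le> (c + real (Suc m) * b) + (c + real (Suc m + m) * b)"
    unfolding sum.distrib by (intro add_mono sum_le sum_shift_le)
  finally have "2 * (real m * c) + b < 0" by (simp add: algebra_simps)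
  moreover have "0 \<le> c" using sum_le[of 0] by simp
  ultimately show False using b by (simp add: add_nonneg_pos order.strict_iff_not)
qed

lemma linear_sum_bound_imp_frequently_small:
  obtains k where "m \<le> k" "a k \<le> 2 * b"
proof (rule ccontr)
  assume "\<not> thesis"
  with that have large: "2 * b \<le> a (k + m)" for k by (metis le_add2 linear)
  obtain n where n: "c + real m * b < real n * b" using ex_less_of_nat_mult[OF b] by blast
  have "real n * (2 * b) \<le> (\<Sum>k<n. a (k + m))" using sum_bounded_below[of "{..<n}", OF large] by simp
  also have "\<dots> \<le> c + real (n + m) * b" by (rule sum_shift_le)
  finally show False using n by (simp add: algebra_simps)
qed

end

lemma kantorovich_dist_bind_powr_le:
  fixes g :: "'a::topological_space \<Rightarrow> real"
  assumes \<nu>: "borel_distribution \<nu>" and \<mu>: "borel_distribution \<mu>" and \<kappa>: "\<kappa> \<in> borel \<rightarrow>\<^sub>M prob_algebra borel"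
    and g: "integrable \<nu> g" "\<And>x. 0 \<le> g x" "(\<integral>x. g x \<partial>\<nu>) \<le> b"
    and pos: "0 \<le> C" "0 < c" "0 < r" and \<delta>: "0 < \<delta>" "\<delta> < 1"
    and dist_le: "\<And>x. kantorovich_dist (\<kappa> x) \<mu> \<le> C * ((g x + c) / r) powr \<delta>"
  shows "kantorovich_dist (\<nu> \<bind> \<kappa>) \<mu> \<le> C * ((b + c) / r) powr \<delta>"
proof -
  interpret borel_distribution \<nu> by (rule \<nu>)
  have "0 \<le> (\<integral>x. g x \<partial>\<nu>)" using g(2) by (intro Bochner_Integration.integral_nonneg) auto
  then have "0 < (b + c) / r" using g(3) pos by simp
  moreover have "(\<integral>x. (g x + c) / r \<partial>\<nu>) \<le> (b + c) / r" "integrable \<nu> (\<lambda>x. (g x + c) / r)"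
    using g pos by (simp_all add: divide_right_mono)
  ultimately have jensen: "integrable \<nu> (\<lambda>x. ((g x + c) / r) powr \<delta>)"
    "(\<integral>x. ((g x + c) / r) powr \<delta> \<partial>\<nu>) \<le> ((b + c) / r) powr \<delta>"
    using g(2) pos \<delta> integral_powr_le[of "\<lambda>x. (g x + c) / r" "(b + c) / r" \<delta>] by (auto simp: less_imp_le)
  have "kantorovich_dist (\<nu> \<bind> \<kappa>) \<mu> \<le> (\<integral>x. C * ((g x + c) / r) powr \<delta> \<partial>\<nu>)"
    by (rule kantorovich_dist_bind_le[OF \<nu> \<mu> \<kappa> _ dist_le]) (use jensen in simp)
  also have "\<dots> \<le> C * ((b + c) / r) powr \<delta>" using jensen pos by (simp add: mult_left_mono)
  finally show ?thesis .
qed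

context drift_chain
begin

lemma phi_v_integrable: "semigroup_integrable (\<lambda>y. \<phi> (v y))"
  by (rule phi_comp_integrable[OF v_integrable v_nonneg])

lemma expect_phi_v_nonneg: "0 \<le> t \<Longrightarrow> 0 \<le> expect t (\<lambda>y. \<phi> (v y)) x"
  using expect_ge_const[OF phi_v_integrable] phi_v_pos less_imp_le by blast

definition K\<^sub>2 :: real where "K\<^sub>2 = K\<^sub>1 / \<eta> + \<phi> M"

lemma K\<^sub>2_pos: "0 < K\<^sub>2"
  using K\<^sub>1_pos \<eta>_pos M_pos phi_pos[of M] by (simp add: K\<^sub>2_def add_pos_pos)

lemma drift_everywhere: "expect h v x + \<eta> * \<phi> (v x) \<le> v x + \<eta> * K\<^sub>2"
proof (cases "M \<le> v x")
  case True
  moreover have "0 \<le> \<eta> * K\<^sub>2" using \<eta>_pos K\<^sub>2_pos by simp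
  ultimately show ?thesis using drift_above[of x] by linarith
next
  case False
  then have "\<eta> * \<phi> (v x) \<le> \<eta> * \<phi> M" using \<eta>_pos v_ge_1[of x] by (intro mult_left_mono phi_mono) auto
  moreover have "\<eta> * K\<^sub>2 = K\<^sub>1 + \<eta> * \<phi> M" using \<eta>_pos by (simp add: K\<^sub>2_def distrib_left)
  ultimately show ?thesis using drift[of x] by linarith
qed

lemma sum_expect_phi_v_le: "(\<Sum>k<n. expect (real k * h) (\<lambda>y. \<phi> (v y)) x) \<le> v x / \<eta> + real n * K\<^sub>2"
proof -
  have "expect (real n * h) v x + \<eta> * (\<Sum>k<n. expect (real k * h) (\<lambda>y. \<phi> (v y)) x) \<le> v x + real n * (\<eta> * K\<^sub>2)" for n
  proof (induction n)
    case 0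
    show ?case by (simp add: expect_0[OF v_measurable])
  next
    case (Suc n)
    have time: "0 \<le> real n * h" "real (Suc n) * h = real n * h + h" using h_pos by (simp_all add: algebra_simps)
    interpret borel_distribution "skeleton n x" by (rule borel_distribution_P[OF time(1)])
    note int = semigroup_integrableD(2)[OF v_integrable time(1)] semigroup_integrableD(2)[OF phi_v_integrable time(1)]
    have "expect (real (Suc n) * h) v x = expect (real n * h) (expect h v) x"
      unfolding time(2) using h_pos time(1) by (intro expect_add_nonneg[OF v_integrable v_nonneg]) auto
    also have "\<dots> \<le> (\<integral>y. (v y + \<eta> * K\<^sub>2) - \<eta> * \<phi> (v y) \<partial>skeleton n x)"
      using drift_everywhere int h_pos
        semigroup_integrableD(2)[OF semigroup_integrable_expect[OF v_integrable v_nonneg] time(1)]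
      by (intro integral_mono) (auto simp: le_diff_eq)
    also have "\<dots> = expect (real n * h) v x + \<eta> * K\<^sub>2 - \<eta> * expect (real n * h) (\<lambda>y. \<phi> (v y)) x"
      using int by (simp add: prob_space)
    finally show ?case using Suc by (simp add: algebra_simps)
  qed
  moreover have "0 \<le> expect (real n * h) v x" using h_pos v_nonneg by (intro expect_ge_const[OF v_integrable]) auto
  ultimately have "\<eta> * (\<Sum>k<n. expect (real k * h) (\<lambda>y. \<phi> (v y)) x) \<le> v x + real n * (\<eta> * K\<^sub>2)" by (smt (verit))
  then show ?thesis using \<eta>_pos by (simp add: field_simps)
qed

end

locale subgeometric_chain = drift_chain P \<phi> h A M K\<^sub>1 \<eta> v
  for P :: "real \<Rightarrow> 'a::polish_space \<Rightarrow> 'a measure" and \<phi> h A M K\<^sub>1 \<eta> v +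
  fixes \<delta> C \<beta> :: real
  assumes \<delta>: "0 < \<delta>" "\<delta> < 1" and C_ge_1: "1 \<le> C" and \<beta>_pos: "0 < \<beta>"
    and contraction: "\<And>n x y. kantorovich_dist (skeleton n x) (skeleton n y)
      \<le> C * ((\<phi> (v x) + \<phi> (v y)) / rate (\<beta> * real n)) powr \<delta>"
begin

lemma borel_distribution_skeleton: "borel_distribution (skeleton n x)"
  using h_pos by (intro borel_distribution_P) simp

lemma skeleton_add: "skeleton (m + n) x = skeleton m x \<bind> skeleton n"
  using h_pos by (simp add: P_add[symmetric] distrib_right)

lemma rate_skeleton_pos: "0 < rate (\<beta> * real n)"
  using \<beta>_pos by (intro rate_pos) simp

lemma contraction_bound_tendsto_0: "(\<lambda>n. a * (b / rate (\<beta> * real n)) powr \<delta>) \<longlonglongrightarrow> 0" if "0 \<le> b"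
proof -
  have "filterlim (\<lambda>n. \<beta> * real n) at_top sequentially"
    using \<beta>_pos by (intro filterlim_tendsto_pos_mult_at_top[OF tendsto_const] filterlim_real_sequentially)
  then have "filterlim (\<lambda>n. rate (\<beta> * real n)) at_top sequentially" by (rule filterlim_compose[OF rate_at_top])
  then have "(\<lambda>n. b / rate (\<beta> * real n)) \<longlonglongrightarrow> 0" by (rule real_tendsto_divide_at_top[OF tendsto_const])
  then have "(\<lambda>n. (b / rate (\<beta> * real n)) powr \<delta>) \<longlonglongrightarrow> 0"
    using that rate_skeleton_pos \<delta>
    by (intro tendsto_zero_powrI[OF _ tendsto_const]) (auto intro!: always_eventually simp: less_imp_le)
  then show ?thesis by (rule tendsto_mult_right_zero)
qed

lemma contraction_shift:
  assumes "expect (real d * h) (\<lambda>y. \<phi> (v y)) x \<le> b"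
  shows "kantorovich_dist (skeleton (d + n) x) (skeleton n x) \<le> C * ((b + \<phi> (v x)) / rate (\<beta> * real n)) powr \<delta>"
  unfolding skeleton_add
  using h_pos \<delta> C_ge_1 assms
  by (intro kantorovich_dist_bind_powr_le[OF borel_distribution_skeleton borel_distribution_skeleton kernel_P
        semigroup_integrableD(2)[OF phi_v_integrable]] contraction phi_v_pos rate_skeleton_pos
          less_imp_le[OF phi_v_pos]) auto

lemma skeleton_Cauchy_bound:
  "kantorovich_dist (skeleton (d + n) x) (skeleton n x)
    \<le> 2 * C * ((2 * (v x / \<eta>) + 3 * K\<^sub>2 + \<phi> (v x)) / rate (\<beta> * real n)) powr \<delta>"
proof -
  define a where "a k = expect (real k * h) (\<lambda>y. \<phi> (v y)) x" for k
  define b where "b = 2 * (v x / \<eta>) + 3 * K\<^sub>2"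
  define B where "B m = C * ((b + \<phi> (v x)) / rate (\<beta> * real m)) powr \<delta>" for m
  have a: "0 \<le> a k" "(\<Sum>k<n. a k) \<le> v x / \<eta> + real n * K\<^sub>2" for k n
    unfolding a_def using h_pos by (auto intro: expect_phi_v_nonneg sum_expect_phi_v_le)
  obtain k where "a k + a (k + d) \<le> b"
    unfolding b_def by (rule linear_sum_bound_imp_small_pair[of a, OF a(1) K\<^sub>2_pos a(2)])
  then have "a k \<le> b" "a (k + d) \<le> b" using a(1)[of k] a(1)[of "k + d"] by linarith+
  then have first: "kantorovich_dist (skeleton (k + (d + n)) x) (skeleton (d + n) x) \<le> B (d + n)"
    and second: "kantorovich_dist (skeleton (k + (d + n)) x) (skeleton n x) \<le> B n"
    using contraction_shift[of k x b "d + n"] contraction_shift[of "k + d" x b n]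
    by (auto simp: a_def B_def add.assoc)
  have "0 \<le> b" using a(1)[of k] \<open>a k \<le> b\<close> by simp
  then have "B (d + n) \<le> B n"
    unfolding B_def using C_ge_1 \<beta>_pos \<delta> phi_v_pos[of x] rate_skeleton_pos[of n] rate_skeleton_pos[of "d + n"]
    by (intro mult_left_mono powr_mono2 divide_left_mono rate_mono) (auto simp: less_imp_le)
  then show ?thesis
    using first second kantorovich_dist_commute[OF borel_distribution_skeleton borel_distribution_skeleton,
      of "d + n" x "k + (d + n)" x]
      kantorovich_dist_triangle[OF borel_distribution_skeleton borel_distribution_skeleton borel_distribution_skeleton,
        of "d + n" x n x "k + (d + n)" x]
    by (simp add: B_def b_def)
qed

lemma skeleton_Cauchy:
  assumes "0 < \<epsilon>"
  shows "\<exists>N. \<forall>m\<ge>N. \<forall>n\<ge>N. kantorovich_dist (skeleton m x) (skeleton n x) \<le> \<epsilon>"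
proof -
  define B where "B n = 2 * C * ((2 * (v x / \<eta>) + 3 * K\<^sub>2 + \<phi> (v x)) / rate (\<beta> * real n)) powr \<delta>" for n
  have "B \<longlonglongrightarrow> 0"
    unfolding B_def using \<eta>_pos v_ge_1[of x] K\<^sub>2_pos phi_v_pos[of x] by (intro contraction_bound_tendsto_0) auto
  then have "eventually (\<lambda>n. B n < \<epsilon>) sequentially" using assms by (rule order_tendstoD)
  then obtain N where N: "\<And>n. N \<le> n \<Longrightarrow> B n < \<epsilon>" by (auto simp: eventually_sequentially)
  have ordered: "kantorovich_dist (skeleton m x) (skeleton n x) \<le> \<epsilon>" if "N \<le> n" "n \<le> m" for m n
    using skeleton_Cauchy_bound[of "m - n" n x] N[OF that(1)] that(2) by (simp add: B_def)
  have "kantorovich_dist (skeleton m x) (skeleton n x) \<le> \<epsilon>" if "N \<le> m" "N \<le> n" for m n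
    using ordered[of n m] ordered[of m n] that
      kantorovich_dist_commute[OF borel_distribution_skeleton borel_distribution_skeleton, of m x n x]
    by (cases "n \<le> m") auto
  then show ?thesis by blast
qed

lemma skeleton_converges:
  assumes feller: "feller P"
  obtains \<pi> where "borel_distribution \<pi>" "\<pi> \<bind> P h = \<pi>" "(\<lambda>n. kantorovich_dist (skeleton n x) \<pi>) \<longlonglongrightarrow> 0"
proof -
  obtain \<pi> r where r: "strict_mono r" and \<pi>: "borel_distribution \<pi>"
    and weak: "weakly_converges (\<lambda>k. skeleton (r k) x) \<pi>"
    and lim: "(\<lambda>n. kantorovich_dist (skeleton n x) \<pi>) \<longlonglongrightarrow> 0"
    by (rule kantorovich_dist_complete[OF borel_distribution_skeleton skeleton_Cauchy])
  have "\<pi> \<bind> P h = \<pi>"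
  proof (rule borel_distribution_eqI_trunc_Lipschitz[OF _ \<pi>])
    show "borel_distribution (\<pi> \<bind> P h)" using h_pos \<pi> by (intro borel_distribution_bind_P) auto
    fix f :: "'a \<Rightarrow> real" assume f: "trunc_Lipschitz f"
    note f_meas = trunc_Lipschitz_measurable[OF f] and f_bound = trunc_Lipschitz_abs_le[OF f, of _ undefined]
    have "continuous_on UNIV (expect h f)" "bounded (range (expect h f))"
      using feller h_pos trunc_Lipschitz_continuous[OF f] trunc_Lipschitz_bounded[OF f] by (auto simp: feller_def)
    then have "(\<lambda>k. expect (real (r k) * h) (expect h f) x) \<longlonglongrightarrow> (\<integral>y. expect h f y \<partial>\<pi>)"
      using weak by (simp add: weakly_converges_def)
    moreover have "expect (real (r k) * h) (expect h f) x = expect (real (Suc (r k)) * h) f x" for k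
      using h_pos expect_add_bounded[OF _ _ f_meas f_bound, of "real (r k) * h" h x]
      by (simp add: distrib_right add.commute)
    moreover have "(\<lambda>n. expect (real n * h) f x) \<longlonglongrightarrow> (\<integral>y. f y \<partial>\<pi>)"
      using abs_integral_diff_le_kantorovich_dist[OF borel_distribution_skeleton \<pi> f]
      by (intro LIM_zero_cancel[OF Lim_null_comparison[OF _ lim]]) auto
    then have "(\<lambda>k. expect (real (Suc (r k)) * h) f x) \<longlonglongrightarrow> (\<integral>y. f y \<partial>\<pi>)"
      using LIMSEQ_subseq_LIMSEQ[of "\<lambda>n. expect (real n * h) f x" _ "\<lambda>k. Suc (r k)"] r
      by (simp add: strict_mono_Suc_iff o_def)
    ultimately have "(\<integral>y. expect h f y \<partial>\<pi>) = (\<integral>y. f y \<partial>\<pi>)" by (simp add: LIMSEQ_unique)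
    then show "(\<integral>y. f y \<partial>(\<pi> \<bind> P h)) = (\<integral>y. f y \<partial>\<pi>)"
      using integral_bind_P[OF _ \<pi> f_meas f_bound] h_pos by simp
  qed
  then show ?thesis using that \<pi> lim by blast
qed

lemma skeleton_limit_independent:
  assumes \<pi>: "borel_distribution \<pi>" and lim: "(\<lambda>n. kantorovich_dist (skeleton n x) \<pi>) \<longlonglongrightarrow> 0"
  shows "(\<lambda>n. kantorovich_dist (skeleton n y) \<pi>) \<longlonglongrightarrow> 0"
proof (rule real_tendsto_sandwich[OF _ _ tendsto_const])
  define B where "B n = C * ((\<phi> (v y) + \<phi> (v x)) / rate (\<beta> * real n)) powr \<delta>" for n
  show "eventually (\<lambda>n. 0 \<le> kantorovich_dist (skeleton n y) \<pi>) sequentially"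
    using kantorovich_dist_nonneg[OF borel_distribution_skeleton \<pi>] by simp
  have "kantorovich_dist (skeleton n y) \<pi> \<le> B n + kantorovich_dist (skeleton n x) \<pi>" for n
    using kantorovich_dist_triangle[OF borel_distribution_skeleton borel_distribution_skeleton \<pi>, of n y n x]
      contraction[of n y x]
    by (simp add: B_def)
  then show "eventually (\<lambda>n. kantorovich_dist (skeleton n y) \<pi> \<le> B n
      + kantorovich_dist (skeleton n x) \<pi>) sequentially"
    by simp
  have "B \<longlonglongrightarrow> 0"
    unfolding B_def using phi_v_pos[of x] phi_v_pos[of y] by (intro contraction_bound_tendsto_0) simp
  from tendsto_add[OF this lim] show "(\<lambda>n. B n + kantorovich_dist (skeleton n x) \<pi>) \<longlonglongrightarrow> 0" by simp
qed

context
  fixes \<pi>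
  assumes \<pi>: "borel_distribution \<pi>" and lim: "\<And>x. (\<lambda>n. kantorovich_dist (skeleton n x) \<pi>) \<longlonglongrightarrow> 0"
begin

text \<open>Along a subsequence of times the mean of \<open>\<phi> \<circ> v\<close> is at most \<open>2 K\<^sub>2\<close>, whatever the starting point.\<close>
lemma kantorovich_dist_skeleton_limit_le:
  "kantorovich_dist (skeleton n x) \<pi> \<le> C * ((\<phi> (v x) + 2 * K\<^sub>2) / rate (\<beta> * real n)) powr \<delta>"
proof (rule field_le_epsilon)
  fix \<epsilon> :: real assume "0 < \<epsilon>"
  then have "eventually (\<lambda>k. kantorovich_dist (skeleton k x) \<pi> < \<epsilon>) sequentially"
    using lim by (intro order_tendstoD) auto
  then obtain N where N: "\<And>k. N \<le> k \<Longrightarrow> kantorovich_dist (skeleton k x) \<pi> < \<epsilon>" by (auto simp: eventually_sequentially)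
  obtain d where d: "N \<le> d" "expect (real d * h) (\<lambda>y. \<phi> (v y)) x \<le> 2 * K\<^sub>2"
    by (rule linear_sum_bound_imp_frequently_small[of "\<lambda>k. expect (real k * h) (\<lambda>y. \<phi> (v y)) x" K\<^sub>2 "v x / \<eta>" N])
       (use h_pos in \<open>auto intro: expect_phi_v_nonneg K\<^sub>2_pos sum_expect_phi_v_le\<close>)
  have "kantorovich_dist (skeleton n x) (skeleton (d + n) x) \<le> C * ((\<phi> (v x) + 2 * K\<^sub>2) / rate (\<beta> * real n)) powr \<delta>"
    using contraction_shift[OF d(2), of n]
      kantorovich_dist_commute[OF borel_distribution_skeleton borel_distribution_skeleton, of n x "d + n" x]
    by (simp add: add.commute)
  then show "kantorovich_dist (skeleton n x) \<pi> \<le> C * ((\<phi> (v x) + 2 * K\<^sub>2) / rate (\<beta> * real n)) powr \<delta> + \<epsilon>"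
    using N[of "d + n"] d(1)
      kantorovich_dist_triangle[OF borel_distribution_skeleton borel_distribution_skeleton \<pi>, of n x "d + n" x]
    by simp
qed

lemma skeleton_invariant_unique:
  assumes \<pi>': "borel_distribution \<pi>'" and invariant: "\<pi>' \<bind> P h = \<pi>'"
  shows "\<pi>' = \<pi>"
proof (rule kantorovich_dist_eq_0_imp_eq[OF \<pi>' \<pi>])
  interpret borel_distribution \<pi>' by (rule \<pi>')
  define B where "B n x = min 1 (C * ((\<phi> (v x) + 2 * K\<^sub>2) / rate (\<beta> * real n)) powr \<delta>)" for n x
  have [measurable]: "(\<lambda>x. \<phi> (v x)) \<in> borel_measurable borel" using semigroup_integrableD(1)[OF phi_v_integrable] .
  have B_meas [measurable]: "B n \<in> borel_measurable \<pi>'" for n unfolding B_def by measurable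
  have B_abs: "norm (B n x) \<le> 1" for n x using C_ge_1 by (simp add: B_def)
  have B_integrable: "integrable \<pi>' (B n)" for n using B_abs by (intro integrable_const_bound[where B=1]) auto
  have dist_le: "kantorovich_dist (skeleton n x) \<pi> \<le> B n x" for n x
    using kantorovich_dist_skeleton_limit_le[of n x] kantorovich_dist_le_1[OF borel_distribution_skeleton \<pi>, of n x]
    by (simp add: B_def)
  have "\<pi>' \<bind> skeleton n = \<pi>'" for n
  proof (induction n)
    case 0
    have "\<pi>' \<bind> P 0 = \<pi>' \<bind> return borel" by (simp add: P_0[abs_def])
    then show ?case by (simp add: bind_return'')
  next
    case (Suc n)
    have "\<pi>' \<bind> skeleton (Suc n) = (\<pi>' \<bind> skeleton n) \<bind> P h"
      using h_pos bind_P_bind_P[OF \<pi>', of "real n * h" h] by (simp add: distrib_right add.commute)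
    then show ?case using Suc invariant by simp
  qed
  then have bound: "kantorovich_dist \<pi>' \<pi> \<le> (\<integral>x. B n x \<partial>\<pi>')" for n
    using kantorovich_dist_bind_le[OF \<pi>' \<pi> kernel_P B_integrable dist_le, of n] h_pos by simp
  have "(\<lambda>n. B n x) \<longlonglongrightarrow> min 1 0" for x
    unfolding B_def using phi_v_pos[of x] K\<^sub>2_pos
    by (intro tendsto_min tendsto_const contraction_bound_tendsto_0) simp
  then have "(\<lambda>n. \<integral>x. B n x \<partial>\<pi>') \<longlonglongrightarrow> (\<integral>x. 0 \<partial>\<pi>')"
    using B_abs by (intro integral_dominated_convergence[where w="\<lambda>_. 1"]) auto
  then show "kantorovich_dist \<pi>' \<pi> \<le> 0" using bound by (intro LIMSEQ_le_const[where X="\<lambda>n. \<integral>x. B n x \<partial>\<pi>'"]) auto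
qed

end

end

section \<open>Invariant measure and rate of convergence\<close>

context markov_semigroup
begin

lemma invariant_prob_iff: "invariant_prob P \<pi> \<longleftrightarrow> borel_distribution \<pi> \<and> (\<forall>t\<ge>0. \<pi> \<bind> P t = \<pi>)"
proof (cases "borel_distribution \<pi>")
  case True
  then interpret borel_distribution \<pi> .
  have "\<pi> \<bind> P t = \<pi> \<longleftrightarrow> (\<forall>A\<in>sets borel. (\<integral>\<^sup>+x. emeasure (P t x) A \<partial>\<pi>) = emeasure \<pi> A)" if "0 \<le> t" for t
  proof -
    interpret bind: borel_distribution "\<pi> \<bind> P t" by (rule borel_distribution_bind_P[OF that True])
    have "\<pi> \<bind> P t = \<pi> \<longleftrightarrow> (\<forall>A\<in>sets borel. emeasure (\<pi> \<bind> P t) A = emeasure \<pi> A)"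
      by (auto intro: measure_eqI)
    then show ?thesis using emeasure_bind_P[OF that True] by simp
  qed
  then show ?thesis using True prob_space_axioms by (simp add: invariant_prob_def)
qed (auto simp: invariant_prob_def borel_distribution_def borel_distribution_axioms_def)

end

context subgeometric_chain
begin

lemma unique_invariant_prob:
  assumes "feller P"
  obtains \<pi> where "invariant_prob P \<pi>" "\<And>\<pi>'. invariant_prob P \<pi>' \<Longrightarrow> \<pi>' = \<pi>"
    "\<And>x. (\<lambda>n. kantorovich_dist (skeleton n x) \<pi>) \<longlonglongrightarrow> 0"
proof -
  obtain \<pi> where \<pi>: "borel_distribution \<pi>" and invariant: "\<pi> \<bind> P h = \<pi>"
    and lim_undefined: "(\<lambda>n. kantorovich_dist (skeleton n undefined) \<pi>) \<longlonglongrightarrow> 0"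
    by (rule skeleton_converges[OF assms])
  note lim = skeleton_limit_independent[OF \<pi> lim_undefined]
  note unique = skeleton_invariant_unique[OF \<pi> lim]
  show ?thesis
  proof (rule that[OF _ _ lim])
    have "\<pi> \<bind> P t = \<pi>" if "0 \<le> t" for t
    proof (rule unique)
      show "borel_distribution (\<pi> \<bind> P t)" by (rule borel_distribution_bind_P[OF that \<pi>])
      show "(\<pi> \<bind> P t) \<bind> P h = \<pi> \<bind> P t"
        using bind_P_bind_P[OF \<pi>, of t h] bind_P_bind_P[OF \<pi>, of h t] that h_pos invariant by (simp add: add.commute)
    qed
    then show "invariant_prob P \<pi>" using \<pi> by (simp add: invariant_prob_iff)
    show "\<pi>' = \<pi>" if "invariant_prob P \<pi>'" for \<pi>'
      using that h_pos by (intro unique) (auto simp: invariant_prob_iff)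
  qed
qed

context
  fixes \<pi> and a :: real and U :: "'a \<Rightarrow> real"
  assumes \<pi>: "borel_distribution \<pi>" and lim: "\<And>x. (\<lambda>n. kantorovich_dist (skeleton n x) \<pi>) \<longlonglongrightarrow> 0"
    and moment: "\<And>s x. 0 \<le> s \<Longrightarrow> s \<le> h \<Longrightarrow> expect s (\<lambda>y. \<phi> (v y)) x \<le> a * (1 + U x)"
    and U: "\<And>x. 0 \<le> U x" and a: "0 < a"
begin

lemma kantorovich_dist_limit_le_skeleton_rate:
  assumes s: "0 \<le> s" "s \<le> h" and r: "0 < r" "r \<le> rate (\<beta> * real n)"
  shows "kantorovich_dist (P (s + real n * h) x) \<pi> \<le> C * (a + 2 * K\<^sub>2) powr \<delta> * (1 + U x powr \<delta>) / r powr \<delta>"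
proof -
  define b where "b = a + 2 * K\<^sub>2"
  have b: "0 < b" using a K\<^sub>2_pos by (simp add: b_def)
  have "kantorovich_dist (P (s + real n * h) x) \<pi> = kantorovich_dist (P s x \<bind> skeleton n) \<pi>"
    using s h_pos by (simp add: P_add)
  also have "\<dots> \<le> C * ((a * (1 + U x) + 2 * K\<^sub>2) / rate (\<beta> * real n)) powr \<delta>"
    using h_pos s \<delta> C_ge_1 moment K\<^sub>2_pos
    by (intro kantorovich_dist_bind_powr_le[OF borel_distribution_P \<pi> kernel_P semigroup_integrableD(2)[OF phi_v_integrable]]
        kantorovich_dist_skeleton_limit_le[OF \<pi> lim] rate_skeleton_pos less_imp_le[OF phi_v_pos]) auto
  also have "\<dots> \<le> C * ((b * (1 + U x)) / r) powr \<delta>"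
  proof (intro mult_left_mono powr_mono2 frac_le)
    show "a * (1 + U x) + 2 * K\<^sub>2 \<le> b * (1 + U x)" "0 \<le> b * (1 + U x)"
      "0 \<le> (a * (1 + U x) + 2 * K\<^sub>2) / rate (\<beta> * real n)"
      using U[of x] K\<^sub>2_pos a b rate_skeleton_pos[of n] by (auto simp: b_def algebra_simps)
  qed (use r C_ge_1 \<delta> in auto)
  also have "\<dots> = C * b powr \<delta> * (1 + U x) powr \<delta> / r powr \<delta>"
    using b U[of x] r by (simp add: powr_mult powr_divide)
  also have "\<dots> \<le> C * b powr \<delta> * (1 + U x powr \<delta>) / r powr \<delta>"
    using C_ge_1 U[of x] \<delta> powr_add_le[of 1 "U x" \<delta>] by (intro divide_right_mono mult_left_mono) auto
  finally show ?thesis by (simp add: b_def)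
qed

lemma kantorovich_dist_limit_le_rate:
  obtains C\<^sub>1 C\<^sub>2 where "0 < C\<^sub>1" "0 < C\<^sub>2"
    "\<And>t x. 0 \<le> t \<Longrightarrow> kantorovich_dist (P t x) \<pi> \<le> C\<^sub>1 * (1 + U x powr \<delta>) / rate (C\<^sub>2 * t) powr \<delta>"
proof -
  define C\<^sub>2 where "C\<^sub>2 = \<beta> / (2 * h)"
  define C\<^sub>1 where "C\<^sub>1 = C * (a + 2 * K\<^sub>2) powr \<delta> + rate (C\<^sub>2 * h) powr \<delta>"
  have C\<^sub>2: "0 < C\<^sub>2" using \<beta>_pos h_pos by (simp add: C\<^sub>2_def)
  have C\<^sub>1: "0 < C\<^sub>1" "C * (a + 2 * K\<^sub>2) powr \<delta> \<le> C\<^sub>1" "rate (C\<^sub>2 * h) powr \<delta> \<le> C\<^sub>1"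
    using C_ge_1 a K\<^sub>2_pos by (auto simp: C\<^sub>1_def intro: add_pos_nonneg)
  show ?thesis
  proof (rule that[OF C\<^sub>1(1) C\<^sub>2])
    fix t x assume t: "0 \<le> (t::real)"
    have rate_t: "0 < rate (C\<^sub>2 * t)" using C\<^sub>2 t by (intro rate_pos) simp
    have "kantorovich_dist (P t x) \<pi> * rate (C\<^sub>2 * t) powr \<delta> \<le> C\<^sub>1 * (1 + U x powr \<delta>)"
    proof (cases "t < h")
      case True
      have "kantorovich_dist (P t x) \<pi> * rate (C\<^sub>2 * t) powr \<delta> \<le> 1 * rate (C\<^sub>2 * h) powr \<delta>"
        using True t C\<^sub>2 \<delta> rate_t
        by (intro mult_mono powr_mono2 rate_mono kantorovich_dist_le_1 borel_distribution_P \<pi>) auto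
      also have "\<dots> \<le> C\<^sub>1 * (1 + U x powr \<delta>)" using C\<^sub>1 by (simp add: distrib_left add_increasing2)
      finally show ?thesis .
    next
      case False
      define n where "n = nat \<lfloor>t / h\<rfloor>"
      have "1 \<le> t / h" using False h_pos by simp
      then have n: "real n \<le> t / h" "t / h < real n + 1" "1 \<le> n" by (auto simp: n_def le_nat_floor)
      then have time: "real n * h \<le> t" "t \<le> real n * h + h" using h_pos by (auto simp: field_simps)
      have "1 * h \<le> real n * h" using n(3) h_pos by (intro mult_right_mono) auto
      then have "t \<le> 2 * (real n * h)" using time(2) by linarith
      then have "rate (C\<^sub>2 * t) \<le> rate (\<beta> * real n)"
        using t C\<^sub>2 \<beta>_pos h_pos by (intro rate_mono) (auto simp: C\<^sub>2_def field_simps)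
      then have "kantorovich_dist (P t x) \<pi> \<le> C * (a + 2 * K\<^sub>2) powr \<delta> * (1 + U x powr \<delta>) / rate (C\<^sub>2 * t) powr \<delta>"
        using kantorovich_dist_limit_le_skeleton_rate[of "t - real n * h" "rate (C\<^sub>2 * t)" n x] time rate_t by simp
      then have "kantorovich_dist (P t x) \<pi> * rate (C\<^sub>2 * t) powr \<delta> \<le> C * (a + 2 * K\<^sub>2) powr \<delta> * (1 + U x powr \<delta>)"
        using rate_t by (simp add: pos_le_divide_eq)
      also have "\<dots> \<le> C\<^sub>1 * (1 + U x powr \<delta>)" using C\<^sub>1(2) by (intro mult_right_mono) auto
      finally show ?thesis .
    qed
    then show "kantorovich_dist (P t x) \<pi> \<le> C\<^sub>1 * (1 + U x powr \<delta>) / rate (C\<^sub>2 * t) powr \<delta>"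
      using rate_t by (simp add: pos_le_divide_eq)
  qed
qed

end

end

context harris_chain
begin

lemma subgeometric_chain_exists:
  assumes "0 < \<delta>" "\<delta> < 1"
  obtains C \<beta> where "subgeometric_chain P \<phi> h A M K\<^sub>1 \<eta> v \<delta> C \<beta>"
proof -
  obtain C \<beta> where "1 \<le> C" "0 < \<beta>" "\<And>n x y. kantorovich_dist (skeleton n x) (skeleton n y)
      \<le> C * ((\<phi> (v x) + \<phi> (v y)) / rate (\<beta> * real n)) powr \<delta>"
    using subgeometric_contraction[OF assms] by blast
  then have "subgeometric_chain P \<phi> h A M K\<^sub>1 \<eta> v \<delta> C \<beta>" using assms by unfold_locales
  then show ?thesis by (rule that)
qed

end

context lyapunov_semigroup
begin

lemma harris_chain_exists:
  assumes \<theta>: "premetric \<theta>" "\<And>x y. trunc_dist x y \<le> \<theta> x y" and A: "assumption_A TYPE('w) P \<theta> r L"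
    and t0: "0 < t0" and B1: "\<And>M. 0 < M \<Longrightarrow> assumption_B1 P \<theta> {x. V x \<le> M} t0"
  obtains h B M K\<^sub>1 \<eta> N \<kappa> where "harris_chain P \<phi> h B M K\<^sub>1 \<eta> (skeleton_V B h) \<theta> N \<kappa>"
proof -
  obtain N T where N: "1 \<le> N" and T: "0 \<le> T"
    and local: "\<And>x y. osc_contracting (t0 + T) (trunc_scale N \<theta>) (trunc_scale (N / 2) \<theta> x y) x y"
    and small: "\<And>M. 0 < M \<Longrightarrow> \<exists>\<kappa>. 0 < \<kappa> \<and> \<kappa> < 1 \<and>
      (\<forall>x y. V x \<le> M \<longrightarrow> V y \<le> M \<longrightarrow> osc_contracting (t0 + T) (trunc_scale N \<theta>) (1 - \<kappa>) x y)"
    using osc_contracting_skeleton[OF A \<theta>(1) less_imp_le[OF t0] B1] by blast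
  define h where "h = t0 + T"
  have h: "0 < h" using t0 T by (simp add: h_def)
  obtain B M K\<^sub>1 \<eta> where drift: "drift_chain P \<phi> h B M K\<^sub>1 \<eta> (skeleton_V B h)" by (rule drift_chain_exists[OF h])
  interpret drift_chain P \<phi> h B M K\<^sub>1 \<eta> "skeleton_V B h" by (rule drift)
  obtain \<kappa> where "0 < \<kappa>" "\<kappa> < 1"
    "\<And>x y. V x \<le> M \<Longrightarrow> V y \<le> M \<Longrightarrow> osc_contracting h (trunc_scale N \<theta>) (1 - \<kappa>) x y"
    using small[OF M_pos] unfolding h_def by blast
  moreover have "V x \<le> M" if "skeleton_V B h x \<le> M" for x
    using skeleton_V_ge(2)[OF h, of B x] A_ge_1 that by simp
  ultimately have "harris_chain P \<phi> h B M K\<^sub>1 \<eta> (skeleton_V B h) \<theta> N \<kappa>"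
    using \<theta> N local by unfold_locales (auto simp: h_def)
  then show ?thesis by (rule that)
qed

theorem subgeometric_ergodicity:
  assumes "feller P" and "premetric \<theta>" "\<And>x y. trunc_dist x y \<le> \<theta> x y" and "assumption_A TYPE('w) P \<theta> r L"
    and "0 < t0" "\<And>M. 0 < M \<Longrightarrow> assumption_B1 P \<theta> {x. V x \<le> M} t0"
  obtains \<pi> where "invariant_prob P \<pi>" "\<And>\<pi>'. invariant_prob P \<pi>' \<Longrightarrow> \<pi>' = \<pi>"
    "\<And>\<delta>. 0 < \<delta> \<Longrightarrow> \<delta> < 1 \<Longrightarrow> \<exists>C\<^sub>1>0. \<exists>C\<^sub>2>0. \<forall>x. \<forall>t\<ge>0. wasserstein (\<lambda>x y. min (dist x y) 1) (P t x) \<pi>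
      \<le> ennreal (C\<^sub>1 * (1 + \<phi> (V x) powr \<delta>) / rate (C\<^sub>2 * t) powr \<delta>)"
proof -
  obtain h B M K\<^sub>1 \<eta> N \<kappa> where harris: "harris_chain P \<phi> h B M K\<^sub>1 \<eta> (skeleton_V B h) \<theta> N \<kappa>"
    by (rule harris_chain_exists[OF assms(2-6)])
  interpret harris_chain P \<phi> h B M K\<^sub>1 \<eta> "skeleton_V B h" \<theta> N \<kappa> by (rule harris)
  obtain C \<beta> where half: "subgeometric_chain P \<phi> h B M K\<^sub>1 \<eta> (skeleton_V B h) (1 / 2) C \<beta>"
    using subgeometric_chain_exists[of "1 / 2"] by auto
  obtain \<pi> where invariant: "invariant_prob P \<pi>" and unique: "\<And>\<pi>'. invariant_prob P \<pi>' \<Longrightarrow> \<pi>' = \<pi>"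
    and lim: "\<And>x. (\<lambda>n. kantorovich_dist (P (real n * h) x) \<pi>) \<longlonglongrightarrow> 0"
    using subgeometric_chain.unique_invariant_prob[OF half assms(1)] by blast
  obtain a where a: "0 < a" "\<And>s x. 0 \<le> s \<Longrightarrow> s \<le> h \<Longrightarrow> expect s (\<lambda>y. \<phi> (skeleton_V B h y)) x \<le> a * (1 + \<phi> (V x))"
    using expect_phi_skeleton_V_le[OF h_pos, of B] A_ge_1 by auto
  show ?thesis
  proof (rule that[OF invariant unique])
    fix \<delta> :: real assume "0 < \<delta>" "\<delta> < 1"
    then obtain C \<beta> where chain: "subgeometric_chain P \<phi> h B M K\<^sub>1 \<eta> (skeleton_V B h) \<delta> C \<beta>"
      by (rule subgeometric_chain_exists)
    have \<pi>: "borel_distribution \<pi>" using invariant by (simp add: invariant_prob_iff)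
    obtain C\<^sub>1 C\<^sub>2 where "0 < C\<^sub>1" "0 < C\<^sub>2" and bound:
      "\<And>t x. 0 \<le> t \<Longrightarrow> kantorovich_dist (P t x) \<pi> \<le> C\<^sub>1 * (1 + \<phi> (V x) powr \<delta>) / rate (C\<^sub>2 * t) powr \<delta>"
      using subgeometric_chain.kantorovich_dist_limit_le_rate[OF chain \<pi> lim a(2) phi_V_nonneg a(1)] by blast
    moreover have "wasserstein (\<lambda>x y. min (dist x y) 1) (P t x) \<pi>
        \<le> ennreal (C\<^sub>1 * (1 + \<phi> (V x) powr \<delta>) / rate (C\<^sub>2 * t) powr \<delta>)" if "0 \<le> t" for t x
      using wasserstein_le_kantorovich_dist[OF borel_distribution_P[OF that] \<pi>, of x] bound[OF that, of x]
      by (meson ennreal_leI order_trans)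
    ultimately show "\<exists>C\<^sub>1>0. \<exists>C\<^sub>2>0. \<forall>x. \<forall>t\<ge>0. wasserstein (\<lambda>x y. min (dist x y) 1) (P t x) \<pi>
      \<le> ennreal (C\<^sub>1 * (1 + \<phi> (V x) powr \<delta>) / rate (C\<^sub>2 * t) powr \<delta>)" by blast
  qed
qed

end

theorem theorem2p7:
  fixes P :: "real \<Rightarrow> 'a::polish_space \<Rightarrow> 'a measure"
    and V :: "'a \<Rightarrow> real" and \<phi> :: "real \<Rightarrow> real" and K :: real
    and \<theta> :: "'a \<Rightarrow> 'a \<Rightarrow> real" and r L :: "real \<Rightarrow> real" and t0 :: real
  assumes markov: "markov_tf P"
    and feller: "feller P"
    and V_meas: "V \<in> borel_measurable borel" and V_nonneg: "\<forall>x. V x \<ge> 0"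
    and phi_concave: "concave_on {0..} \<phi>"
    and phi_diff: "\<forall>s\<ge>0. \<phi> differentiable (at s within {0..})"
    and phi_nonneg: "\<forall>s\<ge>0. \<phi> s \<ge> 0"
    and phi_mono: "mono_on {0..} \<phi>"
    and phi_infty: "filterlim \<phi> at_top at_top"
    and phi_0: "\<phi> 0 = 0"
    and K_pos: "K > 0"
    and lyapunov: "\<forall>t\<ge>0. \<forall>x.
        (\<integral>\<^sup>+ y. ennreal (V y) \<partial>P t x)
          + (\<integral>\<^sup>+ s\<in>{0..t}. (\<integral>\<^sup>+ y. ennreal (\<phi> (V y)) \<partial>P s x) \<partial>lborel)
        \<le> ennreal (V x + K * t)"
    and theta_premetric: "premetric \<theta>"
    and theta_ge: "\<forall>x y. min (dist x y) 1 \<le> \<theta> x y"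
    and assmA: "assumption_A TYPE('w) P \<theta> r L"
    and t0_pos: "t0 > 0"
    and assmB1: "\<forall>M>0. assumption_B1 P \<theta> {x. V x \<le> M} t0"
  shows "\<exists>\<pi>. invariant_prob P \<pi> \<and> (\<forall>\<pi>'. invariant_prob P \<pi>' \<longrightarrow> \<pi>' = \<pi>) \<and>
     (\<forall>\<delta>. 0 < \<delta> \<and> \<delta> < 1 \<longrightarrow> (\<exists>C1>0. \<exists>C2>0. \<forall>x. \<forall>t\<ge>0.
        wasserstein (\<lambda>x y. min (dist x y) 1) (P t x) \<pi>
          \<le> ennreal (C1 * (1 + \<phi> (V x) powr \<delta>) / \<phi> (H_phi_inv \<phi> (C2 * t)) powr \<delta>)))"
proof -
  interpret lyapunov_semigroup P \<phi> V K
  proof unfold_locales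
    show "\<phi> differentiable at s" if "s > 0" for s
      using phi_diff[rule_format, of s] that at_within_interior[of s "{0..}"] by simp
  qed (use markov phi_concave phi_mono phi_infty phi_0 V_meas V_nonneg K_pos lyapunov in auto)
  obtain \<pi> where "invariant_prob P \<pi>" "\<And>\<pi>'. invariant_prob P \<pi>' \<Longrightarrow> \<pi>' = \<pi>"
    "\<And>\<delta>. 0 < \<delta> \<Longrightarrow> \<delta> < 1 \<Longrightarrow> \<exists>C\<^sub>1>0. \<exists>C\<^sub>2>0. \<forall>x. \<forall>t\<ge>0. wasserstein (\<lambda>x y. min (dist x y) 1) (P t x) \<pi>
      \<le> ennreal (C\<^sub>1 * (1 + \<phi> (V x) powr \<delta>) / rate (C\<^sub>2 * t) powr \<delta>)"
    using subgeometric_ergodicity[OF feller theta_premetric _ assmA t0_pos] theta_ge assmB1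
    unfolding trunc_dist_def by blast
  then show ?thesis unfolding rate_def by blast
qed

end
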